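(* Let $f\colon\mathbf C\to\mathbf D$ be one of the forgetful functors $\mathbf G_{\mathrm{sc}}\to\mathbf U_0$, $\mathbf U_{/\mathfrak o}\to\mathbf U$, $\widetilde{\mathbf U}_{/\mathfrak o}\to\widetilde{\mathbf U}$. Then the left Kan extension functor $f_!\colon\widehat{\mathbf C}\to\widehat{\mathbf D}$ preserves Segal objects.
   Context: $\widehat{\mathbf C}=\mathrm{Fun}(\mathbf C^{\mathrm{op}},\mathbf{Set})$; $f_!$ is the left adjoint of the restriction $f^*$. **Graphs.** A graph $G$ consists of finite sets $A_G$ (arcs) and $V_G$ (vertices), a fixpoint-free involution $a\mapsto a^\dagger$ on $A_G$, a subset $D_G\subseteq A_G$, and a function $t\colon D_G\to V_G$. For $v\in V_G$, $\mathrm{nb}(v)=t^{-1}(v)$; the boundary is $\partial(G)=A_G\setminus D_G$; edges are $\dagger$-orbits $[a,a^\dagger]$, and an edge is internal if $a,a^\dagger\in D_G$. Connected means non-empty and not a disjoint union of two non-empty graphs. The edge graph $\updownarrow$ has two arcs interchanged by $\dagger$ and $D=V=\varnothing$; the $n$-star $\star_n$ ($n\ge0$) has one vertex, $D=\{1,\dots,n\}$, $A=\{1,1^\dagger,\dots,n,n^\dagger\}$. A tree is a connected graph that is simply connected (contains no cycles); equivalently, a connected graph with $V_G=\varnothing$, or with exactly $|V_G|-1$ internal edges. An étale map $f\colon H\to G$ consists of functions on $A$, $D$, $V$ compatible with all structure, restricting to bijections $\mathrm{nb}(v)\to\mathrm{nb}(f(v))$. An embedding is an étale map between connected graphs, injective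 on vertices. $\mathrm{Emb}(G)$ is the set of classes $[f]$ of embeddings with codomain $G$ ($f\sim h$ iff $f=hz$, $z$ an isomorphism); $[f\colon H\to G]$ is an edge if $H\cong\updownarrow$; $\varsigma[f]=f(V_H)$, $\partial([f])=f(\partial(H))$. For $v\in V_G$, $\iota_v\colon\star_v\to G$ is the canonical embedding, with $\star_v$ having vertex set $\{v\}$, $D_{\star_v}=\mathrm{nb}(v)$, arc set $\mathrm{nb}(v)\amalg\{b_d\}_{d\in\mathrm{nb}(v)}$, $d^\dagger=b_d$, $\iota_v(d)=d$, $\iota_v(b_d)=d^\dagger$. A nodeless loop is an additional kind of connected graph $K$, with two arcs, $D_K=V_K=\varnothing$, and $\partial(K)=\varnothing$ by definition. The only embeddings with domain $K$ are isomorphisms of nodeless loops; $\mathrm{Emb}(K)=\{[\updownarrow],[\mathrm{id}_K]\}$ with $\partial([\updownarrow])=A_K$, $\partial([\mathrm{id}_K])=\varnothing$. **$\mathbf U$, $\widetilde{\mathbf U}$, $\mathbf U_0$.** $\mathbf U$ has as objects connected graphs (not nodeless loops); a morphism $\varphi\colon G\to G'$ is a pair of an involutive function $\varphi_0\colon A_G\to A_{G'}$ and a function $\varphi_1\colon V_G\to\mathrm{Emb}(G')$ such that: (a) the sets $\varsigma(\varphi_1(v))$ are pairwise disjoint; (b) for each $v$, $a\mapsto\varphi_0(a^\dagger)$ gives a bijection $\mathrm{nb}(v)\to\partial(\varphi_1(v))$; (c) if $\partial(G)=\varnothing$, there is $v$ with $\varphi_1(v)$ not an edge. $\widetilde{\mathbf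 U}$ has in addition the nodeless loops as objects, and (c) is replaced by: if $\partial(G)=\varnothing$ and every $\varphi_1(v)$ is an edge, then $G'$ is a nodeless loop. In both, the composite of $\varphi\colon G\to G'$ and $\psi\colon G'\to G''$ has $(\psi\varphi)_0=\psi_0\varphi_0$, and $(\psi\varphi)_1(v)$ is the unique class in $\mathrm{Emb}(G'')$ with boundary $\psi_0(\partial(\varphi_1(v)))$ and vertex set $\coprod_{w\in\varsigma(\varphi_1(v))}\varsigma(\psi_1(w))$. An embedding $f\colon H\to G$ is regarded as the graphical map given by $f$ on arcs and $v\mapsto[\iota_{f(v)}]$; these are the inert maps. $\mathbf U_0\subset\mathbf U$ is the full subcategory on trees. **Oriented versions.** For $\mathbf D=\mathbf U$ or $\widetilde{\mathbf U}$, $\mathbf D_{/\mathfrak o}$ has objects pairs $(G,x)$ with $G\in\mathbf D$ and $x\colon A_G\to\{+1,-1\}$, $x(a^\dagger)=-x(a)$; morphisms $(G,x)\to(G',x')$ are the graphical maps with $x'\varphi_0=x$. $\mathbf G_{\mathrm{sc}}$ (the dioperadic graphical category) is the full subcategory of $\mathbf U_{/\mathfrak o}$ on the $(G,x)$ with $G$ a tree. The forgetful functors forget $x$. In each category a map is inert if its underlying graphical map is inert. **Segal presheaves.** For any of these categories $\mathbf C$, an object is elementary if its underlying undirected graph is isomorphic to $\updownarrow$ or to some $\star_n$ (nodeless loops are not elementary). $\mathbf C^{\mathrm{el}}_{/c}$ is the category of inert maps $w\to c$ in $\mathbf C$ with $w$ elementary, and (inert) maps over $c$. $Z\in\widehat{\mathbf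 C}$ is Segal if for every $c\in\mathbf C$ the canonical map $Z_c\to\lim_{(w\to c)\in(\mathbf C^{\mathrm{el}}_{/c})^{\mathrm{op}}}Z_w$ is a bijection. *)

theory Defs
  imports "HOL-Library.FuncSet"
begin

section \<open>Categories, presheaves, left Kan extension\<close>

record ('o, 'm) cat =
  Ob :: "'o set"
  Hom :: "'o \<Rightarrow> 'o \<Rightarrow> 'm set"
  Id :: "'o \<Rightarrow> 'm"
  Comp :: "'o \<Rightarrow> 'o \<Rightarrow> 'o \<Rightarrow> 'm \<Rightarrow> 'm \<Rightarrow> 'm"

text \<open>\<open>Comp C a b c g f\<close> is \<open>g \<circ> f\<close> for \<open>f : a \<rightarrow> b\<close> and \<open>g : b \<rightarrow> c\<close>.\<close>

definition is_category :: "('o, 'm, 'z) cat_scheme \<Rightarrow> bool" where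
  "is_category C \<longleftrightarrow>
     (\<forall>a\<in>Ob C. Id C a \<in> Hom C a a) \<and>
     (\<forall>a\<in>Ob C. \<forall>b\<in>Ob C. \<forall>c\<in>Ob C. \<forall>f\<in>Hom C a b. \<forall>g\<in>Hom C b c. Comp C a b c g f \<in> Hom C a c) \<and>
     (\<forall>a\<in>Ob C. \<forall>b\<in>Ob C. \<forall>f\<in>Hom C a b. Comp C a a b f (Id C a) = f \<and> Comp C a b b (Id C b) f = f) \<and>
     (\<forall>a\<in>Ob C. \<forall>b\<in>Ob C. \<forall>c\<in>Ob C. \<forall>d\<in>Ob C. \<forall>f\<in>Hom C a b. \<forall>g\<in>Hom C b c. \<forall>h\<in>Hom C c d.
        Comp C a c d h (Comp C a b c g f) = Comp C a b d (Comp C b c d h g) f)"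

record ('o, 'm, 'p, 'n) func =
  FOb :: "'o \<Rightarrow> 'p"
  FMap :: "'o \<Rightarrow> 'o \<Rightarrow> 'm \<Rightarrow> 'n"

definition is_func ::
  "('o, 'm, 'y) cat_scheme \<Rightarrow> ('p, 'n, 'z) cat_scheme \<Rightarrow> ('o, 'm, 'p, 'n) func \<Rightarrow> bool" where
  "is_func C D F \<longleftrightarrow>
     (\<forall>a\<in>Ob C. FOb F a \<in> Ob D \<and> FMap F a a (Id C a) = Id D (FOb F a)) \<and>
     (\<forall>a\<in>Ob C. \<forall>b\<in>Ob C. \<forall>f\<in>Hom C a b. FMap F a b f \<in> Hom D (FOb F a) (FOb F b)) \<and>
     (\<forall>a\<in>Ob C. \<forall>b\<in>Ob C. \<forall>c\<in>Ob C. \<forall>f\<in>Hom C a b. \<forall>g\<in>Hom C b c.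
        FMap F a c (Comp C a b c g f)
          = Comp D (FOb F a) (FOb F b) (FOb F c) (FMap F b c g) (FMap F a b f))"

record ('o, 'm, 'x) psh =
  PSet :: "'o \<Rightarrow> 'x set"
  PMap :: "'o \<Rightarrow> 'o \<Rightarrow> 'm \<Rightarrow> 'x \<Rightarrow> 'x"

text \<open>For \<open>f : a \<rightarrow> b\<close>, \<open>PMap Z a b f\<close> is the restriction map \<open>PSet Z b \<rightarrow> PSet Z a\<close>.\<close>

definition presheaf :: "('o, 'm, 'z) cat_scheme \<Rightarrow> ('o, 'm, 'x) psh \<Rightarrow> bool" where
  "presheaf C Z \<longleftrightarrow>
     (\<forall>a\<in>Ob C. \<forall>b\<in>Ob C. \<forall>f\<in>Hom C a b. \<forall>z\<in>PSet Z b. PMap Z a b f z \<in> PSet Z a) \<and>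
     (\<forall>a\<in>Ob C. \<forall>z\<in>PSet Z a. PMap Z a a (Id C a) z = z) \<and>
     (\<forall>a\<in>Ob C. \<forall>b\<in>Ob C. \<forall>c\<in>Ob C. \<forall>f\<in>Hom C a b. \<forall>g\<in>Hom C b c. \<forall>z\<in>PSet Z c.
        PMap Z a c (Comp C a b c g f) z = PMap Z a b f (PMap Z b c g z))"

definition natural ::
  "('o, 'm, 'z) cat_scheme \<Rightarrow> ('o, 'm, 'x) psh \<Rightarrow> ('o, 'm, 'w) psh \<Rightarrow> ('o \<Rightarrow> 'x \<Rightarrow> 'w) \<Rightarrow> bool" where
  "natural C Z W \<theta> \<longleftrightarrow>
     (\<forall>a\<in>Ob C. \<forall>z\<in>PSet Z a. \<theta> a z \<in> PSet W a) \<and>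
     (\<forall>a\<in>Ob C. \<forall>b\<in>Ob C. \<forall>f\<in>Hom C a b. \<forall>z\<in>PSet Z b.
        \<theta> a (PMap Z a b f z) = PMap W a b f (\<theta> b z))"

definition pullback_psh ::
  "('o, 'm, 'p, 'n) func \<Rightarrow> ('p, 'n, 'x) psh \<Rightarrow> ('o, 'm, 'x) psh" where
  "pullback_psh F W =
     \<lparr>PSet = (\<lambda>a. PSet W (FOb F a)),
      PMap = (\<lambda>a b f. PMap W (FOb F a) (FOb F b) (FMap F a b f))\<rparr>"

text \<open>
  The left Kan extension of \<open>Z\<close> along \<open>F : C \<rightarrow> D\<close> at \<open>d\<close> is the coend
  \<open>\<integral>\<close> over \<open>c\<close> of \<open>Hom D d (F c) \<times> Z c\<close>: triples \<open>(c, \<alpha> : d \<rightarrow> F c, z \<in> Z c)\<close> modulo the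
  equivalence relation generated by \<open>(c, \<alpha>, Z(m) z') \<sim> (c', F(m) \<circ> \<alpha>, z')\<close> for \<open>m : c \<rightarrow> c'\<close>.
  That this is the value of the left adjoint of \<open>pullback_psh F\<close> is proved below
  (\<open>presheaf_lan\<close>, \<open>natural_lan_unit\<close>, \<open>lan_universal\<close>).
\<close>

definition lan_el ::
  "('o, 'm, 'y) cat_scheme \<Rightarrow> ('p, 'n, 'z) cat_scheme \<Rightarrow> ('o, 'm, 'p, 'n) func \<Rightarrow>
   ('o, 'm, 'x) psh \<Rightarrow> 'p \<Rightarrow> ('o \<times> 'n \<times> 'x) set" where
  "lan_el C D F Z d = {(c, \<alpha>, z). c \<in> Ob C \<and> \<alpha> \<in> Hom D d (FOb F c) \<and> z \<in> PSet Z c}"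

definition lan_step ::
  "('o, 'm, 'y) cat_scheme \<Rightarrow> ('p, 'n, 'z) cat_scheme \<Rightarrow> ('o, 'm, 'p, 'n) func \<Rightarrow>
   ('o, 'm, 'x) psh \<Rightarrow> 'p \<Rightarrow> (('o \<times> 'n \<times> 'x) \<times> ('o \<times> 'n \<times> 'x)) set" where
  "lan_step C D F Z d =
     {((c, \<alpha>, PMap Z c c' m z), (c', Comp D d (FOb F c) (FOb F c') (FMap F c c' m) \<alpha>, z)) |c c' m \<alpha> z.
        c \<in> Ob C \<and> c' \<in> Ob C \<and> m \<in> Hom C c c' \<and> \<alpha> \<in> Hom D d (FOb F c) \<and> z \<in> PSet Z c'}"

definition lan_rel ::
  "('o, 'm, 'y) cat_scheme \<Rightarrow> ('p, 'n, 'z) cat_scheme \<Rightarrow> ('o, 'm, 'p, 'n) func \<Rightarrow>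
   ('o, 'm, 'x) psh \<Rightarrow> 'p \<Rightarrow> (('o \<times> 'n \<times> 'x) \<times> ('o \<times> 'n \<times> 'x)) set" where
  "lan_rel C D F Z d =
     (lan_step C D F Z d \<union> (lan_step C D F Z d)\<inverse>)\<^sup>* \<inter> (lan_el C D F Z d \<times> lan_el C D F Z d)"

definition lan ::
  "('o, 'm, 'y) cat_scheme \<Rightarrow> ('p, 'n, 'z) cat_scheme \<Rightarrow> ('o, 'm, 'p, 'n) func \<Rightarrow>
   ('o, 'm, 'x) psh \<Rightarrow> ('p, 'n, ('o \<times> 'n \<times> 'x) set) psh" where
  "lan C D F Z =
     \<lparr>PSet = (\<lambda>d. lan_el C D F Z d // lan_rel C D F Z d),
      PMap = (\<lambda>d d' \<delta> X. lan_rel C D F Z d `` {(c, Comp D d d' (FOb F c) \<alpha> \<delta>, z) |c \<alpha> z. (c, \<alpha>, z) \<in> X})\<rparr>"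

definition lan_unit ::
  "('o, 'm, 'y) cat_scheme \<Rightarrow> ('p, 'n, 'z) cat_scheme \<Rightarrow> ('o, 'm, 'p, 'n) func \<Rightarrow>
   ('o, 'm, 'x) psh \<Rightarrow> 'o \<Rightarrow> 'x \<Rightarrow> ('o \<times> 'n \<times> 'x) set" where
  "lan_unit C D F Z c z = lan_rel C D F Z (FOb F c) `` {(c, Id D (FOb F c), z)}"


lemma lan_el_iff:
  "(c, \<alpha>, z) \<in> lan_el C D F Z d \<longleftrightarrow> c \<in> Ob C \<and> \<alpha> \<in> Hom D d (FOb F c) \<and> z \<in> PSet Z c"
  by (simp add: lan_el_def)

lemma lan_step_el:
  assumes D: "is_category D" and F: "is_func C D F" and Z: "presheaf C Z" and d: "d \<in> Ob D"
    and s: "(x, y) \<in> lan_step C D F Z d"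
  shows "x \<in> lan_el C D F Z d" "y \<in> lan_el C D F Z d"
proof -
  from s obtain c c' m \<alpha> z where *:
    "x = (c, \<alpha>, PMap Z c c' m z)"
    "y = (c', Comp D d (FOb F c) (FOb F c') (FMap F c c' m) \<alpha>, z)"
    "c \<in> Ob C" "c' \<in> Ob C" "m \<in> Hom C c c'" "\<alpha> \<in> Hom D d (FOb F c)" "z \<in> PSet Z c'"
    unfolding lan_step_def by blast
  show "x \<in> lan_el C D F Z d"
    using * Z unfolding presheaf_def by (auto simp: lan_el_iff)
  have "FOb F c \<in> Ob D" "FOb F c' \<in> Ob D" "FMap F c c' m \<in> Hom D (FOb F c) (FOb F c')"
    using * F unfolding is_func_def by auto
  then have "Comp D d (FOb F c) (FOb F c') (FMap F c c' m) \<alpha> \<in> Hom D d (FOb F c')"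
    using D d * unfolding is_category_def by blast
  then show "y \<in> lan_el C D F Z d"
    using * by (simp add: lan_el_iff)
qed

lemma equiv_lan_rel: "equiv (lan_el C D F Z d) (lan_rel C D F Z d)"
proof (rule equivI)
  show "lan_rel C D F Z d \<subseteq> lan_el C D F Z d \<times> lan_el C D F Z d"
    by (auto simp: lan_rel_def)
  show "refl_on (lan_el C D F Z d) (lan_rel C D F Z d)"
    by (auto simp: refl_on_def lan_rel_def)
  have "sym ((lan_step C D F Z d \<union> (lan_step C D F Z d)\<inverse>)\<^sup>*)"
    by (intro sym_rtrancl) (auto simp: sym_def)
  then show "sym (lan_rel C D F Z d)"
    unfolding lan_rel_def sym_def by blast
  show "trans (lan_rel C D F Z d)"
    unfolding lan_rel_def trans_def by (auto intro: rtrancl_trans)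
qed

lemma lan_rel_stepI:
  assumes "is_category D" "is_func C D F" "presheaf C Z" "d \<in> Ob D"
    and "(x, y) \<in> lan_step C D F Z d"
  shows "(x, y) \<in> lan_rel C D F Z d"
  using lan_step_el[OF assms] assms(5) unfolding lan_rel_def by auto

lemma lan_rel_invariant:
  assumes "(x, y) \<in> lan_rel C D F Z d"
    and "\<And>x y. (x, y) \<in> lan_step C D F Z d \<Longrightarrow> h x = h y"
  shows "h x = h y"
proof -
  have "(x, y) \<in> (lan_step C D F Z d \<union> (lan_step C D F Z d)\<inverse>)\<^sup>*"
    using assms(1) by (simp add: lan_rel_def)
  then show ?thesis
    by (induction rule: rtrancl_induct) (auto dest: assms(2))
qed

lemma lan_PSet: "PSet (lan C D F Z) d = lan_el C D F Z d // lan_rel C D F Z d"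
  by (simp add: lan_def)

lemma lan_classI:
  "(c, \<alpha>, z) \<in> lan_el C D F Z d \<Longrightarrow> lan_rel C D F Z d `` {(c, \<alpha>, z)} \<in> PSet (lan C D F Z) d"
  by (simp add: lan_PSet quotientI)

lemma lan_classE:
  assumes "X \<in> PSet (lan C D F Z) d"
  obtains c \<alpha> z where "(c, \<alpha>, z) \<in> lan_el C D F Z d" "X = lan_rel C D F Z d `` {(c, \<alpha>, z)}"
  using assms unfolding lan_PSet by (auto elim!: quotientE)

lemma lan_PMap_class:
  fixes C :: "('a, 'b, 'c) cat_scheme" and D :: "('e, 'd, 'g) cat_scheme" and Z :: "('a, 'b, 'f) psh"
  assumes D: "is_category D" and F: "is_func C D F" and Z: "presheaf C Z"
    and d: "d \<in> Ob D" and d': "d' \<in> Ob D" and \<delta>: "\<delta> \<in> Hom D d d'"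
    and x: "(c, \<alpha>, z) \<in> lan_el C D F Z d'"
  shows "(c, Comp D d d' (FOb F c) \<alpha> \<delta>, z) \<in> lan_el C D F Z d"
    and "PMap (lan C D F Z) d d' \<delta> (lan_rel C D F Z d' `` {(c, \<alpha>, z)})
           = lan_rel C D F Z d `` {(c, Comp D d d' (FOb F c) \<alpha> \<delta>, z)}"
proof -
  let ?p = "\<lambda>(c, \<alpha>, z). (c, Comp D d d' (FOb F c) \<alpha> \<delta>, z)"
  let ?R = "lan_rel C D F Z d" and ?R' = "lan_rel C D F Z d'"
  have el: "?p y \<in> lan_el C D F Z d" if "y \<in> lan_el C D F Z d'" for y
  proof -
    obtain c \<alpha> z where y: "y = (c, \<alpha>, z)" by (cases y)
    then have *: "c \<in> Ob C" "\<alpha> \<in> Hom D d' (FOb F c)" "z \<in> PSet Z c"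
      using that by (auto simp: lan_el_iff)
    then have "FOb F c \<in> Ob D" using F unfolding is_func_def by auto
    then have "Comp D d d' (FOb F c) \<alpha> \<delta> \<in> Hom D d (FOb F c)"
      using D d d' \<delta> * unfolding is_category_def by blast
    then show ?thesis using * y by (simp add: lan_el_iff)
  qed
  then show "(c, Comp D d d' (FOb F c) \<alpha> \<delta>, z) \<in> lan_el C D F Z d"
    using x by force
  have step: "(?p u, ?p v) \<in> lan_step C D F Z d" if "(u, v) \<in> lan_step C D F Z d'" for u v
  proof -
    from that obtain c c' m \<alpha> z where *:
      "u = (c, \<alpha>, PMap Z c c' m z)"
      "v = (c', Comp D d' (FOb F c) (FOb F c') (FMap F c c' m) \<alpha>, z)"
      "c \<in> Ob C" "c' \<in> Ob C" "m \<in> Hom C c c'" "\<alpha> \<in> Hom D d' (FOb F c)" "z \<in> PSet Z c'"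
      unfolding lan_step_def by blast
    have o: "FOb F c \<in> Ob D" "FOb F c' \<in> Ob D" "FMap F c c' m \<in> Hom D (FOb F c) (FOb F c')"
      using * F unfolding is_func_def by auto
    then have "Comp D d d' (FOb F c) \<alpha> \<delta> \<in> Hom D d (FOb F c)"
      using D d d' \<delta> * unfolding is_category_def by blast
    moreover have "Comp D d d' (FOb F c') (Comp D d' (FOb F c) (FOb F c') (FMap F c c' m) \<alpha>) \<delta>
        = Comp D d (FOb F c) (FOb F c') (FMap F c c' m) (Comp D d d' (FOb F c) \<alpha> \<delta>)"
      using D o d d' \<delta> *(6) unfolding is_category_def by metis
    ultimately show ?thesis using * unfolding lan_step_def by auto
  qed
  have rel: "?R `` {?p u} = ?R `` {?p v}" if "(u, v) \<in> ?R'" for u v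
    using that
  proof (rule lan_rel_invariant)
    fix u v assume "(u, v) \<in> lan_step C D F Z d'"
    then have "(?p u, ?p v) \<in> ?R"
      using lan_rel_stepI[OF D F Z d] step by blast
    then show "?R `` {?p u} = ?R `` {?p v}"
      by (rule equiv_class_eq[OF equiv_lan_rel])
  qed
  have self: "(c, \<alpha>, z) \<in> ?R' `` {(c, \<alpha>, z)}"
    using equiv_class_self[OF equiv_lan_rel x] .
  have "PMap (lan C D F Z) d d' \<delta> (?R' `` {(c, \<alpha>, z)}) = ?R `` (?p ` (?R' `` {(c, \<alpha>, z)}))"
  proof -
    have "{(c, Comp D d d' (FOb F c) \<alpha> \<delta>, z) |c \<alpha> z. (c, \<alpha>, z) \<in> X} = ?p ` X"
      for X :: "('a \<times> 'd \<times> 'f) set"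
      by force
    then show ?thesis by (simp only: lan_def psh.simps)
  qed
  also have "\<dots> = (\<Union>u\<in>?R' `` {(c, \<alpha>, z)}. ?R `` {?p u})"
    by blast
  also have "\<dots> = ?R `` {?p (c, \<alpha>, z)}"
    using self rel by blast
  finally show "PMap (lan C D F Z) d d' \<delta> (?R' `` {(c, \<alpha>, z)})
      = ?R `` {(c, Comp D d d' (FOb F c) \<alpha> \<delta>, z)}" by simp
qed

theorem presheaf_lan:
  assumes D: "is_category D" and F: "is_func C D F" and Z: "presheaf C Z"
  shows "presheaf D (lan C D F Z)"
  unfolding presheaf_def
proof (intro conjI ballI)
  fix a b f X assume *: "a \<in> Ob D" "b \<in> Ob D" "f \<in> Hom D a b" "X \<in> PSet (lan C D F Z) b"
  from *(4) obtain c \<alpha> z where X: "(c, \<alpha>, z) \<in> lan_el C D F Z b"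
    "X = lan_rel C D F Z b `` {(c, \<alpha>, z)}" by (rule lan_classE)
  show "PMap (lan C D F Z) a b f X \<in> PSet (lan C D F Z) a"
    using lan_PMap_class[OF D F Z *(1-3) X(1)] X(2) by (simp add: lan_classI)
next
  fix a X assume *: "a \<in> Ob D" "X \<in> PSet (lan C D F Z) a"
  from *(2) obtain c \<alpha> z where X: "(c, \<alpha>, z) \<in> lan_el C D F Z a"
    "X = lan_rel C D F Z a `` {(c, \<alpha>, z)}" by (rule lan_classE)
  have I: "Id D a \<in> Hom D a a" using D * unfolding is_category_def by blast
  have "FOb F c \<in> Ob D" using F X(1) unfolding is_func_def by (auto simp: lan_el_iff)
  then have "Comp D a a (FOb F c) \<alpha> (Id D a) = \<alpha>"
    using D * X(1) unfolding is_category_def by (auto simp: lan_el_iff)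
  then show "PMap (lan C D F Z) a a (Id D a) X = X"
    using lan_PMap_class(2)[OF D F Z *(1) *(1) I X(1)] X(2) by simp
next
  fix a b c' f g X assume *: "a \<in> Ob D" "b \<in> Ob D" "c' \<in> Ob D" "f \<in> Hom D a b" "g \<in> Hom D b c'"
    "X \<in> PSet (lan C D F Z) c'"
  from *(6) obtain c \<alpha> z where X: "(c, \<alpha>, z) \<in> lan_el C D F Z c'"
    "X = lan_rel C D F Z c' `` {(c, \<alpha>, z)}" by (rule lan_classE)
  have o: "FOb F c \<in> Ob D" "\<alpha> \<in> Hom D c' (FOb F c)"
    using F X(1) unfolding is_func_def by (auto simp: lan_el_iff)
  have gf: "Comp D a b c' g f \<in> Hom D a c'" using D * unfolding is_category_def by blast
  have as: "Comp D a c' (FOb F c) \<alpha> (Comp D a b c' g f)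
      = Comp D a b (FOb F c) (Comp D b c' (FOb F c) \<alpha> g) f"
    using D * o unfolding is_category_def by blast
  note g = lan_PMap_class[OF D F Z *(2) *(3) *(5) X(1)]
  show "PMap (lan C D F Z) a c' (Comp D a b c' g f) X
      = PMap (lan C D F Z) a b f (PMap (lan C D F Z) b c' g X)"
    unfolding X(2) g(2) lan_PMap_class(2)[OF D F Z *(1) *(2) *(4) g(1)]
      lan_PMap_class(2)[OF D F Z *(1) *(3) gf X(1)] as ..
qed

theorem natural_lan_unit:
  assumes D: "is_category D" and F: "is_func C D F" and Z: "presheaf C Z"
  shows "natural C Z (pullback_psh F (lan C D F Z)) (lan_unit C D F Z)"
  unfolding natural_def
proof (intro conjI ballI)
  fix a z assume *: "a \<in> Ob C" "z \<in> PSet Z a"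
  then have "FOb F a \<in> Ob D" using F unfolding is_func_def by auto
  then have "Id D (FOb F a) \<in> Hom D (FOb F a) (FOb F a)"
    using D unfolding is_category_def by blast
  then show "lan_unit C D F Z a z \<in> PSet (pullback_psh F (lan C D F Z)) a"
    using * by (auto simp: pullback_psh_def lan_unit_def lan_el_iff intro!: lan_classI)
next
  fix a b f z assume *: "a \<in> Ob C" "b \<in> Ob C" "f \<in> Hom C a b" "z \<in> PSet Z b"
  let ?R = "lan_rel C D F Z (FOb F a)"
  have o: "FOb F a \<in> Ob D" "FOb F b \<in> Ob D" "FMap F a b f \<in> Hom D (FOb F a) (FOb F b)"
    using * F unfolding is_func_def by auto
  then have i: "Id D (FOb F a) \<in> Hom D (FOb F a) (FOb F a)" "Id D (FOb F b) \<in> Hom D (FOb F b) (FOb F b)"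
    "Comp D (FOb F a) (FOb F a) (FOb F b) (FMap F a b f) (Id D (FOb F a)) = FMap F a b f"
    "Comp D (FOb F a) (FOb F b) (FOb F b) (Id D (FOb F b)) (FMap F a b f) = FMap F a b f"
    using D unfolding is_category_def by blast+
  have "((a, Id D (FOb F a), PMap Z a b f z), (b, FMap F a b f, z)) \<in> lan_step C D F Z (FOb F a)"
    using * i(1) i(3)[symmetric] unfolding lan_step_def by blast
  then have "((a, Id D (FOb F a), PMap Z a b f z), (b, FMap F a b f, z)) \<in> ?R"
    using lan_rel_stepI[OF D F Z o(1)] by blast
  then have "?R `` {(a, Id D (FOb F a), PMap Z a b f z)} = ?R `` {(b, FMap F a b f, z)}"
    by (rule equiv_class_eq[OF equiv_lan_rel])
  moreover have "(b, Id D (FOb F b), z) \<in> lan_el C D F Z (FOb F b)"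
    using * i by (simp add: lan_el_iff)
  note lan_PMap_class(2)[OF D F Z o this]
  ultimately show "lan_unit C D F Z a (PMap Z a b f z)
      = PMap (pullback_psh F (lan C D F Z)) a b f (lan_unit C D F Z b z)"
    using i by (simp add: lan_unit_def pullback_psh_def)
qed

theorem lan_universal:
  assumes D: "is_category D" and F: "is_func C D F" and Z: "presheaf C Z"
    and W: "presheaf D W" and \<theta>: "natural C Z (pullback_psh F W) \<theta>"
  shows "\<exists>\<sigma>. natural D (lan C D F Z) W \<sigma> \<and>
      (\<forall>c\<in>Ob C. \<forall>z\<in>PSet Z c. \<sigma> (FOb F c) (lan_unit C D F Z c z) = \<theta> c z) \<and>
      (\<forall>\<sigma>'. natural D (lan C D F Z) W \<sigma>' \<and>
         (\<forall>c\<in>Ob C. \<forall>z\<in>PSet Z c. \<sigma>' (FOb F c) (lan_unit C D F Z c z) = \<theta> c z) \<longrightarrow>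
         (\<forall>d\<in>Ob D. \<forall>X\<in>PSet (lan C D F Z) d. \<sigma>' d X = \<sigma> d X))"
proof -
  define h where "h d x = (case x of (c, \<alpha>, z) \<Rightarrow> PMap W d (FOb F c) \<alpha> (\<theta> c z))" for d x
  define \<sigma> where "\<sigma> d X = h d (SOME x. x \<in> X)" for d X
  have Fob: "FOb F c \<in> Ob D" if "c \<in> Ob C" for c
    using F that unfolding is_func_def by auto
  have th: "\<theta> c z \<in> PSet W (FOb F c)" if "c \<in> Ob C" "z \<in> PSet Z c" for c z
    using \<theta> that unfolding natural_def pullback_psh_def by auto
  have hstep: "h d x = h d y" if d: "d \<in> Ob D" and s: "(x, y) \<in> lan_step C D F Z d" for d x y
  proof -
    from s obtain c c' m \<alpha> z where *:
      "x = (c, \<alpha>, PMap Z c c' m z)"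
      "y = (c', Comp D d (FOb F c) (FOb F c') (FMap F c c' m) \<alpha>, z)"
      "c \<in> Ob C" "c' \<in> Ob C" "m \<in> Hom C c c'" "\<alpha> \<in> Hom D d (FOb F c)" "z \<in> PSet Z c'"
      unfolding lan_step_def by blast
    have "\<theta> c (PMap Z c c' m z) = PMap W (FOb F c) (FOb F c') (FMap F c c' m) (\<theta> c' z)"
      using \<theta> * unfolding natural_def pullback_psh_def by simp
    moreover have "FMap F c c' m \<in> Hom D (FOb F c) (FOb F c')"
      using * F unfolding is_func_def by auto
    then have "PMap W d (FOb F c') (Comp D d (FOb F c) (FOb F c') (FMap F c c' m) \<alpha>) (\<theta> c' z)
        = PMap W d (FOb F c) \<alpha> (PMap W (FOb F c) (FOb F c') (FMap F c c' m) (\<theta> c' z))"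
      using W d * Fob th unfolding presheaf_def by blast
    ultimately show ?thesis using * by (simp add: h_def)
  qed
  have hrel: "h d x = h d y" if "d \<in> Ob D" "(x, y) \<in> lan_rel C D F Z d" for d x y
    using that(2) by (rule lan_rel_invariant) (rule hstep[OF that(1)])
  have \<sigma>: "\<sigma> d (lan_rel C D F Z d `` {x}) = h d x" if "d \<in> Ob D" "x \<in> lan_el C D F Z d" for d x
  proof -
    have "x \<in> lan_rel C D F Z d `` {x}"
      using equiv_class_self[OF equiv_lan_rel that(2)] .
    then have "(SOME y. y \<in> lan_rel C D F Z d `` {x}) \<in> lan_rel C D F Z d `` {x}"
      by (rule someI)
    then have "(x, SOME y. y \<in> lan_rel C D F Z d `` {x}) \<in> lan_rel C D F Z d"
      by simp
    from hrel[OF that(1) this] show ?thesis unfolding \<sigma>_def by simp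
  qed
  have 1: "natural D (lan C D F Z) W \<sigma>"
    unfolding natural_def
  proof (intro conjI ballI)
    fix a X assume *: "a \<in> Ob D" "X \<in> PSet (lan C D F Z) a"
    from *(2) obtain c \<alpha> z where X: "(c, \<alpha>, z) \<in> lan_el C D F Z a"
      "X = lan_rel C D F Z a `` {(c, \<alpha>, z)}" by (rule lan_classE)
    then have e: "c \<in> Ob C" "\<alpha> \<in> Hom D a (FOb F c)" "z \<in> PSet Z c" by (auto simp: lan_el_iff)
    have "PMap W a (FOb F c) \<alpha> (\<theta> c z) \<in> PSet W a"
      using W * e Fob th unfolding presheaf_def by blast
    then show "\<sigma> a X \<in> PSet W a"
      using \<sigma>[OF *(1) X(1)] X(2) by (simp add: h_def)
  next
    fix a b f X assume *: "a \<in> Ob D" "b \<in> Ob D" "f \<in> Hom D a b" "X \<in> PSet (lan C D F Z) b"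
    from *(4) obtain c \<alpha> z where X: "(c, \<alpha>, z) \<in> lan_el C D F Z b"
      "X = lan_rel C D F Z b `` {(c, \<alpha>, z)}" by (rule lan_classE)
    then have e: "c \<in> Ob C" "\<alpha> \<in> Hom D b (FOb F c)" "z \<in> PSet Z c" by (auto simp: lan_el_iff)
    have "PMap W a (FOb F c) (Comp D a b (FOb F c) \<alpha> f) (\<theta> c z)
        = PMap W a b f (PMap W b (FOb F c) \<alpha> (\<theta> c z))"
      using W * e Fob th unfolding presheaf_def by blast
    then show "\<sigma> a (PMap (lan C D F Z) a b f X) = PMap W a b f (\<sigma> b X)"
      unfolding X(2) \<sigma>[OF *(2) X(1)] lan_PMap_class(2)[OF D F Z *(1-3) X(1)]
        \<sigma>[OF *(1) lan_PMap_class(1)[OF D F Z *(1-3) X(1)]]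
      by (simp add: h_def)
  qed
  have 2: "\<sigma> (FOb F c) (lan_unit C D F Z c z) = \<theta> c z" if "c \<in> Ob C" "z \<in> PSet Z c" for c z
  proof -
    have "Id D (FOb F c) \<in> Hom D (FOb F c) (FOb F c)"
      using D Fob[OF that(1)] unfolding is_category_def by blast
    then have "(c, Id D (FOb F c), z) \<in> lan_el C D F Z (FOb F c)"
      using that by (simp add: lan_el_iff)
    from \<sigma>[OF Fob[OF that(1)] this] show ?thesis
      using W Fob th that unfolding presheaf_def lan_unit_def h_def by auto
  qed
  have 3: "\<sigma>' d X = \<sigma> d X"
    if \<sigma>': "natural D (lan C D F Z) W \<sigma>'"
      and u: "\<forall>c\<in>Ob C. \<forall>z\<in>PSet Z c. \<sigma>' (FOb F c) (lan_unit C D F Z c z) = \<theta> c z"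
      and d: "d \<in> Ob D" and X: "X \<in> PSet (lan C D F Z) d" for \<sigma>' d X
  proof -
    from X obtain c \<alpha> z where X: "(c, \<alpha>, z) \<in> lan_el C D F Z d"
      "X = lan_rel C D F Z d `` {(c, \<alpha>, z)}" by (rule lan_classE)
    then have e: "c \<in> Ob C" "\<alpha> \<in> Hom D d (FOb F c)" "z \<in> PSet Z c" by (auto simp: lan_el_iff)
    note o = Fob[OF e(1)]
    have i: "Id D (FOb F c) \<in> Hom D (FOb F c) (FOb F c)"
      using D o unfolding is_category_def by blast
    have i': "Comp D d (FOb F c) (FOb F c) (Id D (FOb F c)) \<alpha> = \<alpha>"
      using D d o e unfolding is_category_def by blast
    have l: "(c, Id D (FOb F c), z) \<in> lan_el C D F Z (FOb F c)"
      using i e by (simp add: lan_el_iff)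
    have "X = PMap (lan C D F Z) d (FOb F c) \<alpha> (lan_unit C D F Z c z)"
      unfolding lan_unit_def lan_PMap_class(2)[OF D F Z d o e(2) l] i' X(2) ..
    moreover have "lan_unit C D F Z c z \<in> PSet (lan C D F Z) (FOb F c)"
      unfolding lan_unit_def using l by (rule lan_classI)
    ultimately have eq: "\<tau> d X = PMap W d (FOb F c) \<alpha> (\<tau> (FOb F c) (lan_unit C D F Z c z))"
      if "natural D (lan C D F Z) W \<tau>" for \<tau>
      using that d o e(2) unfolding natural_def by simp
    show ?thesis
      unfolding eq[OF \<sigma>'] eq[OF 1] using u 2 e by simp
  qed
  show ?thesis
    using 1 2 3 by blast
qed


section \<open>Segal presheaves\<close>

record ('o, 'm) pattern = "('o, 'm) cat" +
  Elem :: "'o set"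
  Inert :: "'o \<Rightarrow> 'o \<Rightarrow> 'm set"

definition el_over :: "('o, 'm, 'z) pattern_scheme \<Rightarrow> 'o \<Rightarrow> ('o \<times> 'm) set" where
  "el_over C c = {(w, i). w \<in> Elem C \<and> i \<in> Inert C w c}"

definition el_lim :: "('o, 'm, 'z) pattern_scheme \<Rightarrow> ('o, 'm, 'x) psh \<Rightarrow> 'o \<Rightarrow> ('o \<times> 'm \<Rightarrow> 'x) set" where
  "el_lim C Z c =
     {s \<in> (\<Pi>\<^sub>E p\<in>el_over C c. PSet Z (fst p)).
        \<forall>w i w' i' m. (w, i) \<in> el_over C c \<and> (w', i') \<in> el_over C c \<and>
           m \<in> Inert C w w' \<and> Comp C w w' c i' m = i \<longrightarrow> PMap Z w w' m (s (w', i')) = s (w, i)}"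

definition segal :: "('o, 'm, 'z) pattern_scheme \<Rightarrow> ('o, 'm, 'x) psh \<Rightarrow> bool" where
  "segal C Z \<longleftrightarrow> presheaf C Z \<and>
     (\<forall>c\<in>Ob C. bij_betw (\<lambda>z. \<lambda>p\<in>el_over C c. PMap Z (fst p) c (snd p) z) (PSet Z c) (el_lim C Z c))"

definition full_subpattern :: "('o, 'm) pattern \<Rightarrow> ('o \<Rightarrow> bool) \<Rightarrow> ('o, 'm) pattern" where
  "full_subpattern C P = C\<lparr>Ob := {c \<in> Ob C. P c}, Elem := {c \<in> Elem C. P c}\<rparr>"


section \<open>Graphs\<close>

text \<open>
  Arcs and vertices are natural numbers, so that graphs form a set; every finite graph is
  isomorphic to such a graph. The maps \<open>opp\<close> and \<open>tgt\<close> are \<open>extensional\<close>, so that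
  equality of records is equality of graphs. The field \<open>nodeless\<close> marks the nodeless loops,
  whose other data agree with those of an edge graph.
\<close>

record graph =
  arcs :: "nat set"
  verts :: "nat set"
  opp :: "nat \<Rightarrow> nat"
  darts :: "nat set"
  tgt :: "nat \<Rightarrow> nat"
  nodeless :: bool

definition is_graph :: "graph \<Rightarrow> bool" where
  "is_graph G \<longleftrightarrow>
     finite (arcs G) \<and> finite (verts G) \<and>
     opp G \<in> arcs G \<rightarrow>\<^sub>E arcs G \<and>
     (\<forall>a\<in>arcs G. opp G (opp G a) = a \<and> opp G a \<noteq> a) \<and>
     darts G \<subseteq> arcs G \<and>
     tgt G \<in> darts G \<rightarrow>\<^sub>E verts G \<and>
     (nodeless G \<longrightarrow> card (arcs G) = 2 \<and> darts G = {} \<and> verts G = {})"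

definition nb :: "graph \<Rightarrow> nat \<Rightarrow> nat set" where
  "nb G v = {d \<in> darts G. tgt G d = v}"

definition bdry :: "graph \<Rightarrow> nat set" where
  "bdry G = (if nodeless G then {} else arcs G - darts G)"

definition internal_edges :: "graph \<Rightarrow> nat set set" where
  "internal_edges G = {{a, opp G a} |a. a \<in> darts G \<and> opp G a \<in> darts G}"

definition disjoint_union_of_two :: "graph \<Rightarrow> bool" where
  "disjoint_union_of_two G \<longleftrightarrow>
     (\<exists>A1 A2 V1 V2.
        A1 \<union> A2 = arcs G \<and> A1 \<inter> A2 = {} \<and> V1 \<union> V2 = verts G \<and> V1 \<inter> V2 = {} \<and>
        opp G ` A1 \<subseteq> A1 \<and> opp G ` A2 \<subseteq> A2 \<and>
        tgt G ` (darts G \<inter> A1) \<subseteq> V1 \<and> tgt G ` (darts G \<inter> A2) \<subseteq> V2 \<and>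
        (A1 \<noteq> {} \<or> V1 \<noteq> {}) \<and> (A2 \<noteq> {} \<or> V2 \<noteq> {}))"

definition connected_graph :: "graph \<Rightarrow> bool" where
  "connected_graph G \<longleftrightarrow>
     is_graph G \<and> (arcs G \<noteq> {} \<or> verts G \<noteq> {}) \<and> \<not> disjoint_union_of_two G"

definition is_tree :: "graph \<Rightarrow> bool" where
  "is_tree G \<longleftrightarrow> connected_graph G \<and> \<not> nodeless G \<and>
     (verts G = {} \<or> card (internal_edges G) + 1 = card (verts G))"

definition edge_graph :: graph where
  "edge_graph = \<lparr>arcs = {0, 1}, verts = {}, opp = (\<lambda>a\<in>{0, 1}. 1 - a), darts = {},
     tgt = (\<lambda>_. undefined), nodeless = False\<rparr>"

text \<open>
  \<open>star_on v S\<close> is the star with vertex \<open>v\<close> and darts indexed by \<open>S\<close>: the dart of \<open>d \<in> S\<close>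
  is encoded as \<open>2 * d\<close>, and the opposite boundary arc as \<open>2 * d + 1\<close>.
\<close>

definition star_on :: "nat \<Rightarrow> nat set \<Rightarrow> graph" where
  "star_on v S =
     \<lparr>arcs = (\<lambda>d. 2 * d) ` S \<union> (\<lambda>d. 2 * d + 1) ` S, verts = {v},
      opp = (\<lambda>a\<in>(\<lambda>d. 2 * d) ` S \<union> (\<lambda>d. 2 * d + 1) ` S. if even a then a + 1 else a - 1),
      darts = (\<lambda>d. 2 * d) ` S, tgt = (\<lambda>a\<in>(\<lambda>d. 2 * d) ` S. v), nodeless = False\<rparr>"

definition star :: "nat \<Rightarrow> graph" where
  "star n = star_on 0 {1..n}"


section \<open>Etale maps and embeddings\<close>

text \<open>
  An etale map is given by its functions on arcs and on vertices; its function on darts is the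
  restriction of the one on arcs.
\<close>

type_synonym gfun = "(nat \<Rightarrow> nat) \<times> (nat \<Rightarrow> nat)"

definition etale :: "graph \<Rightarrow> graph \<Rightarrow> gfun \<Rightarrow> bool" where
  "etale H G f \<longleftrightarrow> is_graph H \<and> is_graph G \<and>
     fst f \<in> arcs H \<rightarrow>\<^sub>E arcs G \<and> snd f \<in> verts H \<rightarrow>\<^sub>E verts G \<and>
     (\<forall>a\<in>arcs H. fst f (opp H a) = opp G (fst f a)) \<and>
     (\<forall>d\<in>darts H. fst f d \<in> darts G \<and> tgt G (fst f d) = snd f (tgt H d)) \<and>
     (\<forall>v\<in>verts H. bij_betw (fst f) (nb H v) (nb G (snd f v)))"

definition gfun_comp :: "graph \<Rightarrow> gfun \<Rightarrow> gfun \<Rightarrow> gfun" where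
  "gfun_comp K f z = (\<lambda>a\<in>arcs K. fst f (fst z a), \<lambda>v\<in>verts K. snd f (snd z v))"

definition graph_iso :: "graph \<Rightarrow> graph \<Rightarrow> gfun \<Rightarrow> bool" where
  "graph_iso H G z \<longleftrightarrow> etale H G z \<and> nodeless H = nodeless G \<and>
     bij_betw (fst z) (arcs H) (arcs G) \<and> bij_betw (fst z) (darts H) (darts G) \<and>
     bij_betw (snd z) (verts H) (verts G)"

definition isomorphic :: "graph \<Rightarrow> graph \<Rightarrow> bool" where
  "isomorphic H G \<longleftrightarrow> (\<exists>z. graph_iso H G z)"

text \<open>
  The last clause excludes maps from a nodeless loop to an ordinary graph. With it, the
  embeddings into a nodeless loop are the isomorphisms from edge graphs onto its arcs,
  and the isomorphisms from nodeless loops.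
\<close>

definition embedding :: "graph \<Rightarrow> graph \<Rightarrow> gfun \<Rightarrow> bool" where
  "embedding H G f \<longleftrightarrow> etale H G f \<and> connected_graph H \<and> connected_graph G \<and>
     inj_on (snd f) (verts H) \<and> (nodeless H \<longrightarrow> nodeless G)"

type_synonym emb = "(graph \<times> gfun) set"

definition emb_class :: "graph \<Rightarrow> gfun \<Rightarrow> emb" where
  "emb_class H f = {(K, gfun_comp K f z) |K z. graph_iso K H z}"

definition Emb :: "graph \<Rightarrow> emb set" where
  "Emb G = {emb_class H f |H f. embedding H G f}"

text \<open>The unions below are over the representatives of a class, all of which have the same image.\<close>

definition emb_verts :: "emb \<Rightarrow> nat set" where
  "emb_verts e = (\<Union>(H, f)\<in>e. snd f ` verts H)"

definition emb_bdry :: "emb \<Rightarrow> nat set" where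
  "emb_bdry e = (\<Union>(H, f)\<in>e. fst f ` bdry H)"

definition is_edge :: "emb \<Rightarrow> bool" where
  "is_edge e \<longleftrightarrow> (\<exists>(H, f)\<in>e. isomorphic H edge_graph)"

definition iota :: "graph \<Rightarrow> nat \<Rightarrow> gfun" where
  "iota G v =
     (\<lambda>a\<in>arcs (star_on v (nb G v)). if even a then a div 2 else opp G (a div 2), \<lambda>u\<in>{v}. u)"

definition iota_class :: "graph \<Rightarrow> nat \<Rightarrow> emb" where
  "iota_class G v = emb_class (star_on v (nb G v)) (iota G v)"


section \<open>Graphical maps\<close>

type_synonym gmap = "(nat \<Rightarrow> nat) \<times> (nat \<Rightarrow> emb)"

definition pre_gmap :: "graph \<Rightarrow> graph \<Rightarrow> gmap \<Rightarrow> bool" where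
  "pre_gmap G G' \<phi> \<longleftrightarrow>
     fst \<phi> \<in> arcs G \<rightarrow>\<^sub>E arcs G' \<and> snd \<phi> \<in> verts G \<rightarrow>\<^sub>E Emb G' \<and>
     (\<forall>a\<in>arcs G. fst \<phi> (opp G a) = opp G' (fst \<phi> a)) \<and>
     (\<forall>v\<in>verts G. \<forall>w\<in>verts G. v \<noteq> w \<longrightarrow> emb_verts (snd \<phi> v) \<inter> emb_verts (snd \<phi> w) = {}) \<and>
     (\<forall>v\<in>verts G. bij_betw (\<lambda>a. fst \<phi> (opp G a)) (nb G v) (emb_bdry (snd \<phi> v)))"

definition U_hom :: "graph \<Rightarrow> graph \<Rightarrow> gmap set" where
  "U_hom G G' = {\<phi>. pre_gmap G G' \<phi> \<and>
     (bdry G = {} \<longrightarrow> (\<exists>v\<in>verts G. \<not> is_edge (snd \<phi> v)))}"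

definition Utilde_hom :: "graph \<Rightarrow> graph \<Rightarrow> gmap set" where
  "Utilde_hom G G' = {\<phi>. pre_gmap G G' \<phi> \<and>
     (bdry G = {} \<and> (\<forall>v\<in>verts G. is_edge (snd \<phi> v)) \<longrightarrow> nodeless G')}"

definition gmap_comp :: "graph \<Rightarrow> graph \<Rightarrow> graph \<Rightarrow> gmap \<Rightarrow> gmap \<Rightarrow> gmap" where
  "gmap_comp G G' G'' \<psi> \<phi> =
     (\<lambda>a\<in>arcs G. fst \<psi> (fst \<phi> a),
      \<lambda>v\<in>verts G. THE e. e \<in> Emb G'' \<and>
         emb_bdry e = fst \<psi> ` emb_bdry (snd \<phi> v) \<and>
         emb_verts e = (\<Union>w\<in>emb_verts (snd \<phi> v). emb_verts (snd \<psi> w)))"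

definition gmap_of_emb :: "graph \<Rightarrow> graph \<Rightarrow> gfun \<Rightarrow> gmap" where
  "gmap_of_emb H G f = (fst f, \<lambda>v\<in>verts H. iota_class G (snd f v))"

definition gmap_id :: "graph \<Rightarrow> gmap" where
  "gmap_id G = gmap_of_emb G G (\<lambda>a\<in>arcs G. a, \<lambda>v\<in>verts G. v)"

definition inert_maps :: "graph \<Rightarrow> graph \<Rightarrow> gmap set" where
  "inert_maps H G = {gmap_of_emb H G f |f. embedding H G f}"

definition elementary :: "graph \<Rightarrow> bool" where
  "elementary G \<longleftrightarrow> isomorphic G edge_graph \<or> (\<exists>n. isomorphic G (star n))"

definition U :: "(graph, gmap) pattern" where
  "U = \<lparr>Ob = {G. connected_graph G \<and> \<not> nodeless G},
     Hom = U_hom, Id = gmap_id, Comp = gmap_comp,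
     Elem = {G. connected_graph G \<and> \<not> nodeless G \<and> elementary G}, Inert = inert_maps\<rparr>"

definition Utilde :: "(graph, gmap) pattern" where
  "Utilde = \<lparr>Ob = {G. connected_graph G},
     Hom = Utilde_hom, Id = gmap_id, Comp = gmap_comp,
     Elem = {G. connected_graph G \<and> elementary G}, Inert = inert_maps\<rparr>"

definition U0 :: "(graph, gmap) pattern" where
  "U0 = full_subpattern U is_tree"


section \<open>Oriented versions\<close>

type_synonym orgraph = "graph \<times> (nat \<Rightarrow> int)"

definition orientations :: "graph \<Rightarrow> (nat \<Rightarrow> int) set" where
  "orientations G = {x \<in> arcs G \<rightarrow>\<^sub>E {1, -1}. \<forall>a\<in>arcs G. x (opp G a) = - x a}"

definition oriented :: "(graph, gmap) pattern \<Rightarrow> (orgraph, gmap) pattern" where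
  "oriented D =
     \<lparr>Ob = {(G, x). G \<in> Ob D \<and> x \<in> orientations G},
      Hom = (\<lambda>(G, x) (G', x'). {\<phi> \<in> Hom D G G'. \<forall>a\<in>arcs G. x' (fst \<phi> a) = x a}),
      Id = (\<lambda>(G, x). Id D G),
      Comp = (\<lambda>(G, x) (G', x') (G'', x''). Comp D G G' G''),
      Elem = {(G, x). G \<in> Elem D \<and> x \<in> orientations G},
      Inert = (\<lambda>(G, x) (G', x'). {\<phi> \<in> Inert D G G'. \<forall>a\<in>arcs G. x' (fst \<phi> a) = x a})\<rparr>"

definition Gsc :: "(orgraph, gmap) pattern" where
  "Gsc = full_subpattern (oriented U) (\<lambda>(G, x). is_tree G)"

definition forget :: "(orgraph, gmap, graph, gmap) func" where
  "forget = \<lparr>FOb = fst, FMap = (\<lambda>_ _ \<phi>. \<phi>)\<rparr>"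

end

theory Submission
  imports Defs
begin

text \<open>
  Orientations of \<open>G\<close> form a presheaf which is Segal, since an orientation is determined by its
  restrictions to the edges of \<open>G\<close>, and the oriented category is its category of elements.
  Hence the left Kan extension of \<open>Z\<close> is \<open>G \<mapsto> \<Coprod>\<^sub>x Z (G, x)\<close>, and a compatible family over
  the elementary objects of \<open>G\<close> is an orientation \<open>x\<close> of \<open>G\<close> together with a compatible family
  for \<open>Z\<close> over those of \<open>(G, x)\<close>. Of the category axioms this uses that graphical maps are closed under
  composition and that the identities are right units; associativity is only tested
  through \<open>Z\<close>, which is functorial by assumption. Closure under composition is graph substitution:
  classes of embeddings are encoded by their vertex sets and boundaries, so that substitution
  becomes a statement about joining and gluing such pairs. The three cases are treated
  uniformly because a graphical map of \<open>Utilde\<close> between ordinary graphs is one of \<open>U\<close>.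
\<close>

section \<open>Connected graphs and embeddings\<close>

text \<open>The main obstacle is \<open>gmap_comp\<close>: its vertex component is a definite
  description, so nothing is known of a composite until the described class is shown to exist and to
  be unique. Uniqueness holds because an embedding can be rebuilt, up to isomorphism of its domain,
  from its vertex image and boundary. Existence amounts to connectedness of the substituted graph,
  whence the construction of pairs by moves that preserve connectedness. Nodeless loops shape the
  details: by convention their boundary is empty, so they appear as vertexless classes with empty
  boundary, and the clause on closed graphs in \<open>Utilde_hom\<close> makes the target a nodeless
  loop exactly where gluing would otherwise leave the classes of embeddings.

  In the coend, a triple \<open>(c, \<alpha>, z)\<close> is joined by a single step, along the lift
  of \<alpha>, to one whose middle entry is an identity. Classes are therefore the fibres of one
  evaluation map. Compatible families recover an orientation because every arc of \<open>G\<close>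
  is the image of arc 0 under an inert map from the edge graph.\<close>

definition dts :: "graph \<Rightarrow> nat set \<Rightarrow> nat set" where
  "dts G S = {d \<in> darts G. tgt G d \<in> S}"

lemma dts_iff: "d \<in> dts G S \<longleftrightarrow> d \<in> darts G \<and> tgt G d \<in> S"
  by (simp add: dts_def)

lemma nb_eq_dts: "nb G v = dts G {v}"
  by (auto simp: nb_def dts_def)

lemma graph_opp:
  assumes "is_graph G" "a \<in> arcs G"
  shows "opp G a \<in> arcs G" "opp G (opp G a) = a" "opp G a \<noteq> a"
  using assms unfolding is_graph_def by auto

lemma graph_dart:
  assumes "is_graph G" "d \<in> darts G"
  shows "d \<in> arcs G" "tgt G d \<in> verts G"
  using assms unfolding is_graph_def by auto

lemma connected_is_graph: "connected_graph G \<Longrightarrow> is_graph G"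
  by (simp add: connected_graph_def)

text \<open>An edge without darts touches no vertex, so it splits off from everything else, and
  connectedness leaves nothing else. Consequently, in a connected graph with a vertex, the opposite
  of every non-dart is a dart.\<close>

lemma connected_free_edge:
  assumes "connected_graph G" "a \<in> arcs G" "a \<notin> darts G" "opp G a \<notin> darts G"
  shows "arcs G = {a, opp G a}" "verts G = {}"
proof -
  have g: "is_graph G" using assms(1) by (rule connected_is_graph)
  have nd: "\<not> disjoint_union_of_two G" using assms(1) by (simp add: connected_graph_def)
  let ?A = "arcs G - {a, opp G a}"
  have "opp G ` ?A \<subseteq> ?A"
  proof
    fix b assume "b \<in> opp G ` ?A"
    then obtain c where c: "b = opp G c" "c \<in> arcs G" "c \<noteq> a" "c \<noteq> opp G a" by auto
    have "opp G b = c" "b \<in> arcs G" using c graph_opp[OF g c(2)] by auto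
    then show "b \<in> ?A" using c graph_opp[OF g assms(2)] by auto
  qed
  moreover have "tgt G ` (darts G \<inter> ?A) \<subseteq> verts G" using graph_dart[OF g] by auto
  moreover have "opp G ` {a, opp G a} \<subseteq> {a, opp G a}" using graph_opp[OF g assms(2)] by auto
  moreover have "{a, opp G a} \<union> ?A = arcs G" using graph_opp[OF g assms(2)] assms(2) by auto
  moreover have "tgt G ` (darts G \<inter> {a, opp G a}) \<subseteq> {}" using assms(3,4) by auto
  ultimately have "\<not> (?A \<noteq> {} \<or> verts G \<noteq> {})"
    using nd unfolding disjoint_union_of_two_def
    by (metis Diff_disjoint Int_empty_left Un_empty_left insert_not_empty)
  then show "arcs G = {a, opp G a}" "verts G = {}"
    using graph_opp[OF g assms(2)] assms(2) by auto
qed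

lemma connected_no_verts:
  assumes "connected_graph G" "verts G = {}"
  obtains a where "a \<in> arcs G" "arcs G = {a, opp G a}" "darts G = {}"
proof -
  have g: "is_graph G" using assms(1) by (rule connected_is_graph)
  have "darts G = {}" using graph_dart[OF g] assms(2) by auto
  moreover obtain a where "a \<in> arcs G" using assms unfolding connected_graph_def by blast
  ultimately have "arcs G = {a, opp G a}" by (intro connected_free_edge(1)[OF assms(1)]) simp_all
  then show ?thesis using \<open>a \<in> arcs G\<close> \<open>darts G = {}\<close> by (intro that)
qed

lemma no_verts_no_bdry:
  assumes "connected_graph G" "verts G = {}" "bdry G = {}"
  shows "nodeless G"
  using assms(3) by (auto simp: bdry_def split: if_splits intro: connected_no_verts[OF assms(1,2)])

text \<open>If no edge crossed from \<open>T\<close> to its complement, the arcs with an end over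
  \<open>T\<close> would split off together with \<open>T\<close>.\<close>

lemma connected_cut:
  assumes "connected_graph G" "T \<subseteq> verts G" "T \<noteq> {}" "T \<noteq> verts G"
  shows "\<exists>d\<in>dts G T. opp G d \<in> dts G (verts G - T)"
proof (rule ccontr)
  assume n: "\<not> ?thesis"
  have g: "is_graph G" using assms(1) by (rule connected_is_graph)
  let ?A = "{a \<in> arcs G. a \<in> dts G T \<or> opp G a \<in> dts G T}"
  let ?B = "arcs G - ?A"
  have "?A \<union> ?B = arcs G" "?A \<inter> ?B = {}" "T \<union> (verts G - T) = verts G" "T \<inter> (verts G - T) = {}"
    using assms(2) by auto
  moreover have "opp G ` ?A \<subseteq> ?A" "opp G ` ?B \<subseteq> ?B" using graph_opp[OF g] by auto
  moreover have "tgt G ` (darts G \<inter> ?A) \<subseteq> T"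
  proof
    fix v assume "v \<in> tgt G ` (darts G \<inter> ?A)"
    then obtain d where d: "v = tgt G d" "d \<in> darts G" "d \<in> arcs G" "d \<in> dts G T \<or> opp G d \<in> dts G T"
      by auto
    show "v \<in> T"
    proof (rule ccontr)
      assume v: "v \<notin> T"
      then have o: "opp G d \<in> dts G T" using d by (auto simp: dts_iff)
      have "opp G (opp G d) \<in> dts G (verts G - T)"
        using v d graph_opp[OF g d(3)] graph_dart[OF g d(2)] by (auto simp: dts_iff)
      then show False using n o by blast
    qed
  qed
  moreover have "tgt G ` (darts G \<inter> ?B) \<subseteq> verts G - T"
    using graph_dart[OF g] by (auto simp: dts_iff)
  moreover have "verts G - T \<noteq> {}" using assms(2,4) by blast
  ultimately have "disjoint_union_of_two G"
    unfolding disjoint_union_of_two_def using assms(3)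
    by (intro exI[of _ ?A] exI[of _ ?B] exI[of _ T] exI[of _ "verts G - T"] conjI disjI2)
  then show False using assms(1) by (simp add: connected_graph_def)
qed

text \<open>The hypothesis on non-darts excludes pieces made of arcs alone, so a splitting of the
  graph splits the vertices into two non-empty sets, and a crossing edge contradicts it.\<close>

lemma connectedI:
  assumes g: "is_graph G" and v: "verts G \<noteq> {}"
    and o: "\<And>a. a \<in> arcs G \<Longrightarrow> a \<notin> darts G \<Longrightarrow> opp G a \<in> darts G"
    and c: "\<And>T. T \<subseteq> verts G \<Longrightarrow> T \<noteq> {} \<Longrightarrow> T \<noteq> verts G \<Longrightarrow>
      \<exists>d\<in>dts G T. opp G d \<in> dts G (verts G - T)"
  shows "connected_graph G"
proof -
  have "\<not> disjoint_union_of_two G"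
  proof
    assume "disjoint_union_of_two G"
    then obtain A1 A2 V1 V2 where p:
      "A1 \<union> A2 = arcs G" "A1 \<inter> A2 = {}" "V1 \<union> V2 = verts G" "V1 \<inter> V2 = {}"
      "opp G ` A1 \<subseteq> A1" "opp G ` A2 \<subseteq> A2"
      "tgt G ` (darts G \<inter> A1) \<subseteq> V1" "tgt G ` (darts G \<inter> A2) \<subseteq> V2"
      "A1 \<noteq> {} \<or> V1 \<noteq> {}" "A2 \<noteq> {} \<or> V2 \<noteq> {}"
      unfolding disjoint_union_of_two_def by (elim exE conjE) (rule that)
    have ne: "V \<noteq> {}" if "A \<noteq> {} \<or> V \<noteq> {}" "A \<subseteq> arcs G" "opp G ` A \<subseteq> A"
      "tgt G ` (darts G \<inter> A) \<subseteq> V" for A V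
    proof
      assume V: "V = {}"
      with that obtain a where a: "a \<in> A" by auto
      then have "a \<notin> darts G" "opp G a \<notin> darts G" using that V by auto
      then show False using o a that by auto
    qed
    have "A1 \<subseteq> arcs G" "A2 \<subseteq> arcs G" using p(1) by auto
    then have "V1 \<noteq> {}" "V2 \<noteq> {}"
      using ne[OF p(9) _ p(5) p(7)] ne[OF p(10) _ p(6) p(8)] by simp_all
    moreover have "V1 \<subseteq> verts G" using p(3) by blast
    moreover have "V1 \<noteq> verts G" using p(3,4) \<open>V2 \<noteq> {}\<close> by blast
    ultimately obtain d where d: "d \<in> dts G V1" "opp G d \<in> dts G (verts G - V1)"
      using c[of V1] by blast
    then have "d \<in> arcs G" using graph_dart[OF g] by (auto simp: dts_iff)
    then consider "d \<in> A1" | "d \<in> A2" using p by auto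
    then show False
    proof cases
      case 1
      then have "opp G d \<in> A1" using p by auto
      then show False using d p by (auto simp: dts_iff)
    next
      case 2
      then show False using d p by (auto simp: dts_iff)
    qed
  qed
  then show ?thesis using g v by (simp add: connected_graph_def)
qed

section \<open>Etale maps, isomorphisms and classes of embeddings\<close>

lemma etaleD:
  assumes "etale H G f"
  shows "is_graph H" "is_graph G"
    "a \<in> arcs H \<Longrightarrow> fst f a \<in> arcs G" "a \<in> arcs H \<Longrightarrow> fst f (opp H a) = opp G (fst f a)"
    "v \<in> verts H \<Longrightarrow> snd f v \<in> verts G"
    "d \<in> darts H \<Longrightarrow> fst f d \<in> darts G" "d \<in> darts H \<Longrightarrow> tgt G (fst f d) = snd f (tgt H d)"
    "v \<in> verts H \<Longrightarrow> bij_betw (fst f) (nb H v) (nb G (snd f v))"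
    "fst f \<in> extensional (arcs H)" "snd f \<in> extensional (verts H)"
  using assms unfolding etale_def by (auto simp: PiE_def Pi_def)

text \<open>A dart determines its vertex, and \<open>f\<close> is injective on vertices and
  bijective around each of them. Thus the vertex image alone fixes the image of the darts.\<close>

lemma etale_darts:
  assumes e: "etale H G f" and i: "inj_on (snd f) (verts H)"
  shows "bij_betw (fst f) (darts H) (dts G (snd f ` verts H))"
  unfolding bij_betw_def
proof
  note g = etaleD(1,2)[OF e] and e' = etaleD[OF e]
  show "inj_on (fst f) (darts H)"
  proof (rule inj_onI)
    fix d d' assume *: "d \<in> darts H" "d' \<in> darts H" "fst f d = fst f d'"
    then have "snd f (tgt H d) = snd f (tgt H d')" using e'(7) by metis
    then have t: "tgt H d = tgt H d'" using i * graph_dart[OF g(1)] by (auto dest: inj_onD)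
    then have "d \<in> nb H (tgt H d)" "d' \<in> nb H (tgt H d)" using * by (auto simp: nb_def)
    then show "d = d'" using e'(8)[of "tgt H d"] * graph_dart[OF g(1)]
      by (auto simp: bij_betw_def dest: inj_onD)
  qed
  show "fst f ` darts H = dts G (snd f ` verts H)"
  proof
    show "fst f ` darts H \<subseteq> dts G (snd f ` verts H)"
      using e'(6,7) graph_dart[OF g(1)] by (auto simp: dts_iff)
    show "dts G (snd f ` verts H) \<subseteq> fst f ` darts H"
    proof
      fix d assume "d \<in> dts G (snd f ` verts H)"
      then obtain v where v: "v \<in> verts H" "d \<in> nb G (snd f v)" by (auto simp: dts_iff nb_def)
      then have "d \<in> fst f ` nb H v" using e'(8)[OF v(1)] by (simp add: bij_betw_def)
      then show "d \<in> fst f ` darts H" by (auto simp: nb_def)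
    qed
  qed
qed

text \<open>The bijections between neighbourhoods that \<open>etale\<close> demands follow from
  those on darts and vertices.\<close>

lemma graph_isoI:
  assumes g: "is_graph H" "is_graph G" "nodeless H = nodeless G"
    and x: "fst z \<in> extensional (arcs H)" "snd z \<in> extensional (verts H)"
    and b: "bij_betw (fst z) (arcs H) (arcs G)" "bij_betw (fst z) (darts H) (darts G)"
      "bij_betw (snd z) (verts H) (verts G)"
    and o: "\<And>a. a \<in> arcs H \<Longrightarrow> fst z (opp H a) = opp G (fst z a)"
    and t: "\<And>d. d \<in> darts H \<Longrightarrow> tgt G (fst z d) = snd z (tgt H d)"
  shows "graph_iso H G z"
proof -
  have m: "fst z \<in> arcs H \<rightarrow> arcs G" "snd z \<in> verts H \<rightarrow> verts G" "fst z \<in> darts H \<rightarrow> darts G"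
    using b by (auto dest: bij_betwE)
  have nb: "bij_betw (fst z) (nb H v) (nb G (snd z v))" if v: "v \<in> verts H" for v
    unfolding bij_betw_def
  proof
    show "inj_on (fst z) (nb H v)"
      by (rule inj_on_subset[OF bij_betw_imp_inj_on[OF b(2)]]) (auto simp: nb_def)
    show "fst z ` nb H v = nb G (snd z v)"
    proof
      show "fst z ` nb H v \<subseteq> nb G (snd z v)" using t m(3) by (auto simp: nb_def)
      show "nb G (snd z v) \<subseteq> fst z ` nb H v"
      proof
        fix d assume d: "d \<in> nb G (snd z v)"
        then have "d \<in> fst z ` darts H" using b(2) by (simp add: bij_betw_def nb_def)
        then obtain c where c: "c \<in> darts H" "d = fst z c" by auto
        then have "snd z (tgt H c) = snd z v" using d t by (simp add: nb_def)
        then have "tgt H c = v"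
          using graph_dart[OF g(1) c(1)] v b(3) by (auto simp: bij_betw_def dest: inj_onD)
        then show "d \<in> fst z ` nb H v" using c by (auto simp: nb_def)
      qed
    qed
  qed
  show ?thesis
    unfolding graph_iso_def etale_def PiE_def using g x m b o t nb by blast
qed

lemma graph_iso_comp:
  assumes "graph_iso K H y" "graph_iso H L z"
  shows "graph_iso K L (gfun_comp K z y)"
proof -
  have y: "etale K H y" "nodeless K = nodeless H" "bij_betw (fst y) (arcs K) (arcs H)"
    "bij_betw (fst y) (darts K) (darts H)" "bij_betw (snd y) (verts K) (verts H)"
    using assms(1) by (auto simp: graph_iso_def)
  have z: "etale H L z" "nodeless H = nodeless L" "bij_betw (fst z) (arcs H) (arcs L)"
    "bij_betw (fst z) (darts H) (darts L)" "bij_betw (snd z) (verts H) (verts L)"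
    using assms(2) by (auto simp: graph_iso_def)
  note e = etaleD[OF y(1)] and e' = etaleD[OF z(1)]
  have c: "fst (gfun_comp K z y) a = (fst z \<circ> fst y) a" if "a \<in> arcs K" for a
    using that by (simp add: gfun_comp_def)
  have c': "snd (gfun_comp K z y) v = (snd z \<circ> snd y) v" if "v \<in> verts K" for v
    using that by (simp add: gfun_comp_def)
  show ?thesis
  proof (rule graph_isoI)
    show "is_graph K" "is_graph L" "nodeless K = nodeless L" using e(1) e'(2) y z by auto
    show "fst (gfun_comp K z y) \<in> extensional (arcs K)" "snd (gfun_comp K z y) \<in> extensional (verts K)"
      by (auto simp: gfun_comp_def)
    show "bij_betw (fst (gfun_comp K z y)) (arcs K) (arcs L)"
      using bij_betw_trans[OF y(3) z(3)] c by (subst bij_betw_cong[of _ _ "fst z \<circ> fst y"])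
    show "bij_betw (fst (gfun_comp K z y)) (darts K) (darts L)"
      using bij_betw_trans[OF y(4) z(4)] c graph_dart(1)[OF e(1)]
      by (subst bij_betw_cong[of _ _ "fst z \<circ> fst y"]) simp_all
    show "bij_betw (snd (gfun_comp K z y)) (verts K) (verts L)"
      using bij_betw_trans[OF y(5) z(5)] c' by (subst bij_betw_cong[of _ _ "snd z \<circ> snd y"])
    show "fst (gfun_comp K z y) (opp K a) = opp L (fst (gfun_comp K z y) a)" if "a \<in> arcs K" for a
      using that c graph_opp(1)[OF e(1) that] e(3,4) e'(4) by simp
    show "tgt L (fst (gfun_comp K z y) d) = snd (gfun_comp K z y) (tgt K d)" if "d \<in> darts K" for d
      using that c c' graph_dart[OF e(1) that] e(6,7) e'(7) by simp
  qed
qed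

text \<open>Representatives differ by isomorphisms of their domains, so the unions in
  \<open>emb_verts\<close> and \<open>emb_bdry\<close> collapse to a single image. Extensionality
  makes the composite of \<open>f\<close> with the identity equal to \<open>f\<close> itself, which
  puts \<open>(H, f)\<close> into its own class.\<close>

lemma emb_class_images:
  assumes "is_graph H" and f: "fst f \<in> extensional (arcs H)" "snd f \<in> extensional (verts H)"
  shows "(H, f) \<in> emb_class H f" "emb_verts (emb_class H f) = snd f ` verts H"
    "emb_bdry (emb_class H f) = fst f ` bdry H"
proof -
  let ?i = "(\<lambda>a\<in>arcs H. a, \<lambda>v\<in>verts H. v)"
  have bij: "bij_betw (\<lambda>a\<in>S. a) T T" if "T \<subseteq> S" for S T :: "nat set"
    using that by (subst bij_betw_cong[where g=id]) auto
  have "darts H \<subseteq> arcs H" using assms(1) by (simp add: is_graph_def)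
  then have "graph_iso H H ?i"
    using assms(1) graph_opp[OF assms(1)] graph_dart[OF assms(1)]
    by (intro graph_isoI) (simp_all only: fst_conv snd_conv bij subset_refl, simp_all)
  moreover have "gfun_comp H f ?i = f"
    unfolding gfun_comp_def using f
    by (cases f) (auto simp: fun_eq_iff extensional_def)
  ultimately show self: "(H, f) \<in> emb_class H f" unfolding emb_class_def by force
  have im: "snd g ` verts K = snd f ` verts H \<and> fst g ` bdry K = fst f ` bdry H"
    if "(K, g) \<in> emb_class H f" for K g
  proof -
    from that obtain z where z: "graph_iso K H z" "g = gfun_comp K f z"
      unfolding emb_class_def by auto
    have "nodeless K = nodeless H" and b: "bij_betw (fst z) (arcs K) (arcs H)"
      "bij_betw (fst z) (darts K) (darts H)" "bij_betw (snd z) (verts K) (verts H)"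
      and e: "etale K H z"
      using z by (auto simp: graph_iso_def)
    moreover have "darts K \<subseteq> arcs K" using etaleD(1)[OF e] by (simp add: is_graph_def)
    ultimately have "fst z ` bdry K = bdry H"
      unfolding bdry_def bij_betw_def
      by (auto simp: inj_on_image_set_diff[of "fst z" "arcs K"])
    moreover have "bdry K \<subseteq> arcs K" by (auto simp: bdry_def)
    then have "fst g ` bdry K = fst f ` (fst z ` bdry K)"
      unfolding z(2) gfun_comp_def by (auto simp: image_image)
    moreover have "snd g ` verts K = snd f ` (snd z ` verts K)"
      unfolding z(2) gfun_comp_def by (auto simp: image_image)
    ultimately show ?thesis using b(3) by (simp add: bij_betw_def)
  qed
  show "emb_verts (emb_class H f) = snd f ` verts H"
    unfolding emb_verts_def using im self by fast
  show "emb_bdry (emb_class H f) = fst f ` bdry H"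
    unfolding emb_bdry_def using im self by fast
qed

lemma embeddingD:
  assumes "embedding H G f"
  shows "etale H G f" "connected_graph H" "connected_graph G" "inj_on (snd f) (verts H)"
    "nodeless H \<Longrightarrow> nodeless G" "is_graph H" "is_graph G"
  using assms unfolding embedding_def by (auto simp: connected_graph_def)

lemma embedding_images:
  assumes "embedding H G f"
  shows "(H, f) \<in> emb_class H f" "emb_verts (emb_class H f) = snd f ` verts H"
    "emb_bdry (emb_class H f) = fst f ` bdry H"
  using emb_class_images etaleD(9,10)[OF embeddingD(1)[OF assms]] embeddingD(6)[OF assms] by auto

lemma EmbE:
  assumes "e \<in> Emb G"
  obtains H f where "embedding H G f" "e = emb_class H f"
    "emb_verts e = snd f ` verts H" "emb_bdry e = fst f ` bdry H"
  using assms embedding_images unfolding Emb_def by blast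

section \<open>Recovering an embedding from its vertex image and boundary\<close>

lemma image_transfer:
  fixes f :: "'a \<Rightarrow> 'c" and g :: "'b \<Rightarrow> 'c"
  assumes "inj_on f A" "inj_on g B" "f ` A = g ` B"
  shows "bij_betw (\<lambda>a. inv_into B g (f a)) A B"
    and "a \<in> A \<Longrightarrow> g (inv_into B g (f a)) = f a"
proof -
  have "bij_betw (inv_into B g) (g ` B) B"
    using assms(2) by (intro bij_betw_inv_into) (simp add: bij_betw_def)
  moreover have "bij_betw f A (g ` B)" using assms by (simp add: bij_betw_def)
  ultimately show "bij_betw (\<lambda>a. inv_into B g (f a)) A B"
    using bij_betw_trans[of f A "g ` B" "inv_into B g" B] by (simp add: comp_def)
  show "a \<in> A \<Longrightarrow> g (inv_into B g (f a)) = f a"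
    using assms(3) by (intro f_inv_into_f) auto
qed

text \<open>
  An embedding may identify a boundary arc with a dart, namely when it cuts an internal edge,
  so the comparison is made separately on darts and on the remaining arcs.
\<close>

definition separated :: "graph \<Rightarrow> graph \<Rightarrow> gfun \<Rightarrow> bool" where
  "separated H G f \<longleftrightarrow> etale H G f \<and> inj_on (snd f) (verts H) \<and>
     inj_on (fst f) (arcs H - darts H) \<and>
     (darts H = {} \<or> (\<forall>a\<in>arcs H - darts H. opp H a \<in> darts H))"

text \<open>Whether an edge is cut is visible in the images. If \<open>a'\<close> were a dart with a
  non-dart opposite, that opposite would have a counterpart \<open>b\<close> among the non-darts of
  \<open>H\<close>; injectivity on darts gives \<open>opp H b = a\<close>, so \<open>b\<close> would
  be the dart \<open>opp H a\<close>.\<close>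

lemma separated_opp:
  assumes f: "separated H G f" and f': "separated H' G f'"
    and D: "fst f ` darts H = fst f' ` darts H'"
    and N: "fst f ` (arcs H - darts H) = fst f' ` (arcs H' - darts H')"
    and a: "a \<in> arcs H" "a' \<in> arcs H'" "fst f a = fst f' a'" "a \<in> darts H \<longleftrightarrow> a' \<in> darts H'"
    and o: "opp H a \<in> darts H"
  shows "opp H' a' \<in> darts H'"
proof (rule ccontr)
  assume n: "opp H' a' \<notin> darts H'"
  have e: "etale H G f" "etale H' G f'" and i: "inj_on (snd f) (verts H)"
    using f f' by (auto simp: separated_def)
  note e1 = etaleD[OF e(1)] and e2 = etaleD[OF e(2)]
  have "darts H' \<noteq> {}" using D o by auto
  then have "a' \<in> darts H'" using f' n a(2) by (auto simp: separated_def)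
  then have ad: "a \<in> darts H" using a by simp
  have "fst f' (opp H' a') \<in> fst f' ` (arcs H' - darts H')"
    using n a(2) graph_opp[OF e2(1)] by auto
  then obtain b where b: "b \<in> arcs H" "b \<notin> darts H" "fst f b = fst f' (opp H' a')"
    using N by (metis DiffD1 DiffD2 imageE)
  have "fst f b = opp G (fst f a)" using b(3) e2(4)[OF a(2)] a(3) by simp
  then have eq: "fst f (opp H b) = fst f a"
    using e1(4)[OF b(1)] graph_opp(2)[OF e1(2) e1(3)[OF a(1)]] by simp
  have "opp H b \<in> darts H" using f b o by (auto simp: separated_def)
  then have "opp H b = a"
    using eq ad bij_betw_imp_inj_on[OF etale_darts[OF e(1) i]] by (auto dest: inj_onD)
  then show False using b o graph_opp(2)[OF e1(1) b(1)] by auto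
qed

text \<open>The vertex image fixes the image of the darts by \<open>etale_darts\<close>, so both
  maps have equal images on darts, non-darts and vertices. Being injective on each of the three,
  they are matched there separately.\<close>

lemma separated_factor:
  assumes f: "separated H G f" and f': "separated H' G f'" and n: "nodeless H = nodeless H'"
    and V: "snd f ` verts H = snd f' ` verts H'"
    and N: "fst f ` (arcs H - darts H) = fst f' ` (arcs H' - darts H')"
  shows "\<exists>z. graph_iso H H' z \<and> f = gfun_comp H f' z"
proof -
  have e: "etale H G f" "etale H' G f'" and i: "inj_on (snd f) (verts H)" "inj_on (snd f') (verts H')"
    and iN: "inj_on (fst f) (arcs H - darts H)" "inj_on (fst f') (arcs H' - darts H')"
    using f f' by (auto simp: separated_def)
  note e1 = etaleD[OF e(1)] and e2 = etaleD[OF e(2)]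
  have bD: "bij_betw (fst f) (darts H) (dts G (snd f ` verts H))"
    "bij_betw (fst f') (darts H') (dts G (snd f ` verts H))"
    using etale_darts[OF e(1) i(1)] etale_darts[OF e(2) i(2)] V by auto
  then have iD: "inj_on (fst f) (darts H)" "inj_on (fst f') (darts H')"
    and D: "fst f ` darts H = fst f' ` darts H'"
    by (auto simp: bij_betw_def)
  let ?d = "\<lambda>a. inv_into (darts H') (fst f') (fst f a)"
  let ?n = "\<lambda>a. inv_into (arcs H' - darts H') (fst f') (fst f a)"
  let ?v = "\<lambda>a. inv_into (verts H') (snd f') (snd f a)"
  note d = image_transfer[OF iD D] and nd = image_transfer[OF iN N] and v = image_transfer[OF i V]
  define z where "z = (\<lambda>a\<in>arcs H. if a \<in> darts H then ?d a else ?n a, \<lambda>a\<in>verts H. ?v a)"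
  have sub: "darts H \<subseteq> arcs H" "darts H' \<subseteq> arcs H'" using e1(1) e2(1) by (auto simp: is_graph_def)
  have zd: "bij_betw (fst z) (darts H) (darts H')"
    using d(1) sub by (subst bij_betw_cong[of _ _ ?d]) (auto simp: z_def)
  have zn: "bij_betw (fst z) (arcs H - darts H) (arcs H' - darts H')"
    using nd(1) by (subst bij_betw_cong[of _ _ ?n]) (auto simp: z_def)
  have zv: "bij_betw (snd z) (verts H) (verts H')"
    using v(1) by (subst bij_betw_cong[of _ _ ?v]) (auto simp: z_def)
  have za: "bij_betw (fst z) (arcs H) (arcs H')"
    using bij_betw_combine[OF zd zn] sub by (simp add: Un_absorb1)
  have fz: "fst f' (fst z a) = fst f a" if "a \<in> arcs H" for a
    using that d(2) nd(2) by (simp add: z_def)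
  have fzv: "snd f' (snd z a) = snd f a" if "a \<in> verts H" for a
    using that v(2) by (simp add: z_def)
  have m: "fst z a \<in> arcs H'" "fst z a \<in> darts H' \<longleftrightarrow> a \<in> darts H" if "a \<in> arcs H" for a
    using that bij_betwE[OF za] bij_betwE[OF zd] bij_betwE[OF zn] by auto
  \<comment> \<open>\<open>f'\<close> may identify a dart with a non-dart, so equal images do not
    suffice: both sides must also be shown to have the same dart status.\<close>
  have oz: "fst z (opp H a) = opp H' (fst z a)" if a: "a \<in> arcs H" for a
  proof -
    have eq: "fst f' (fst z (opp H a)) = fst f' (opp H' (fst z a))"
      using a fz graph_opp(1)[OF e1(1) a] e1(4) e2(4) m by simp
    have "opp H a \<in> darts H \<longleftrightarrow> opp H' (fst z a) \<in> darts H'"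
      using separated_opp[OF f f' D N a m(1)[OF a] fz[OF a, symmetric] m(2)[OF a, symmetric]]
        separated_opp[OF f' f D[symmetric] N[symmetric] m(1)[OF a] a fz[OF a] m(2)[OF a]]
      by blast
    then have "fst z (opp H a) \<in> darts H' \<longleftrightarrow> opp H' (fst z a) \<in> darts H'"
      using m(2) graph_opp(1)[OF e1(1) a] by simp
    moreover have "fst z (opp H a) \<in> arcs H'" "opp H' (fst z a) \<in> arcs H'"
      using m(1) a graph_opp(1)[OF e1(1)] graph_opp(1)[OF e2(1)] by auto
    ultimately show ?thesis using eq iD(2) iN(2) by (auto dest: inj_onD)
  qed
  have tz: "tgt H' (fst z d) = snd z (tgt H d)" if dd: "d \<in> darts H" for d
  proof -
    have zd': "fst z d \<in> darts H'" using dd m sub by auto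
    have "snd f' (tgt H' (fst z d)) = tgt G (fst f d)"
      using e2(7)[OF zd'] fz dd sub by auto
    also have "\<dots> = snd f' (snd z (tgt H d))"
      using e1(7)[OF dd] fzv graph_dart[OF e1(1) dd] by auto
    finally show ?thesis
      using i(2) graph_dart(2)[OF e2(1) zd'] bij_betwE[OF zv] graph_dart(2)[OF e1(1) dd]
      by (auto dest: inj_onD)
  qed
  have "graph_iso H H' z"
    by (rule graph_isoI[OF e1(1) e2(1) n _ _ za zd zv oz tz]) (auto simp: z_def)
  moreover have "f = gfun_comp H f' z"
    unfolding gfun_comp_def using fz fzv e1(9,10)
    by (cases f) (auto simp: fun_eq_iff extensional_def)
  ultimately show ?thesis by blast
qed

lemma emb_class_subset:
  assumes "\<exists>z. graph_iso H H' z \<and> f = gfun_comp H f' z"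
  shows "emb_class H f \<subseteq> emb_class H' f'"
proof -
  from assms obtain z where z: "graph_iso H H' z" "f = gfun_comp H f' z" by blast
  show ?thesis
  proof
    fix p assume "p \<in> emb_class H f"
    then obtain K y where y: "p = (K, gfun_comp K f y)" "graph_iso K H y"
      unfolding emb_class_def by auto
    have "fst y a \<in> arcs H" if "a \<in> arcs K" for a
      using y(2) that by (auto simp: graph_iso_def dest: bij_betwE)
    moreover have "snd y a \<in> verts H" if "a \<in> verts K" for a
      using y(2) that by (auto simp: graph_iso_def dest: bij_betwE)
    ultimately have "gfun_comp K f y = gfun_comp K f' (gfun_comp K z y)"
      unfolding z(2) by (auto simp: gfun_comp_def fun_eq_iff)
    then show "p \<in> emb_class H' f'"
      using graph_iso_comp[OF y(2) z(1)] y(1) unfolding emb_class_def by blast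
  qed
qed

text \<open>A vertexless connected graph has only the arcs \<open>a\<close> and
  \<open>opp H a\<close>, and these cannot merge because \<open>opp G\<close> has no fixpoint.
  Otherwise the opposites of non-darts are darts, and injectivity passes from darts to
  non-darts.\<close>

lemma embedding_separated:
  assumes "embedding H G f"
  shows "separated H G f"
proof -
  note e = embeddingD[OF assms] and e' = etaleD[OF embeddingD(1)[OF assms]]
  show ?thesis
  proof (cases "verts H = {}")
    case True
    then obtain a where a: "a \<in> arcs H" "arcs H = {a, opp H a}" "darts H = {}"
      using connected_no_verts[OF e(2)] by blast
    then have "inj_on (fst f) {a, opp H a}"
      using e'(4)[OF a(1)] graph_opp(3)[OF e'(2) e'(3)[OF a(1)]] by auto
    then show ?thesis using a e by (simp add: separated_def)
  next
    case False
    have o: "opp H a \<in> darts H" if "a \<in> arcs H" "a \<notin> darts H" for a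
      using connected_free_edge(2)[OF e(2) that] False by blast
    have "inj_on (fst f) (arcs H - darts H)"
    proof (rule inj_onI)
      fix a b assume *: "a \<in> arcs H - darts H" "b \<in> arcs H - darts H" "fst f a = fst f b"
      then have "fst f (opp H a) = fst f (opp H b)" using e'(4) by simp
      then have "opp H a = opp H b"
        using * o bij_betw_imp_inj_on[OF etale_darts[OF e(1,4)]] by (auto dest: inj_onD)
      then show "a = b" using * graph_opp(2)[OF e'(1)] by (metis DiffD1)
    qed
    then show ?thesis using e o by (simp add: separated_def)
  qed
qed

text \<open>For ordinary domains the boundary is the image of the non-darts, and
  \<open>separated_factor\<close> compares representatives in both directions. Nodeless loops need
  care: their boundary is empty by convention although none of their arcs is a dart.\<close>

lemma Emb_unique:
  assumes "e \<in> Emb G" "e' \<in> Emb G" "emb_verts e = emb_verts e'" "emb_bdry e = emb_bdry e'"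
  shows "e = e'"
proof -
  obtain H f where h: "embedding H G f" "e = emb_class H f"
    "emb_verts e = snd f ` verts H" "emb_bdry e = fst f ` bdry H"
    using assms(1) by (rule EmbE)
  obtain H' f' where h': "embedding H' G f'" "e' = emb_class H' f'"
    "emb_verts e' = snd f' ` verts H'" "emb_bdry e' = fst f' ` bdry H'"
    using assms(2) by (rule EmbE)
  have V: "snd f ` verts H = snd f' ` verts H'" using h h' assms by simp
  have B: "fst f ` bdry H = fst f' ` bdry H'" using h h' assms by simp
  have nv: "verts K = {}" "darts K = {}" if "connected_graph K" "nodeless K" for K
    using that by (auto simp: connected_graph_def is_graph_def)
  \<comment> \<open>An empty vertex set together with an empty boundary can only come from a
    nodeless loop.\<close>
  have n: "nodeless H = nodeless H'"
  proof -
    have *: "nodeless H2" if "embedding H1 G f1" "embedding H2 G f2"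
      "snd f1 ` verts H1 = snd f2 ` verts H2" "fst f1 ` bdry H1 = fst f2 ` bdry H2" "nodeless H1"
      for H1 H2 f1 f2
    proof -
      have c: "connected_graph H1" "connected_graph H2" using that(1,2) by (auto dest: embeddingD)
      have "verts H1 = {}" "bdry H1 = {}" using nv[OF c(1) that(5)] that(5) by (auto simp: bdry_def)
      then have "verts H2 = {}" "bdry H2 = {}" using that(3,4) by auto
      then show ?thesis by (rule no_verts_no_bdry[OF c(2)])
    qed
    show ?thesis using *[OF h(1) h'(1) V B] *[OF h'(1) h(1) V[symmetric] B[symmetric]] by blast
  qed
  \<comment> \<open>A nodeless loop embeds only into a nodeless loop, and an injection between
    two-element arc sets is onto. This supplies the image of the non-darts, which the boundary does
    not show.\<close>
  have loop: "fst g ` (arcs K - darts K) = arcs G" if "embedding K G g" "nodeless K" for K g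
  proof -
    note k = embeddingD[OF that(1)] etaleD[OF embeddingD(1)[OF that(1)]]
    have "separated K G g" using that(1) by (rule embedding_separated)
    then have "inj_on (fst g) (arcs K)" using nv[OF k(2) that(2)] by (simp add: separated_def)
    moreover have "card (arcs K) = 2" "card (arcs G) = 2" "finite (arcs G)"
      using k(5-7) that(2) by (auto simp: is_graph_def)
    ultimately have "fst g ` arcs K = arcs G"
      using k(10) by (intro card_subset_eq) (auto simp: card_image)
    then show ?thesis using nv[OF k(2) that(2)] by simp
  qed
  have N: "fst f ` (arcs H - darts H) = fst f' ` (arcs H' - darts H')"
  proof (cases "nodeless H")
    case True
    then show ?thesis using loop[OF h(1)] loop[OF h'(1)] n by simp
  next
    case False
    then show ?thesis using B n by (simp add: bdry_def)
  qed
  note s = embedding_separated[OF h(1)] embedding_separated[OF h'(1)]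
  show ?thesis
    unfolding h(2) h'(2)
    using emb_class_subset[OF separated_factor[OF s n V N]]
      emb_class_subset[OF separated_factor[OF s(2,1) n[symmetric] V[symmetric] N[symmetric]]]
    by (rule equalityI)
qed

section \<open>Classes of embeddings as pairs of a vertex set and a boundary\<close>

text \<open>
  The pairs \<open>(S, B)\<close> with \<open>full G S B\<close> are the images of the vertices and the boundary under
  embeddings whose domain has a vertex: the domain is recovered from \<open>G\<close> by cutting the edges
  at the darts \<open>d\<close> over \<open>S\<close> with \<open>opp G d \<in> B\<close>, and the last condition is its connectedness.
\<close>

definition full :: "graph \<Rightarrow> nat set \<Rightarrow> nat set \<Rightarrow> bool" where
  "full G S B \<longleftrightarrow> S \<noteq> {} \<and> S \<subseteq> verts G \<and> B \<subseteq> arcs G \<and> opp G ` B \<subseteq> dts G S \<and>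
     (\<forall>d\<in>dts G S. opp G d \<notin> dts G S \<longrightarrow> opp G d \<in> B) \<and>
     (\<forall>d\<in>dts G S. opp G d \<in> dts G S \<longrightarrow> d \<in> B \<longrightarrow> opp G d \<in> B) \<and>
     (\<forall>T. T \<subseteq> S \<longrightarrow> T \<noteq> {} \<longrightarrow> T \<noteq> S \<longrightarrow> (\<exists>d\<in>dts G T. opp G d \<in> dts G (S - T) \<and> d \<notin> B))"

definition emb_ok :: "graph \<Rightarrow> nat set \<Rightarrow> nat set \<Rightarrow> bool" where
  "emb_ok G S B \<longleftrightarrow> (S = {} \<and> (\<exists>a\<in>arcs G. B = {a, opp G a})) \<or>
     (nodeless G \<and> S = {} \<and> B = {}) \<or> full G S B"

lemma fullD:
  assumes "full G S B"
  shows "S \<noteq> {}" "S \<subseteq> verts G" "B \<subseteq> arcs G" "b \<in> B \<Longrightarrow> opp G b \<in> dts G S"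
    "d \<in> dts G S \<Longrightarrow> opp G d \<notin> dts G S \<Longrightarrow> opp G d \<in> B"
    "d \<in> dts G S \<Longrightarrow> opp G d \<in> dts G S \<Longrightarrow> d \<in> B \<Longrightarrow> opp G d \<in> B"
    "T \<subseteq> S \<Longrightarrow> T \<noteq> {} \<Longrightarrow> T \<noteq> S \<Longrightarrow> \<exists>d\<in>dts G T. opp G d \<in> dts G (S - T) \<and> d \<notin> B"
  using assms unfolding full_def by auto

lemma dts_arcs: "is_graph G \<Longrightarrow> d \<in> dts G S \<Longrightarrow> d \<in> arcs G"
  by (auto simp: dts_iff dest: graph_dart)

section \<open>Joining and gluing of pieces\<close>

lemma full_star:
  assumes g: "is_graph G" and v: "v \<in> verts G"
  shows "full G {v} (opp G ` nb G v)"
  unfolding full_def nb_eq_dts using v graph_opp[OF g] dts_arcs[OF g]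
  by (auto simp: subset_singleton_iff)

text \<open>Both ends of the cut edge lie over \<open>S\<close>, so mending it adds nothing outside
  the piece; and shrinking \<open>B\<close> only makes more edges available for
  connectedness.\<close>

lemma full_glue:
  assumes g: "is_graph G" and f: "full G S B" and c: "c \<in> B" "opp G c \<in> B"
  shows "full G S (B - {c, opp G c})"
proof -
  note F = fullD[OF f]
  have o: "opp G (opp G a) = a" if "a \<in> arcs G" for a using graph_opp(2)[OF g that] .
  have cD: "c \<in> dts G S" "opp G c \<in> dts G S"
    using F(4)[OF c(1)] F(4)[OF c(2)] o F(3) c(1) by auto
  have "\<exists>d\<in>dts G T. opp G d \<in> dts G (S - T) \<and> d \<notin> B - {c, opp G c}"
    if "T \<subseteq> S" "T \<noteq> {}" "T \<noteq> S" for T using F(7)[OF that] by blast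
  moreover have "opp G d \<in> B - {c, opp G c}" if "d \<in> dts G S" "opp G d \<notin> dts G S" for d
    using F(5)[OF that] that cD by auto
  moreover have "opp G d \<in> B - {c, opp G c}"
    if "d \<in> dts G S" "opp G d \<in> dts G S" "d \<in> B - {c, opp G c}" for d
  proof -
    have "d \<in> arcs G" "c \<in> arcs G" using that c F(3) by auto
    then have "opp G d \<noteq> c" "opp G d \<noteq> opp G c" using that(3) o by (metis Diff_iff insertCI)+
    then show ?thesis using F(6)[OF that(1,2)] that(3) by blast
  qed
  moreover have "opp G ` (B - {c, opp G c}) \<subseteq> dts G S" "B - {c, opp G c} \<subseteq> arcs G" using F(3,4) by auto
  ultimately show ?thesis unfolding full_def using F(1,2) by simp
qed

text \<open>Only the edge of \<open>c\<close> is mended; every other edge between \<open>S1\<close>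
  and \<open>S2\<close> stays cut and keeps both of its arcs in the boundary.\<close>

lemma full_join:
  assumes g: "is_graph G" and f: "full G S1 B1" "full G S2 B2" and dis: "S1 \<inter> S2 = {}"
    and c: "c \<in> B1" "opp G c \<in> B2"
  shows "full G (S1 \<union> S2) ((B1 - {c}) \<union> (B2 - {opp G c}))" (is "full G ?S ?B")
proof -
  note F = fullD[OF f(1)] and F' = fullD[OF f(2)]
  have o: "opp G (opp G a) = a" if "a \<in> arcs G" for a using graph_opp(2)[OF g that] .
  have un: "dts G ?S = dts G S1 \<union> dts G S2" and dis': "dts G S1 \<inter> dts G S2 = {}"
    using dis by (auto simp: dts_iff)
  have cD: "opp G c \<in> dts G S1" "c \<in> dts G S2"
    using F(4)[OF c(1)] F'(4)[OF c(2)] o F(3) c(1) by auto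
  have dts_o: "opp G (opp G d) = d" if "d \<in> dts G S1 \<or> d \<in> dts G S2" for d
    using that dts_arcs[OF g] o by blast
  have 1: "opp G ` ?B \<subseteq> dts G ?S" using F(4) F'(4) un by auto
  have 2: "opp G d \<in> ?B" if "d \<in> dts G ?S" "opp G d \<notin> dts G ?S" for d
    using that F(5) F'(5) un cD by auto
  have 3: "opp G d \<in> ?B" if d: "d \<in> dts G ?S" "opp G d \<in> dts G ?S" "d \<in> ?B" for d
  proof -
    from d(3) consider "d \<in> B1" "d \<noteq> c" | "d \<in> B2" "d \<noteq> opp G c" by blast
    then show ?thesis
    proof cases
      case 1
      then have oD: "opp G d \<in> dts G S1" using F(4) by blast
      show ?thesis
      proof (cases "d \<in> dts G S1")
        case True
        then have "opp G d \<in> B1" using F(6) 1 oD by blast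
        moreover have "opp G d \<noteq> c" using oD cD(2) dis' by auto
        ultimately show ?thesis by blast
      next
        case False
        then have d2: "d \<in> dts G S2" using d un by blast
        moreover have "opp G d \<notin> dts G S2" using oD dis' by blast
        ultimately have "opp G d \<in> B2" using F'(5) by blast
        moreover have "opp G d \<noteq> opp G c" using dts_o[of d] dts_o[of c] d2 cD 1 by metis
        ultimately show ?thesis by blast
      qed
    next
      case 2
      then have oD: "opp G d \<in> dts G S2" using F'(4) by blast
      show ?thesis
      proof (cases "d \<in> dts G S2")
        case True
        then have "opp G d \<in> B2" using F'(6) 2 oD by blast
        moreover have "opp G d \<noteq> opp G c" using oD cD(1) dis' by auto
        ultimately show ?thesis by blast
      next
        case False
        then have d2: "d \<in> dts G S1" using d un by blast
        moreover have "opp G d \<notin> dts G S1" using oD dis' by blast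
        ultimately have "opp G d \<in> B1" using F(5) by blast
        moreover have "opp G d \<noteq> c" using dts_o[of d] d2 2 by metis
        ultimately show ?thesis by blast
      qed
    qed
  qed
  have cB: "c \<notin> B2" "opp G c \<notin> B1" using F(4) F'(4) cD dts_o[of c] dis' by fastforce+
  have 4: "\<exists>d\<in>dts G T. opp G d \<in> dts G (?S - T) \<and> d \<notin> ?B"
    if T: "T \<subseteq> ?S" "T \<noteq> {}" "T \<noteq> ?S" for T
  proof -
    \<comment> \<open>Either \<open>T\<close> divides one of the two pieces, whose own connectedness
      gives a crossing edge, or \<open>T\<close> is one of the pieces and the mended edge
      crosses.\<close>
    consider "T \<inter> S1 \<noteq> {}" "T \<inter> S1 \<noteq> S1" | "T \<inter> S2 \<noteq> {}" "T \<inter> S2 \<noteq> S2"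
      | "T = S1" | "T = S2" using T by blast
    then show ?thesis
    proof cases
      case 1
      then obtain d where d: "d \<in> dts G (T \<inter> S1)" "opp G d \<in> dts G (S1 - T \<inter> S1)" "d \<notin> B1"
        using F(7)[of "T \<inter> S1"] by blast
      then have "opp G d \<notin> dts G S2" using dis by (auto simp: dts_iff)
      then have "d \<notin> B2" using F'(4) by blast
      then show ?thesis using d by (intro bexI[of _ d]) (auto simp: dts_iff)
    next
      case 2
      then obtain d where d: "d \<in> dts G (T \<inter> S2)" "opp G d \<in> dts G (S2 - T \<inter> S2)" "d \<notin> B2"
        using F'(7)[of "T \<inter> S2"] by blast
      then have "opp G d \<notin> dts G S1" using dis by (auto simp: dts_iff)
      then have "d \<notin> B1" using F(4) by blast
      then show ?thesis using d by (intro bexI[of _ d]) (auto simp: dts_iff)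
    next
      case 3
      then show ?thesis using cD cB dts_o[of c] dis
        by (intro bexI[of _ "opp G c"]) (auto simp: dts_iff)
    next
      case 4
      then show ?thesis using cD cB dis by (intro bexI[of _ c]) (auto simp: dts_iff)
    qed
  qed
  have "?S \<noteq> {}" "?S \<subseteq> verts G" "?B \<subseteq> arcs G" using F(1-3) F'(1-3) by auto
  then show ?thesis unfolding full_def using 1 2 3 4 by simp
qed

lemma emb_ok_arcs: "is_graph G \<Longrightarrow> emb_ok G S B \<Longrightarrow> B \<subseteq> arcs G"
  by (auto simp: emb_ok_def full_def intro: graph_opp)

text \<open>An edge is a unit for joining: attaching one at \<open>c\<close> returns the other pair.
  Nodeless loops cannot occur, as both boundaries are non-empty. The disjointness is what keeps a
  graphical map injective on the boundary of a joined piece.\<close>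

lemma emb_ok_join:
  assumes g: "is_graph G" and f: "emb_ok G S1 B1" "emb_ok G S2 B2" and dis: "S1 \<inter> S2 = {}"
    and c: "c \<in> B1" "opp G c \<in> B2"
  shows "emb_ok G (S1 \<union> S2) ((B1 - {c}) \<union> (B2 - {opp G c}))" (is "emb_ok G ?S ?B")
    and "(B1 - {c}) \<inter> (B2 - {opp G c}) = {}"
proof -
  have edge: "B = {a, opp G a}" if "a \<in> B" "\<exists>a\<in>arcs G. B = {a, opp G a}" for a B
  proof -
    from that(2) obtain x where x: "x \<in> arcs G" "B = {x, opp G x}" by blast
    with that(1) have "a = x \<or> a = opp G x" by blast
    then show ?thesis using x(2) graph_opp(2)[OF g x(1)] by (metis insert_commute)
  qed
  have "c \<in> arcs G" using emb_ok_arcs[OF g f(1)] c by blast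
  note oc = graph_opp(2)[OF g this] and ne = graph_opp(3)[OF g this]
  have "B1 = {c, opp G c}" if "\<exists>a\<in>arcs G. B1 = {a, opp G a}" using edge[OF c(1) that] .
  moreover have "B2 = {c, opp G c}" if "\<exists>a\<in>arcs G. B2 = {a, opp G a}"
    using edge[OF c(2) that] oc by (simp add: insert_commute)
  moreover have "B1 \<noteq> {}" "B2 \<noteq> {}" using c by auto
  ultimately consider (l) "S1 = {}" "B1 = {c, opp G c}" | (r) "S2 = {}" "B2 = {c, opp G c}" | (v) "full G S1 B1" "full G S2 B2"
    using f unfolding emb_ok_def by blast
  then have "emb_ok G ?S ?B \<and> (B1 - {c}) \<inter> (B2 - {opp G c}) = {}"
  proof cases
    case l
    then have "?S = S2" "?B = B2" using ne c by auto
    then show ?thesis using f l by auto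
  next
    case r
    then have "?S = S1" "?B = B1" using ne c by auto
    then show ?thesis using f r by auto
  next
    case v
    have "(B1 - {c}) \<inter> (B2 - {opp G c}) = {}"
      using fullD(4)[OF v(1)] fullD(4)[OF v(2)] dis by (fastforce simp: dts_iff)
    then show ?thesis using full_join[OF g v dis c] by (simp add: emb_ok_def)
  qed
  then show "emb_ok G ?S ?B" "(B1 - {c}) \<inter> (B2 - {opp G c}) = {}" by auto
qed

text \<open>Starting from the star of one vertex, attach further stars, each along an edge that is
  uncut in \<open>(S, B)\<close>; connectedness of \<open>(S, B)\<close> provides such an edge as
  long as a vertex is missing. Once all vertices are present, only edges cut too often remain, and
  these are glued one by one.\<close>

lemma full_induct:
  assumes g: "is_graph G" and f: "full G S B"
    and star: "\<And>v. v \<in> verts G \<Longrightarrow> Q {v} (opp G ` nb G v)"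
    and join: "\<And>T C v c. full G T C \<Longrightarrow> Q T C \<Longrightarrow> v \<in> verts G \<Longrightarrow> v \<notin> T \<Longrightarrow>
      c \<in> C \<Longrightarrow> c \<in> nb G v \<Longrightarrow> Q (T \<union> {v}) ((C - {c}) \<union> (opp G ` nb G v - {opp G c}))"
    and glue: "\<And>T C c. full G T C \<Longrightarrow> Q T C \<Longrightarrow> c \<in> C \<Longrightarrow> opp G c \<in> C \<Longrightarrow>
      full G T (C - {c, opp G c}) \<Longrightarrow> Q T (C - {c, opp G c})"
  shows "Q S B"
proof -
  note F = fullD[OF f]
  have fin: "finite (arcs G)" "finite S"
    using g F(2) by (auto simp: is_graph_def intro: finite_subset)
  have o: "opp G (opp G a) = a" if "a \<in> arcs G" for a using graph_opp(2)[OF g that] .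
  have dts_o: "opp G (opp G d) = d" if "d \<in> dts G T" for d T
    using that dts_arcs[OF g] o by blast
  \<comment> \<open>\<open>Suc n\<close> because the process starts with one vertex. The last
    conjunct is the invariant: no arc of \<open>B\<close> facing a dart over \<open>T\<close> is
    ever mended, so \<open>C\<close> contains \<open>B\<close> at the end.\<close>
  have "\<exists>T C. T \<subseteq> S \<and> card T = Suc n \<and> full G T C \<and> Q T C \<and>
      (\<forall>b\<in>B. opp G b \<in> dts G T \<longrightarrow> b \<in> C)" if "n < card S" for n
    using that
  proof (induction n)
    case 0
    obtain v where v: "v \<in> S" using F(1) by auto
    have "\<forall>b\<in>B. opp G b \<in> dts G {v} \<longrightarrow> b \<in> opp G ` nb G v"
      unfolding nb_eq_dts using o F(3) by (metis image_eqI subsetD)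
    then show ?case using v F(2) star full_star[OF g]
      by (intro exI[of _ "{v}"] exI[of _ "opp G ` nb G v"]) auto
  next
    case (Suc n)
    then obtain T C where T: "T \<subseteq> S" "card T = Suc n" "full G T C" "Q T C"
      "\<forall>b\<in>B. opp G b \<in> dts G T \<longrightarrow> b \<in> C" by auto
    have "T \<noteq> {}" "T \<noteq> S" using T(2) Suc.prems by auto
    then obtain d where d: "d \<in> dts G T" "opp G d \<in> dts G (S - T)" "d \<notin> B"
      using F(7)[OF T(1)] by blast
    define v where "v = tgt G (opp G d)"
    have v: "v \<in> S" "v \<notin> T" "v \<in> verts G" "opp G d \<in> nb G v"
      using d(2) F(2) by (auto simp: v_def dts_iff nb_def)
    have "opp G d \<notin> dts G T" using d(2) by (auto simp: dts_iff)
    then have C: "opp G d \<in> C" using fullD(5)[OF T(3) d(1)] by blast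
    have od: "opp G (opp G d) = d" using d(1) by (rule dts_o)
    have dS: "d \<in> dts G S" "opp G d \<in> dts G S" using d T(1) by (auto simp: dts_iff)
    \<comment> \<open>Joining along the edge of \<open>d\<close> removes both of its arcs from the
      respective boundaries, so both must lie outside \<open>B\<close> for the invariant to
      survive.\<close>
    have odB: "opp G d \<notin> B" using F(6)[OF dS(2)] od dS(1) d(3) by auto
    let ?C = "(C - {opp G d}) \<union> (opp G ` nb G v - {opp G (opp G d)})"
    have "opp G (opp G d) \<in> opp G ` nb G v" using v(4) by blast
    then have "full G (T \<union> {v}) ?C"
      using full_join[OF g T(3) full_star[OF g v(3)] _ C] v(2) by simp
    moreover have "Q (T \<union> {v}) ?C" using join[OF T(3,4) v(3,2) C v(4)] .
    moreover have "b \<in> ?C" if b: "b \<in> B" "opp G b \<in> dts G (T \<union> {v})" for b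
    proof (cases "opp G b \<in> dts G T")
      case True
      then show ?thesis using T(5) b odB by auto
    next
      case False
      then have "opp G b \<in> nb G v" using b(2) by (auto simp: dts_iff nb_def)
      then have "b \<in> opp G ` nb G v" using o[of b] b(1) F(3) by (metis image_eqI subsetD)
      then show ?thesis using od d(3) b by auto
    qed
    moreover have "card (T \<union> {v}) = Suc (Suc n)"
      using T(2) v(2) finite_subset[OF T(1) fin(2)] by simp
    ultimately show ?case using T(1) v(1)
      by (intro exI[of _ "T \<union> {v}"] exI[of _ ?C]) auto
  qed
  from this[of "card S - 1"] obtain T C where T: "T \<subseteq> S" "card T = card S" "full G T C" "Q T C"
    "\<forall>b\<in>B. opp G b \<in> dts G T \<longrightarrow> b \<in> C"
    using F(1) fin(2) by (metis Suc_pred' card_gt_0_iff diff_less zero_less_one)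
  have TS: "T = S" using T(1,2) fin(2) by (metis card_subset_eq)
  \<comment> \<open>Induction on the number of arcs of \<open>C\<close> outside \<open>B\<close>. An
    arc \<open>c\<close> of this kind, and its opposite, lie over \<open>S\<close>; otherwise
    fullness of \<open>(S, B)\<close> would put \<open>c\<close> into \<open>B\<close>. Hence the
    two can be glued.\<close>
  have "Q S B" if "full G S C" "Q S C" "B \<subseteq> C" for C
    using that
  proof (induction "card (C - B)" arbitrary: C rule: less_induct)
    case less
    note E = fullD[OF less.prems(1)]
    show ?case
    proof (cases "C = B")
      case True
      then show ?thesis using less.prems by simp
    next
      case False
      then obtain c where c: "c \<in> C" "c \<notin> B" using less.prems by auto
      have ca: "c \<in> arcs G" using E(3) c by auto
      have oS: "opp G c \<in> dts G S" using E(4)[OF c(1)] .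
      have cS: "c \<in> dts G S" using F(5)[OF oS] o[OF ca] c(2) by auto
      have oC: "opp G c \<in> C" using E(6)[OF cS oS c(1)] .
      have oB: "opp G c \<notin> B" using F(6)[OF oS] o[OF ca] cS c(2) by auto
      note fl = full_glue[OF g less.prems(1) c(1) oC]
      have "card (C - {c, opp G c} - B) < card (C - B)"
        using c E(3) fin(1) by (intro psubset_card_mono) (auto intro: finite_subset)
      moreover have "B \<subseteq> C - {c, opp G c}" using c oB less.prems by auto
      ultimately show ?thesis
        using less.hyps[OF _ fl glue[OF less.prems(1,2) c(1) oC fl]] by blast
    qed
  qed
  moreover have "B \<subseteq> C" using T(5) F(4) TS by auto
  ultimately show ?thesis using T(3,4) TS by simp
qed

text \<open>With an empty boundary no edge leaves \<open>S\<close>, so connectedness makes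
  \<open>S\<close> everything. A non-dart of \<open>G\<close> would face a dart over
  \<open>S\<close> and would have to belong to the empty boundary.\<close>

lemma full_no_bdry:
  assumes c: "connected_graph G" and f: "full G S {}"
  shows "S = verts G" "bdry G = {}"
proof -
  note F = fullD[OF f]
  have g: "is_graph G" using c by (rule connected_is_graph)
  show S: "S = verts G"
  proof (rule ccontr)
    assume "S \<noteq> verts G"
    then obtain d where d: "d \<in> dts G S" "opp G d \<in> dts G (verts G - S)"
      using connected_cut[OF c F(2,1)] by blast
    then have "opp G d \<notin> dts G S" by (auto simp: dts_iff)
    then show False using F(5)[OF d(1)] by simp
  qed
  have "b \<in> darts G" if b: "b \<in> arcs G" for b
  proof (rule ccontr)
    assume n: "b \<notin> darts G"
    then have "opp G b \<in> darts G" using connected_free_edge(2)[OF c b] F(1,2) by blast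
    then have "opp G b \<in> dts G S" using graph_dart[OF g] S by (auto simp: dts_iff)
    then show False using F(5)[of "opp G b"] graph_opp(2)[OF g b] n by (auto simp: dts_iff)
  qed
  then show "bdry G = {}" by (auto simp: bdry_def)
qed

text \<open>This is the pair of the identity embedding; it allows the whole of \<open>G\<close> to
  be substituted.\<close>

lemma full_verts:
  assumes c: "connected_graph G" and v: "verts G \<noteq> {}"
  shows "full G (verts G) (bdry G)"
proof -
  have g: "is_graph G" using c by (rule connected_is_graph)
  have "\<not> nodeless G" using g v by (auto simp: is_graph_def)
  then have b: "bdry G = arcs G - darts G" by (simp add: bdry_def)
  have d: "dts G (verts G) = darts G" using graph_dart[OF g] by (auto simp: dts_iff)
  have cut: "\<exists>d\<in>dts G T. opp G d \<in> dts G (verts G - T) \<and> d \<notin> bdry G"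
    if "T \<subseteq> verts G" "T \<noteq> {}" "T \<noteq> verts G" for T
    using connected_cut[OF c that] by (auto simp: dts_iff b)
  have "opp G a \<in> darts G" if "a \<in> bdry G" for a
    using that connected_free_edge(2)[OF c] v by (auto simp: b)
  then show ?thesis
    unfolding full_def d using v cut graph_opp(1)[OF g] graph_dart(1)[OF g] by (auto simp: b)
qed

section \<open>Pairs from embeddings and embeddings from pairs\<close>

lemma embedding_emb_ok:
  assumes f: "embedding H G f"
  shows "emb_ok G (snd f ` verts H) (fst f ` bdry H)"
proof (cases "verts H = {}")
  case True
  then obtain a where a: "a \<in> arcs H" "arcs H = {a, opp H a}" "darts H = {}"
    using connected_no_verts[OF embeddingD(2)[OF f]] by blast
  note e = embeddingD[OF f] and e' = etaleD[OF embeddingD(1)[OF f]]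
  show ?thesis
  proof (cases "nodeless H")
    case nl: True
    then show ?thesis using e(5) True by (simp add: emb_ok_def bdry_def)
  next
    case False
    then have "bdry H = {a, opp H a}" using a(2,3) by (simp add: bdry_def)
    then have "fst f ` bdry H = {fst f a, opp G (fst f a)}" using e'(4)[OF a(1)] by simp
    then show ?thesis using True e'(3)[OF a(1)] by (auto simp: emb_ok_def)
  qed
next
  case False
  note e = embeddingD[OF f] and e' = etaleD[OF embeddingD(1)[OF f]]
  let ?S = "snd f ` verts H" and ?B = "fst f ` bdry H"
  have "\<not> nodeless H" using e(6) False by (auto simp: is_graph_def)
  then have bd: "bdry H = arcs H - darts H" by (simp add: bdry_def)
  have ob: "opp H b \<in> darts H" if "b \<in> bdry H" for b
    using that connected_free_edge(2)[OF e(2)] False by (auto simp: bd)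
  have D: "dts G ?S = fst f ` darts H" and iD: "inj_on (fst f) (darts H)"
    using etale_darts[OF e(1,4)] by (auto simp: bij_betw_def)
  have da: "d \<in> arcs H" if "d \<in> darts H" for d using graph_dart[OF e(6) that] by simp
  \<comment> \<open>If \<open>opp H d\<close> were a dart too, pick a boundary arc \<open>b\<close>
    with the same image as \<open>d\<close>. Both opposites are darts with equal images, so
    injectivity gives \<open>d = b\<close>, although \<open>b\<close> is no dart.\<close>
  have boundary_dart: "opp H d \<in> bdry H" if d: "d \<in> darts H" "fst f d \<in> ?B" for d
  proof (rule ccontr)
    assume "opp H d \<notin> bdry H"
    then have od: "opp H d \<in> darts H" using d graph_opp(1)[OF e(6) da] by (auto simp: bd)
    obtain b where b: "b \<in> bdry H" "fst f d = fst f b" using d by auto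
    then have "fst f (opp H d) = fst f (opp H b)" using e'(4) da[OF d(1)] by (auto simp: bd)
    then have "opp H d = opp H b" using od ob[OF b(1)] iD by (auto dest: inj_onD)
    then have "d = b" using graph_opp(2)[OF e(6)] da[OF d(1)] b by (metis DiffD1 bd)
    then show False using b d by (simp add: bd)
  qed
  have 1: "?B \<subseteq> arcs G" using e'(3) by (auto simp: bd)
  have 2: "opp G ` ?B \<subseteq> dts G ?S"
  proof
    fix x assume "x \<in> opp G ` ?B"
    then obtain b where b: "b \<in> bdry H" "x = opp G (fst f b)" by auto
    then have "x = fst f (opp H b)" using e'(4) by (auto simp: bd)
    then show "x \<in> dts G ?S" using ob[OF b(1)] D by auto
  qed
  have 3: "opp G d \<in> ?B" if d: "d \<in> dts G ?S" "opp G d \<notin> dts G ?S" for d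
  proof -
    obtain c where c: "c \<in> darts H" "d = fst f c" using d D by auto
    then have o: "opp G d = fst f (opp H c)" using e'(4) da by simp
    then have "opp H c \<in> bdry H" using d D graph_opp(1)[OF e(6) da[OF c(1)]] by (auto simp: bd)
    then show ?thesis using o by auto
  qed
  have 4: "opp G d \<in> ?B" if d: "d \<in> dts G ?S" "d \<in> ?B" for d
  proof -
    obtain c where c: "c \<in> darts H" "d = fst f c" using d D by auto
    then have "opp H c \<in> bdry H" using boundary_dart d by auto
    then show ?thesis using c e'(4) da by (metis imageI)
  qed
  have 5: "\<exists>d\<in>dts G T. opp G d \<in> dts G (?S - T) \<and> d \<notin> ?B"
    if T: "T \<subseteq> ?S" "T \<noteq> {}" "T \<noteq> ?S" for T
  proof -
    let ?T = "{v \<in> verts H. snd f v \<in> T}"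
    have "?T \<noteq> {}" "?T \<noteq> verts H" using T by auto
    then obtain c where c: "c \<in> dts H ?T" "opp H c \<in> dts H (verts H - ?T)"
      using connected_cut[OF e(2), of ?T] by auto
    have cd: "c \<in> darts H" "opp H c \<in> darts H" using c by (auto simp: dts_iff)
    have "fst f c \<in> dts G T" using c e'(6,7) by (auto simp: dts_iff)
    moreover have "opp G (fst f c) \<in> dts G (?S - T)"
      using c e'(4)[OF da[OF cd(1)], symmetric] e'(6,7)[OF cd(2)] by (auto simp: dts_iff)
    moreover have "fst f c \<notin> ?B" using boundary_dart[OF cd(1)] cd(2) by (auto simp: bd)
    ultimately show ?thesis by blast
  qed
  have "full G ?S ?B" unfolding full_def using False e'(5) 1 2 3 4 5 by auto
  then show ?thesis by (simp add: emb_ok_def)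
qed

text \<open>The arc \<open>2 * d + 1\<close> is the new boundary arc facing a dart \<open>d\<close>
  whose edge is cut; it lies over \<open>opp G d\<close>. An edge cut with both ends over
  \<open>S\<close> thus yields four arcs. The encoding copies that of \<open>star_on\<close>, so
  that stars become instances.\<close>

definition cut_graph :: "graph \<Rightarrow> nat set \<Rightarrow> nat set \<Rightarrow> graph" where
  "cut_graph G S B =
     \<lparr>arcs = (\<lambda>d. 2 * d) ` dts G S \<union> (\<lambda>d. 2 * d + 1) ` {d \<in> dts G S. opp G d \<in> B}, verts = S,
      opp = (\<lambda>a\<in>(\<lambda>d. 2 * d) ` dts G S \<union> (\<lambda>d. 2 * d + 1) ` {d \<in> dts G S. opp G d \<in> B}.
        if even a then if opp G (a div 2) \<in> B then a + 1 else 2 * opp G (a div 2) else a - 1),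
      darts = (\<lambda>d. 2 * d) ` dts G S, tgt = (\<lambda>a\<in>(\<lambda>d. 2 * d) ` dts G S. tgt G (a div 2)),
      nodeless = False\<rparr>"

definition cut_map :: "graph \<Rightarrow> nat set \<Rightarrow> nat set \<Rightarrow> gfun" where
  "cut_map G S B =
     (\<lambda>a\<in>arcs (cut_graph G S B). if even a then a div 2 else opp G (a div 2), \<lambda>u\<in>S. u)"

text \<open>Shared encoding gives an equality rather than an isomorphism, so the facts about
  \<open>iota_class\<close> are instances of those about \<open>cut_map\<close>.\<close>

lemma star_on_eq_cut: "star_on v (nb G v) = cut_graph G {v} (opp G ` nb G v)"
proof -
  have 1: "{d \<in> dts G {v}. opp G d \<in> opp G ` dts G {v}} = dts G {v}" by auto
  have 2: "tgt G d = v" if "d \<in> dts G {v}" for d using that by (simp add: dts_iff)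
  show ?thesis
    unfolding star_on_def cut_graph_def nb_eq_dts 1 using 2
    by (auto simp: fun_eq_iff restrict_def)
qed

lemma iota_eq_cut: "iota G v = cut_map G {v} (opp G ` nb G v)"
  by (simp add: iota_def cut_map_def star_on_eq_cut)

lemma cut_graph_simps:
  "verts (cut_graph G S B) = S" "nodeless (cut_graph G S B) = False"
  "2 * d \<in> arcs (cut_graph G S B) \<longleftrightarrow> d \<in> dts G S"
  "Suc (2 * d) \<in> arcs (cut_graph G S B) \<longleftrightarrow> d \<in> dts G S \<and> opp G d \<in> B"
  "2 * d \<in> darts (cut_graph G S B) \<longleftrightarrow> d \<in> dts G S"
  "Suc (2 * d) \<notin> darts (cut_graph G S B)"
  "d \<in> dts G S \<Longrightarrow> opp (cut_graph G S B) (2 * d) = (if opp G d \<in> B then Suc (2 * d) else 2 * opp G d)"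
  "d \<in> dts G S \<Longrightarrow> opp G d \<in> B \<Longrightarrow> opp (cut_graph G S B) (Suc (2 * d)) = 2 * d"
  "d \<in> dts G S \<Longrightarrow> tgt (cut_graph G S B) (2 * d) = tgt G d"
  "d \<in> dts G S \<Longrightarrow> fst (cut_map G S B) (2 * d) = d"
  "d \<in> dts G S \<Longrightarrow> opp G d \<in> B \<Longrightarrow> fst (cut_map G S B) (Suc (2 * d)) = opp G d"
  by (auto simp: cut_graph_def cut_map_def) presburger+

lemma cut_graph_arcE:
  assumes "a \<in> arcs (cut_graph G S B)"
  obtains d where "a = 2 * d" "d \<in> dts G S" | d where "a = Suc (2 * d)" "d \<in> dts G S" "opp G d \<in> B"
  using assms by (auto simp: cut_graph_def)

lemma cut_embedding:
  assumes c: "connected_graph G" and f: "full G S B"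
  shows "embedding (cut_graph G S B) G (cut_map G S B)"
    and "snd (cut_map G S B) ` verts (cut_graph G S B) = S"
    and "fst (cut_map G S B) ` bdry (cut_graph G S B) = B"
proof -
  let ?H = "cut_graph G S B" and ?f = "cut_map G S B"
  note F = fullD[OF f] and s = cut_graph_simps
  have g: "is_graph G" using c by (rule connected_is_graph)
  have da: "d \<in> arcs G" "opp G (opp G d) = d" "opp G d \<in> arcs G" "opp G d \<noteq> d" if "d \<in> dts G S" for d
    using dts_arcs[OF g that] graph_opp[OF g] by auto
  \<comment> \<open>An uncut dart over \<open>S\<close> has its opposite over \<open>S\<close>,
    uncut as well. Hence the branch of \<open>opp\<close> for mended edges stays within the arcs and
    is involutive.\<close>
  have inner: "opp G d \<in> dts G S" "opp G (opp G d) \<notin> B" if "d \<in> dts G S" "opp G d \<notin> B" for d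
    using F(5)[OF that(1)] F(6)[OF that(1)] that da[OF that(1)] by auto
  have opp_in: "opp ?H a \<in> arcs ?H \<and> opp ?H (opp ?H a) = a \<and> opp ?H a \<noteq> a \<and>
    fst ?f (opp ?H a) = opp G (fst ?f a) \<and> fst ?f a \<in> arcs G" if "a \<in> arcs ?H" for a
    using that
  proof (cases rule: cut_graph_arcE)
    case (1 d)
    show ?thesis
    proof (cases "opp G d \<in> B")
      case True
      then show ?thesis using 1(2) da[OF 1(2)] unfolding 1(1) by (simp add: s)
    next
      case False
      note i = inner[OF 1(2) False]
      have "opp ?H (2 * d) = 2 * opp G d" "opp ?H (2 * opp G d) = 2 * opp G (opp G d)"
        using 1(2) False i s(7) by simp_all
      then show ?thesis using 1(2) i(1) da(1-4)[OF 1(2)] unfolding 1(1) by (simp add: s)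
    qed
  next
    case (2 d)
    then show ?thesis using da[OF 2(2)] by (simp add: s)
  qed
  have fin: "finite (dts G S)" "finite S"
    using g F(2) by (auto simp: is_graph_def dts_def intro: finite_subset)
  have dart: "d \<in> arcs ?H" "tgt ?H d \<in> S" "fst ?f d \<in> darts G" "tgt G (fst ?f d) = tgt ?H d"
    if "d \<in> darts ?H" for d
    using that by (auto simp: s dts_iff cut_graph_def cut_map_def)
  have ext: "opp ?H \<in> extensional (arcs ?H)" "tgt ?H \<in> extensional (darts ?H)"
    by (auto simp: cut_graph_def)
  have gH: "is_graph ?H"
    unfolding is_graph_def PiE_def using fin opp_in ext dart
    by (auto simp: s(1,2)) (auto simp: cut_graph_def)
  have dts_H: "dts ?H T = (\<lambda>d. 2 * d) ` dts G T" if "T \<subseteq> S" for T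
    using that by (auto simp: dts_iff cut_graph_def)
  have conn: "connected_graph ?H"
  proof (rule connectedI[OF gH])
    show "verts ?H \<noteq> {}" using F(1) by (simp add: s)
    show "opp ?H a \<in> darts ?H" if "a \<in> arcs ?H" "a \<notin> darts ?H" for a
      using that by (cases rule: cut_graph_arcE) (auto simp: s)
  next
    fix T assume "T \<subseteq> verts ?H" "T \<noteq> {}" "T \<noteq> verts ?H"
    then have T: "T \<subseteq> S" "T \<noteq> {}" "T \<noteq> S" by (auto simp: s)
    then obtain d where d: "d \<in> dts G T" "opp G d \<in> dts G (S - T)" "d \<notin> B" using F(7) by blast
    have dS: "d \<in> dts G S" "opp G d \<in> dts G S" using d T(1) by (auto simp: dts_iff)
    have "opp G d \<notin> B" using F(6)[OF dS(2)] da[OF dS(1)] dS d(3) by auto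
    then have "opp ?H (2 * d) = 2 * opp G d" using dS by (simp add: s)
    then show "\<exists>d\<in>dts ?H T. opp ?H d \<in> dts ?H (verts ?H - T)"
      using d dts_H[OF T(1)] dts_H[of "S - T"] by (auto simp: s)
  qed
  have nb: "bij_betw (fst ?f) (nb ?H v) (nb G v)" if "v \<in> S" for v
    unfolding nb_eq_dts bij_betw_def using that dts_H[of "{v}"] s(10)[of _ G S B]
    by (auto simp: inj_on_def image_image dts_iff)
  have "etale ?H G ?f"
    unfolding etale_def PiE_def using gH g opp_in dart nb F(2)
    by (auto simp: s(1)) (auto simp: cut_map_def s(1))
  then show "embedding ?H G ?f"
    unfolding embedding_def using conn c by (simp add: s) (simp add: cut_map_def inj_on_def)
  show "snd ?f ` verts ?H = S" by (simp add: s) (simp add: cut_map_def)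
  show "fst ?f ` bdry ?H = B"
  proof
    show "fst ?f ` bdry ?H \<subseteq> B"
      by (auto simp: bdry_def s elim!: cut_graph_arcE)
    show "B \<subseteq> fst ?f ` bdry ?H"
    proof
      fix b assume b: "b \<in> B"
      then have d: "opp G b \<in> dts G S" "opp G (opp G b) = b" using F(3,4) graph_opp[OF g] by auto
      then have "fst ?f (Suc (2 * opp G b)) = b" "Suc (2 * opp G b) \<in> bdry ?H"
        using b by (auto simp: s bdry_def)
      then show "b \<in> fst ?f ` bdry ?H" by (metis imageI)
    qed
  qed
qed

definition edge_map :: "graph \<Rightarrow> nat \<Rightarrow> gfun" where
  "edge_map G a = (\<lambda>i\<in>{0, 1}. if i = 0 then a else opp G a, \<lambda>v\<in>{}. v)"

lemma edge_graph_simps: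
  "arcs edge_graph = {0, 1}" "verts edge_graph = {}" "darts edge_graph = {}"
  "opp edge_graph 0 = 1" "opp edge_graph (Suc 0) = 0" "\<not> nodeless edge_graph" "bdry edge_graph = {0, 1}"
  by (simp_all add: edge_graph_def bdry_def)

lemma edge_graph_connected: "connected_graph edge_graph"
proof -
  have "\<not> disjoint_union_of_two edge_graph"
  proof
    assume "disjoint_union_of_two edge_graph"
    then obtain A1 A2 where A: "A1 \<union> A2 = {0, 1}" "A1 \<inter> A2 = {}" "A1 \<noteq> {}" "A2 \<noteq> {}"
      "opp edge_graph ` A1 \<subseteq> A1" "opp edge_graph ` A2 \<subseteq> A2"
      unfolding disjoint_union_of_two_def by (auto simp: edge_graph_simps)
    have "0 \<in> X \<longleftrightarrow> 1 \<in> X" if "opp edge_graph ` X \<subseteq> X" for X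
      using that edge_graph_simps(4,5) by (metis One_nat_def image_subset_iff)
    then have "{0, 1} \<subseteq> A1 \<or> {0, 1} \<subseteq> A2" using A by auto
    then show False using A by blast
  qed
  then show ?thesis
    by (auto simp: connected_graph_def is_graph_def edge_graph_def)
qed

lemma edge_embedding:
  assumes c: "connected_graph G" and a: "a \<in> arcs G"
  shows "embedding edge_graph G (edge_map G a)" "fst (edge_map G a) ` bdry edge_graph = {a, opp G a}"
proof -
  have g: "is_graph G" using c by (rule connected_is_graph)
  show "embedding edge_graph G (edge_map G a)"
    unfolding embedding_def etale_def edge_map_def
    using c edge_graph_connected connected_is_graph[OF edge_graph_connected] g a graph_opp[OF g a]
    by (auto simp: edge_graph_simps)
  show "fst (edge_map G a) ` bdry edge_graph = {a, opp G a}"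
    by (auto simp: edge_map_def edge_graph_simps)
qed

lemma id_embedding:
  assumes c: "connected_graph G"
  shows "embedding G G (\<lambda>a\<in>arcs G. a, \<lambda>v\<in>verts G. v)"
proof -
  have g: "is_graph G" using c by (rule connected_is_graph)
  have "bij_betw (\<lambda>a\<in>arcs G. a) (nb G v) (nb G v)" for v
    using graph_dart[OF g] by (subst bij_betw_cong[of _ _ id]) (auto simp: nb_def)
  then show ?thesis
    unfolding embedding_def etale_def using c g graph_opp[OF g] graph_dart[OF g]
    by (auto simp: inj_on_def)
qed

text \<open>The three disjuncts of \<open>emb_ok\<close> are realised by an edge, by the identity of
  a nodeless loop and by the cut graph.\<close>

lemma Emb_exists:
  assumes c: "connected_graph G" and S: "emb_ok G S B"
  obtains e where "e \<in> Emb G" "emb_verts e = S" "emb_bdry e = B"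
proof -
  have "\<exists>H f. embedding H G f \<and> snd f ` verts H = S \<and> fst f ` bdry H = B"
    using S unfolding emb_ok_def
  proof (elim disjE)
    assume "S = {} \<and> (\<exists>a\<in>arcs G. B = {a, opp G a})"
    then obtain a where "S = {}" "a \<in> arcs G" "B = {a, opp G a}" by blast
    then show ?thesis using edge_embedding[OF c]
      by (intro exI[of _ edge_graph] exI[of _ "edge_map G a"]) (simp add: edge_graph_simps)
  next
    assume l: "nodeless G \<and> S = {} \<and> B = {}"
    then have "verts G = {}" using connected_is_graph[OF c] by (simp add: is_graph_def)
    then show ?thesis using id_embedding[OF c] l
      by (intro exI[of _ G] exI conjI) (auto simp: bdry_def)
  next
    assume "full G S B"
    from cut_embedding[OF c this] show ?thesis by (intro exI conjI)
  qed
  then obtain H f where h: "embedding H G f" "snd f ` verts H = S" "fst f ` bdry H = B" by blast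
  then have "emb_class H f \<in> Emb G" unfolding Emb_def by blast
  then show ?thesis using that embedding_images[OF h(1)] h by simp
qed

lemma Emb_emb_ok: "e \<in> Emb G \<Longrightarrow> emb_ok G (emb_verts e) (emb_bdry e)"
  by (elim EmbE) (simp add: embedding_emb_ok)

lemma iota_class:
  assumes c: "connected_graph G" and v: "v \<in> verts G"
  shows "iota_class G v \<in> Emb G" "emb_verts (iota_class G v) = {v}"
    "emb_bdry (iota_class G v) = opp G ` nb G v"
proof -
  note e = cut_embedding[OF c full_star[OF connected_is_graph[OF c] v]]
  show "iota_class G v \<in> Emb G"
    unfolding iota_class_def star_on_eq_cut iota_eq_cut Emb_def using e(1) by blast
  show "emb_verts (iota_class G v) = {v}" "emb_bdry (iota_class G v) = opp G ` nb G v"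
    unfolding iota_class_def star_on_eq_cut iota_eq_cut embedding_images(2,3)[OF e(1)] e(2,3)
    by simp_all
qed

text \<open>A connected graph without vertices is an edge or a nodeless loop, and the boundary tells
  them apart.\<close>

lemma is_edge_iff:
  assumes "e \<in> Emb G"
  shows "is_edge e \<longleftrightarrow> emb_verts e = {} \<and> emb_bdry e \<noteq> {}"
proof -
  obtain H f where h: "embedding H G f" "e = emb_class H f"
    "emb_verts e = snd f ` verts H" "emb_bdry e = fst f ` bdry H"
    using assms by (rule EmbE)
  have c: "connected_graph H" using h(1) by (rule embeddingD)
  show ?thesis
  proof
    assume "is_edge e"
    then obtain K g z y where k: "graph_iso K H z" "graph_iso K edge_graph y"
      unfolding is_edge_def h(2) emb_class_def isomorphic_def by auto
    then have "verts K = {}" "darts K = {}" "arcs K \<noteq> {}" "\<not> nodeless K"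
      by (auto simp: graph_iso_def edge_graph_simps bij_betw_def)
    with k(1) have "verts H = {}" "darts H = {}" "arcs H \<noteq> {}" "\<not> nodeless H"
      by (auto simp: graph_iso_def bij_betw_def)
    then show "emb_verts e = {} \<and> emb_bdry e \<noteq> {}" using h by (simp add: bdry_def)
  next
    assume e: "emb_verts e = {} \<and> emb_bdry e \<noteq> {}"
    then have H: "verts H = {}" "\<not> nodeless H" using h by (auto simp: bdry_def)
    then obtain a where a: "a \<in> arcs H" "arcs H = {a, opp H a}" "darts H = {}"
      using connected_no_verts[OF c] by blast
    have g: "is_graph H" using c by (rule connected_is_graph)
    let ?z = "(\<lambda>b\<in>arcs H. if b = a then 0 else 1, \<lambda>v\<in>verts H. v)"
    have "bij_betw (\<lambda>b\<in>{a, opp H a}. if b = a then 0 else 1) {a, opp H a} {0, 1::nat}"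
      using graph_opp[OF g a(1)] by (auto simp: bij_betw_def inj_on_def)
    then have "graph_iso H edge_graph ?z"
      using graph_opp[OF g a(1)] a H g connected_is_graph[OF edge_graph_connected]
      by (intro graph_isoI) (auto simp: edge_graph_simps bij_betw_def)
    then show "is_edge e"
      unfolding is_edge_def isomorphic_def using embedding_images(1)[OF h(1)] h(2) by blast
  qed
qed

section \<open>Graphical maps\<close>

lemma U_hom_eq_Utilde_hom: "\<not> nodeless G' \<Longrightarrow> U_hom G G' = Utilde_hom G G'"
  by (auto simp: U_hom_def Utilde_hom_def)

lemma Utilde_homD:
  assumes "\<phi> \<in> Utilde_hom G G'"
  shows "a \<in> arcs G \<Longrightarrow> fst \<phi> a \<in> arcs G'" "v \<in> verts G \<Longrightarrow> snd \<phi> v \<in> Emb G'"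
    "a \<in> arcs G \<Longrightarrow> fst \<phi> (opp G a) = opp G' (fst \<phi> a)"
    "v \<in> verts G \<Longrightarrow> w \<in> verts G \<Longrightarrow> v \<noteq> w \<Longrightarrow> emb_verts (snd \<phi> v) \<inter> emb_verts (snd \<phi> w) = {}"
    "v \<in> verts G \<Longrightarrow> bij_betw (\<lambda>a. fst \<phi> (opp G a)) (nb G v) (emb_bdry (snd \<phi> v))"
    "bdry G = {} \<Longrightarrow> (\<And>v. v \<in> verts G \<Longrightarrow> is_edge (snd \<phi> v)) \<Longrightarrow> nodeless G'"
    "fst \<phi> \<in> extensional (arcs G)" "snd \<phi> \<in> extensional (verts G)"
  using assms by (auto simp: Utilde_hom_def pre_gmap_def PiE_def Pi_def)

text \<open>In an ordinary graph a class without vertices has a non-empty boundary and is thus an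
  edge. This restates the clause on closed graphs through vertex sets, the form in which it applies
  to pairs.\<close>

lemma no_verts_nodeless:
  assumes h: "\<phi> \<in> Utilde_hom G G'" and b: "bdry G = {}"
    and v: "\<And>v. v \<in> verts G \<Longrightarrow> emb_verts (snd \<phi> v) = {}"
  shows "nodeless G'"
proof (rule ccontr)
  assume n: "\<not> nodeless G'"
  have "is_edge (snd \<phi> v)" if vG: "v \<in> verts G" for v
  proof -
    have "emb_ok G' {} (emb_bdry (snd \<phi> v))"
      using Emb_emb_ok[OF Utilde_homD(2)[OF h vG]] v[OF vG] by simp
    then have "emb_bdry (snd \<phi> v) \<noteq> {}" using n by (auto simp: emb_ok_def full_def)
    then show ?thesis using is_edge_iff[OF Utilde_homD(2)[OF h vG]] v[OF vG] by simp
  qed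
  then show False using Utilde_homD(6)[OF h b] n by blast
qed

text \<open>
  By \<open>full_induct\<close> a connected piece of \<open>G\<close> is assembled from stars by joining pieces and by
  gluing two ends of a piece, and classes of embeddings into \<open>G'\<close> are closed under these two
  operations. The exception is gluing the ends of an edge, where a nodeless loop arises.
\<close>

lemma subst_full:
  assumes h: "\<phi> \<in> Utilde_hom G G'" and c: "connected_graph G" "connected_graph G'" and f: "full G S B"
  shows "emb_ok G' (\<Union>w\<in>S. emb_verts (snd \<phi> w)) (fst \<phi> ` B) \<and> inj_on (fst \<phi>) B"
proof -
  have g: "is_graph G" "is_graph G'" using c by (auto intro: connected_is_graph)
  note H = Utilde_homD[OF h]
  \<comment> \<open>Injectivity is carried through the induction so that removing an arc from
    \<open>B\<close> and taking the image commute; otherwise a join or glue in \<open>G\<close>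
    would not become one in \<open>G'\<close>.\<close>
  let ?Q = "\<lambda>S B. emb_ok G' (\<Union>w\<in>S. emb_verts (snd \<phi> w)) (fst \<phi> ` B) \<and> inj_on (fst \<phi>) B"
  have star: "fst \<phi> ` opp G ` nb G v = emb_bdry (snd \<phi> v)" "inj_on (fst \<phi>) (opp G ` nb G v)"
    if "v \<in> verts G" for v
    using H(5)[OF that] by (auto simp: bij_betw_def image_image inj_on_def)
  have "?Q S B"
  proof (rule full_induct[OF g(1) f, of ?Q])
    fix v assume v: "v \<in> verts G"
    then show "?Q {v} (opp G ` nb G v)"
      using Emb_emb_ok[OF H(2)[OF v]] star[OF v] by simp
  next
    fix T C v x
    assume T: "full G T C" "?Q T C" and v: "v \<in> verts G" "v \<notin> T" and x: "x \<in> C" "x \<in> nb G v"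
    let ?N = "opp G ` nb G v" and ?y = "fst \<phi> x" and ?S = "\<Union>w\<in>T. emb_verts (snd \<phi> w)"
    have xa: "x \<in> arcs G" using fullD(3)[OF T(1)] x(1) by auto
    have yo: "fst \<phi> (opp G x) = opp G' ?y" using H(3)[OF xa] .
    have sub: "C \<subseteq> arcs G" "?N \<subseteq> arcs G"
      using fullD(3)[OF T(1)] graph_opp(1)[OF g(1)] graph_dart(1)[OF g(1)] by (auto simp: nb_def)
    have "emb_verts (snd \<phi> w) \<inter> emb_verts (snd \<phi> v) = {}" if "w \<in> T" for w
      using that fullD(2)[OF T(1)] v by (intro H(4)) auto
    then have dis: "?S \<inter> emb_verts (snd \<phi> v) = {}" by blast
    have ok: "emb_ok G' ?S (fst \<phi> ` C)" "emb_ok G' (emb_verts (snd \<phi> v)) (fst \<phi> ` ?N)"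
      using T(2) star[OF v(1)] Emb_emb_ok[OF H(2)[OF v(1)]] by auto
    have oN: "opp G x \<in> ?N" using x(2) by blast
    then have y: "?y \<in> fst \<phi> ` C" "opp G' ?y \<in> fst \<phi> ` ?N" using x(1) yo[symmetric] by auto
    have i: "inj_on (fst \<phi>) C" "inj_on (fst \<phi>) ?N" using T(2) star[OF v(1)] by auto
    have im: "fst \<phi> ` (C - {x}) = fst \<phi> ` C - {?y}"
      "fst \<phi> ` (?N - {opp G x}) = fst \<phi> ` ?N - {opp G' ?y}"
      using inj_on_image_set_diff[OF i(1), of C "{x}"] inj_on_image_set_diff[OF i(2), of ?N "{opp G x}"]
        x(1) oN yo by auto
    note J = emb_ok_join[OF g(2) ok dis y]
    have "inj_on (fst \<phi>) ((C - {x}) \<union> (?N - {opp G x}))"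
      unfolding inj_on_Un
    proof (intro conjI)
      show "inj_on (fst \<phi>) (C - {x})" "inj_on (fst \<phi>) (?N - {opp G x})"
        using i by (auto intro: inj_on_subset)
      show "fst \<phi> ` (C - {x} - (?N - {opp G x})) \<inter> fst \<phi> ` (?N - {opp G x} - (C - {x})) = {}"
        using J(2) unfolding im[symmetric] by blast
    qed
    moreover have "(\<Union>w\<in>T \<union> {v}. emb_verts (snd \<phi> w)) = ?S \<union> emb_verts (snd \<phi> v)" by auto
    ultimately show "?Q (T \<union> {v}) ((C - {x}) \<union> (?N - {opp G x}))"
      using J(1) unfolding im[symmetric] image_Un[symmetric] by simp
  next
    fix T C x
    assume T: "full G T C" "?Q T C" and x: "x \<in> C" "opp G x \<in> C"
      and F: "full G T (C - {x, opp G x})"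
    let ?S = "\<Union>w\<in>T. emb_verts (snd \<phi> w)" and ?y = "fst \<phi> x"
    have xa: "x \<in> arcs G" using fullD(3)[OF T(1)] x(1) by auto
    have yo: "fst \<phi> (opp G x) = opp G' ?y" using H(3)[OF xa] .
    have i: "inj_on (fst \<phi>) C" using T(2) by simp
    have im: "fst \<phi> ` (C - {x, opp G x}) = fst \<phi> ` C - {?y, opp G' ?y}"
      using inj_on_image_set_diff[OF i, of C "{x, opp G x}"] x yo by auto
    have y: "?y \<in> fst \<phi> ` C" "opp G' ?y \<in> fst \<phi> ` C" using x yo[symmetric] by auto
    have "emb_ok G' ?S (fst \<phi> ` (C - {x, opp G x}))"
    proof (cases "full G' ?S (fst \<phi> ` C)")
      case True
      then show ?thesis using full_glue[OF g(2) True y] unfolding im by (simp add: emb_ok_def)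
    next
      \<comment> \<open>Here the piece has collapsed to an edge of \<open>G'\<close>. Gluing its
        ends empties the boundary, so the piece is all of \<open>G\<close>, which is then closed
        with only vertexless classes as values.\<close>
      case False
      then obtain b where b: "?S = {}" "b \<in> arcs G'" "fst \<phi> ` C = {b, opp G' b}"
        using T(2) x(1) unfolding emb_ok_def by blast
      have "fst \<phi> ` C \<subseteq> {?y, opp G' ?y}"
        using b(3) y(1) graph_opp(2)[OF g(2) b(2)] by auto
      then have e: "fst \<phi> ` (C - {x, opp G x}) = {}" unfolding im by blast
      then have "C - {x, opp G x} = {}" by (simp only: image_is_empty)
      then have "full G T {}" using F by (simp only:)
      then have "T = verts G" "bdry G = {}" using full_no_bdry[OF c(1)] by auto
      then have "nodeless G'" using b(1) by (intro no_verts_nodeless[OF h]) auto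
      then show ?thesis using b(1) e by (simp add: emb_ok_def)
    qed
    then show "?Q T (C - {x, opp G x})" using i by (auto intro: inj_on_subset)
  qed
  then show ?thesis .
qed

text \<open>The pairs not covered by \<open>subst_full\<close> have no vertex to substitute. An edge
  goes to an edge, injectively since \<open>opp G'\<close> has no fixpoint; for a nodeless loop the
  premises of the clause on closed graphs hold vacuously.\<close>

lemma subst_emb_ok:
  assumes h: "\<phi> \<in> Utilde_hom G G'" and c: "connected_graph G" "connected_graph G'" and s: "emb_ok G S B"
  shows "emb_ok G' (\<Union>w\<in>S. emb_verts (snd \<phi> w)) (fst \<phi> ` B)" "inj_on (fst \<phi>) B"
proof -
  have g: "is_graph G" "is_graph G'" using c by (auto intro: connected_is_graph)
  note H = Utilde_homD[OF h]
  from s have "emb_ok G' (\<Union>w\<in>S. emb_verts (snd \<phi> w)) (fst \<phi> ` B) \<and> inj_on (fst \<phi>) B"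
    unfolding emb_ok_def[of G]
  proof (elim disjE conjE bexE)
    fix a assume a: "S = {}" "a \<in> arcs G" "B = {a, opp G a}"
    then have "fst \<phi> ` B = {fst \<phi> a, opp G' (fst \<phi> a)}" using H(3)[OF a(2)] by simp
    moreover have "opp G' (fst \<phi> a) \<noteq> fst \<phi> a" using graph_opp(3)[OF g(2) H(1)[OF a(2)]] .
    ultimately show ?thesis using a H(1)[OF a(2)] H(3)[OF a(2)] by (auto simp: emb_ok_def)
  next
    assume n: "nodeless G" "S = {}" "B = {}"
    then have "bdry G = {}" "verts G = {}" using g by (auto simp: bdry_def is_graph_def)
    then have "nodeless G'" using H(6) by auto
    then show ?thesis using n by (simp add: emb_ok_def)
  qed (rule subst_full[OF h c])
  then show "emb_ok G' (\<Union>w\<in>S. emb_verts (snd \<phi> w)) (fst \<phi> ` B)" "inj_on (fst \<phi>) B" by auto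
qed

text \<open>The definite description in \<open>gmap_comp\<close> is justified here:
  \<open>subst_emb_ok\<close> and \<open>Emb_exists\<close> give a class, and
  \<open>Emb_unique\<close> gives uniqueness.\<close>

lemma gmap_comp_class:
  assumes h: "\<phi> \<in> Utilde_hom G G'" "\<psi> \<in> Utilde_hom G' G''"
    and c: "connected_graph G'" "connected_graph G''" and v: "v \<in> verts G"
  shows "snd (gmap_comp G G' G'' \<psi> \<phi>) v \<in> Emb G''"
    "emb_bdry (snd (gmap_comp G G' G'' \<psi> \<phi>) v) = fst \<psi> ` emb_bdry (snd \<phi> v)"
    "emb_verts (snd (gmap_comp G G' G'' \<psi> \<phi>) v) = (\<Union>w\<in>emb_verts (snd \<phi> v). emb_verts (snd \<psi> w))"
proof -
  let ?P = "\<lambda>e. e \<in> Emb G'' \<and> emb_bdry e = fst \<psi> ` emb_bdry (snd \<phi> v) \<and>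
    emb_verts e = (\<Union>w\<in>emb_verts (snd \<phi> v). emb_verts (snd \<psi> w))"
  have "emb_ok G' (emb_verts (snd \<phi> v)) (emb_bdry (snd \<phi> v))"
    using Emb_emb_ok Utilde_homD(2)[OF h(1) v] .
  then obtain e where "?P e"
    by (elim Emb_exists[OF c(2) subst_emb_ok(1)[OF h(2) c]]) blast
  moreover have "e' = e" if "?P e'" for e'
    using that calculation by (intro Emb_unique[of e' G'' e]) simp_all
  ultimately have "?P (THE e. ?P e)" by (rule theI)
  then show "snd (gmap_comp G G' G'' \<psi> \<phi>) v \<in> Emb G''"
    "emb_bdry (snd (gmap_comp G G' G'' \<psi> \<phi>) v) = fst \<psi> ` emb_bdry (snd \<phi> v)"
    "emb_verts (snd (gmap_comp G G' G'' \<psi> \<phi>) v) = (\<Union>w\<in>emb_verts (snd \<phi> v). emb_verts (snd \<psi> w))"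
    using v by (simp_all add: gmap_comp_def)
qed

lemma emb_verts_subset: "e \<in> Emb G \<Longrightarrow> emb_verts e \<subseteq> verts G"
  using Emb_emb_ok[of e G] by (auto simp: emb_ok_def full_def)

lemma gmap_comp_in_Utilde_hom:
  assumes h: "\<phi> \<in> Utilde_hom G G'" "\<psi> \<in> Utilde_hom G' G''"
    and c: "connected_graph G" "connected_graph G'" "connected_graph G''"
  shows "gmap_comp G G' G'' \<psi> \<phi> \<in> Utilde_hom G G''" (is "?\<chi> \<in> _")
proof -
  note H = Utilde_homD[OF h(1)] and K = Utilde_homD[OF h(2)] and C = gmap_comp_class[OF h c(2,3)]
  have g: "is_graph G" using c(1) by (rule connected_is_graph)
  have 0: "fst ?\<chi> a = fst \<psi> (fst \<phi> a)" if "a \<in> arcs G" for a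
    using that by (simp add: gmap_comp_def)
  have 1: "fst ?\<chi> \<in> arcs G \<rightarrow>\<^sub>E arcs G''" "snd ?\<chi> \<in> verts G \<rightarrow>\<^sub>E Emb G''"
    using 0 H(1) K(1) C(1) by (auto simp: PiE_def) (auto simp: gmap_comp_def)
  have 2: "fst ?\<chi> (opp G a) = opp G'' (fst ?\<chi> a)" if "a \<in> arcs G" for a
    using that 0 graph_opp(1)[OF g that] H(1,3) K(3) by simp
  have 3: "emb_verts (snd ?\<chi> v) \<inter> emb_verts (snd ?\<chi> w) = {}"
    if "v \<in> verts G" "w \<in> verts G" "v \<noteq> w" for v w
  proof -
    have "emb_verts (snd \<psi> x) \<inter> emb_verts (snd \<psi> y) = {}"
      if "x \<in> emb_verts (snd \<phi> v)" "y \<in> emb_verts (snd \<phi> w)" for x y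
      using that \<open>v \<in> verts G\<close> \<open>w \<in> verts G\<close> \<open>v \<noteq> w\<close> H(2,4) emb_verts_subset
      by (intro K(4)) blast+
    then show ?thesis unfolding C(3)[OF that(1)] C(3)[OF that(2)] by blast
  qed
  have 4: "bij_betw (\<lambda>a. fst ?\<chi> (opp G a)) (nb G v) (emb_bdry (snd ?\<chi> v))" if v: "v \<in> verts G" for v
  proof -
    have "inj_on (fst \<psi>) (emb_bdry (snd \<phi> v))"
      using subst_emb_ok(2)[OF h(2) c(2,3) Emb_emb_ok[OF H(2)[OF v]]] .
    then have "bij_betw (fst \<psi> \<circ> (\<lambda>a. fst \<phi> (opp G a))) (nb G v) (emb_bdry (snd ?\<chi> v))"
      unfolding C(2)[OF v] using H(5)[OF v] by (intro bij_betw_trans) (auto simp: bij_betw_def)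
    then show ?thesis
      using 0 graph_opp(1)[OF g] graph_dart(1)[OF g]
      by (subst bij_betw_cong[of _ _ "fst \<psi> \<circ> (\<lambda>a. fst \<phi> (opp G a))"]) (auto simp: nb_def)
  qed
  \<comment> \<open>Substitute all of \<open>G\<close> into \<open>G'\<close>: the resulting pair
    has empty boundary. If \<open>G'\<close> is ordinary, this pair is all of \<open>G'\<close>,
    which is then closed; every vertex of \<open>G'\<close> lies in some
    \<open>snd \<phi> v\<close>, so its value under \<psi> is vertexless and the clause for \<psi>
    applies.\<close>
  have 5: "nodeless G''" if b: "bdry G = {}" and e: "\<forall>v\<in>verts G. is_edge (snd ?\<chi> v)"
  proof -
    have "emb_ok G (verts G) (bdry G)"
      using full_verts[OF c(1)] b no_verts_no_bdry[OF c(1)]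
      by (cases "verts G = {}") (simp_all add: emb_ok_def)
    from subst_emb_ok(1)[OF h(1) c(1,2) this]
    have ok: "emb_ok G' (\<Union>v\<in>verts G. emb_verts (snd \<phi> v)) {}" using b by simp
    show ?thesis
    proof (cases "nodeless G'")
      case True
      then have "bdry G' = {}" "verts G' = {}"
        using connected_is_graph[OF c(2)] by (auto simp: bdry_def is_graph_def)
      then show ?thesis using K(6) by auto
    next
      case False
      then have "full G' (\<Union>v\<in>verts G. emb_verts (snd \<phi> v)) {}" using ok by (auto simp: emb_ok_def)
      note f = full_no_bdry[OF c(2) this]
      have "emb_verts (snd \<psi> w) = {}" if w: "w \<in> verts G'" for w
      proof -
        obtain v where v: "v \<in> verts G" "w \<in> emb_verts (snd \<phi> v)" using w f(1) by auto
        have "emb_verts (snd ?\<chi> v) = {}" using e v(1) is_edge_iff[OF C(1)[OF v(1)]] by simp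
        then show ?thesis using C(3)[OF v(1)] v(2) by auto
      qed
      then show ?thesis by (intro no_verts_nodeless[OF h(2) f(2)])
    qed
  qed
  show ?thesis unfolding Utilde_hom_def pre_gmap_def using 1 2 3 4 5 by blast
qed

section \<open>Inert maps and identities\<close>

lemma gmap_of_emb_in_Utilde_hom:
  assumes f: "embedding H G f"
  shows "gmap_of_emb H G f \<in> Utilde_hom H G"
proof -
  note e = embeddingD[OF f] and e' = etaleD[OF embeddingD(1)[OF f]]
  let ?\<phi> = "gmap_of_emb H G f"
  have F: "fst ?\<phi> = fst f" "\<And>v. v \<in> verts H \<Longrightarrow> snd ?\<phi> v = iota_class G (snd f v)"
    by (auto simp: gmap_of_emb_def)
  note I = iota_class[OF e(3) e'(5)]
  have 1: "fst ?\<phi> \<in> arcs H \<rightarrow>\<^sub>E arcs G" "snd ?\<phi> \<in> verts H \<rightarrow>\<^sub>E Emb G"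
    using e'(3,9) F I(1) by (auto simp: PiE_def) (auto simp: gmap_of_emb_def)
  have 2: "bij_betw (\<lambda>a. fst ?\<phi> (opp H a)) (nb H v) (emb_bdry (snd ?\<phi> v))" if v: "v \<in> verts H" for v
  proof -
    have "inj_on (opp G) (nb G (snd f v))"
      by (rule inj_on_inverseI[of _ "opp G"])
        (use graph_opp(2)[OF e(7)] graph_dart(1)[OF e(7)] in \<open>auto simp: nb_def\<close>)
    then have "bij_betw (opp G \<circ> fst f) (nb H v) (opp G ` nb G (snd f v))"
      using e'(8)[OF v] by (intro bij_betw_trans) (auto simp: bij_betw_def)
    then show ?thesis unfolding F(1) F(2)[OF v] I(3)[OF v]
      using e'(4) graph_dart(1)[OF e(6)]
      by (subst bij_betw_cong[of _ _ "opp G \<circ> fst f"]) (auto simp: nb_def)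
  qed
  have 3: "emb_verts (snd ?\<phi> v) \<inter> emb_verts (snd ?\<phi> w) = {}"
    if "v \<in> verts H" "w \<in> verts H" "v \<noteq> w" for v w
    using that e(4) by (auto simp: F(2) I(2) dest: inj_onD)
  \<comment> \<open>The class of a star has a vertex and is never an edge, so here \<open>H\<close>
    is vertexless and closed, that is, a nodeless loop.\<close>
  have 4: "nodeless G" if b: "bdry H = {}" and ed: "\<forall>v\<in>verts H. is_edge (snd ?\<phi> v)"
  proof -
    have "\<not> is_edge (snd ?\<phi> v)" if "v \<in> verts H" for v
      using is_edge_iff[OF I(1)[OF that]] I(2)[OF that] F(2)[OF that] by simp
    then have "verts H = {}" using ed by blast
    then show ?thesis using no_verts_no_bdry[OF e(2)] b e(5) by blast
  qed
  show ?thesis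
    unfolding Utilde_hom_def pre_gmap_def using 1 2 3 4 F(1) e'(4) by simp
qed

lemma inert_in_Utilde_hom: "\<phi> \<in> inert_maps H G \<Longrightarrow> \<phi> \<in> Utilde_hom H G"
  by (auto simp: inert_maps_def gmap_of_emb_in_Utilde_hom)

lemma gmap_id_in_Utilde_hom: "connected_graph G \<Longrightarrow> gmap_id G \<in> Utilde_hom G G"
  unfolding gmap_id_def by (intro gmap_of_emb_in_Utilde_hom id_embedding)

lemma fst_gmap_id: "fst (gmap_id G) = (\<lambda>a\<in>arcs G. a)"
  by (simp add: gmap_id_def gmap_of_emb_def)

text \<open>Condition (b) on \<phi> says precisely that the star at \<open>v\<close> is carried to
  the boundary of \<open>snd \<phi> v\<close>; \<open>Emb_unique\<close> turns this into equality of
  classes.\<close>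

lemma gmap_comp_id:
  assumes h: "\<phi> \<in> Utilde_hom G G'" and c: "connected_graph G" "connected_graph G'"
  shows "gmap_comp G G G' \<phi> (gmap_id G) = \<phi>" (is "?\<chi> = _")
proof (rule prod_eqI)
  note H = Utilde_homD[OF h] and C = gmap_comp_class[OF gmap_id_in_Utilde_hom[OF c(1)] h c]
  show "fst ?\<chi> = fst \<phi>"
    using H(7) by (auto simp: gmap_comp_def fst_gmap_id fun_eq_iff extensional_def)
  show "snd ?\<chi> = snd \<phi>"
  proof
    fix v
    show "snd ?\<chi> v = snd \<phi> v"
    proof (cases "v \<in> verts G")
      case True
      have i: "snd (gmap_id G) v = iota_class G v" using True by (simp add: gmap_id_def gmap_of_emb_def)
      have "emb_bdry (snd ?\<chi> v) = emb_bdry (snd \<phi> v)"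
        using C(2)[OF True] H(5)[OF True] unfolding i iota_class(3)[OF c(1) True]
        by (simp add: image_image bij_betw_def)
      then show ?thesis
        using C(1,3)[OF True] H(2)[OF True] unfolding i iota_class(2)[OF c(1) True]
        by (intro Emb_unique[of _ G']) auto
    next
      case False
      then show ?thesis using H(8) by (simp add: gmap_comp_def extensional_def)
    qed
  qed
qed

section \<open>Left Kan extension along the forgetful functor\<close>

text \<open>\<open>X\<close> enters as raw data, and even its presheaf laws are transported from
  \<open>L\<close>. The two value types differ, since a coend consists of sets of triples while the
  fibrewise sum consists of pairs.\<close>

lemma segal_transfer:
  assumes idH: "\<And>a. a \<in> Ob D \<Longrightarrow> Id D a \<in> Hom D a a"
    and compH: "\<And>a b c f g. a \<in> Ob D \<Longrightarrow> b \<in> Ob D \<Longrightarrow> c \<in> Ob D \<Longrightarrow> f \<in> Hom D a b \<Longrightarrow>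
      g \<in> Hom D b c \<Longrightarrow> Comp D a b c g f \<in> Hom D a c"
    and el: "Elem D \<subseteq> Ob D"
    and inert: "\<And>a b. a \<in> Ob D \<Longrightarrow> b \<in> Ob D \<Longrightarrow> Inert D a b \<subseteq> Hom D a b"
    and F: "\<And>a. a \<in> Ob D \<Longrightarrow> bij_betw (F a) (PSet L a) (PSet X a)"
    and nat: "\<And>a b f l. a \<in> Ob D \<Longrightarrow> b \<in> Ob D \<Longrightarrow> f \<in> Hom D a b \<Longrightarrow> l \<in> PSet L b \<Longrightarrow>
      PMap X a b f (F b l) = F a (PMap L a b f l)"
    and L: "segal D L"
  shows "segal D X"
proof -
  have P: "presheaf D L" using L by (simp add: segal_def)
  have Pm: "PMap L a b f l \<in> PSet L a"
    if "a \<in> Ob D" "b \<in> Ob D" "f \<in> Hom D a b" "l \<in> PSet L b" for a b f l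
    using P that unfolding presheaf_def by blast
  have Pi: "PMap L a a (Id D a) l = l" if "a \<in> Ob D" "l \<in> PSet L a" for a l
    using P that unfolding presheaf_def by blast
  have Pc: "PMap L a c (Comp D a b c g f) l = PMap L a b f (PMap L b c g l)"
    if "a \<in> Ob D" "b \<in> Ob D" "c \<in> Ob D" "f \<in> Hom D a b" "g \<in> Hom D b c" "l \<in> PSet L c" for a b c f g l
    using P that unfolding presheaf_def by blast
  have Fin: "F a l \<in> PSet X a" if "a \<in> Ob D" "l \<in> PSet L a" for a l
    using F that by (auto dest: bij_betwE)
  have Fsur: "\<exists>l\<in>PSet L a. x = F a l" if "a \<in> Ob D" "x \<in> PSet X a" for a x
    using F that by (auto simp: bij_betw_def)
  have Finj: "l = l'" if "a \<in> Ob D" "l \<in> PSet L a" "l' \<in> PSet L a" "F a l = F a l'" for a l l'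
    using F[OF that(1)] that by (auto simp: bij_betw_def dest: inj_onD)
  have "presheaf D X"
    unfolding presheaf_def
  proof (intro conjI ballI)
    fix a b f x assume *: "a \<in> Ob D" "b \<in> Ob D" "f \<in> Hom D a b" "x \<in> PSet X b"
    then obtain l where "l \<in> PSet L b" "x = F b l" using Fsur by blast
    then show "PMap X a b f x \<in> PSet X a" using * nat Fin Pm by simp
  next
    fix a x assume *: "a \<in> Ob D" "x \<in> PSet X a"
    then obtain l where "l \<in> PSet L a" "x = F a l" using Fsur by blast
    then show "PMap X a a (Id D a) x = x" using * nat idH Pi by simp
  next
    fix a b c f g x
    assume *: "a \<in> Ob D" "b \<in> Ob D" "c \<in> Ob D" "f \<in> Hom D a b" "g \<in> Hom D b c" "x \<in> PSet X c"
    then obtain l where "l \<in> PSet L c" "x = F c l" using Fsur by blast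
    then show "PMap X a c (Comp D a b c g f) x = PMap X a b f (PMap X b c g x)"
      using * nat compH Pm Pc by simp
  qed
  moreover have "bij_betw (\<lambda>z. \<lambda>p\<in>el_over D c. PMap X (fst p) c (snd p) z) (PSet X c) (el_lim D X c)"
    (is "bij_betw ?X _ _") if c: "c \<in> Ob D" for c
  proof -
    let ?L = "\<lambda>z. \<lambda>p\<in>el_over D c. PMap L (fst p) c (snd p) z"
    have bL: "bij_betw ?L (PSet L c) (el_lim D L c)" using L c by (simp add: segal_def)
    have o: "w \<in> Ob D" "i \<in> Hom D w c" if "(w, i) \<in> el_over D c" for w i
      using that el inert[OF _ c] by (auto simp: el_over_def)
    have XF: "?X (F c l) = (\<lambda>p\<in>el_over D c. F (fst p) (?L l p))" if "l \<in> PSet L c" for l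
      using that o nat c by (auto simp: fun_eq_iff)
    have Llim: "?L l \<in> el_lim D L c" if "l \<in> PSet L c" for l
      using bL that by (auto dest: bij_betwE)
    have Lin: "?L l (w, i) \<in> PSet L w" if "l \<in> PSet L c" "(w, i) \<in> el_over D c" for l w i
      using that Pm o[OF that(2)] c by simp
    have into: "(\<lambda>p\<in>el_over D c. F (fst p) (t p)) \<in> el_lim D X c" if t: "t \<in> el_lim D L c" for t
    proof -
      have tin: "t (w, i) \<in> PSet L w" if "(w, i) \<in> el_over D c" for w i
        using t that unfolding el_lim_def by (auto simp: PiE_def Pi_def)
      have tc: "PMap L w w' m (t (w', i')) = t (w, i)"
        if "(w, i) \<in> el_over D c" "(w', i') \<in> el_over D c" "m \<in> Inert D w w'" "Comp D w w' c i' m = i"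
        for w i w' i' m
        using t that unfolding el_lim_def by blast
      have tc': "PMap X w w' m (F w' (t (w', i'))) = F w (t (w, i))"
        if "(w, i) \<in> el_over D c" "(w', i') \<in> el_over D c" "m \<in> Inert D w w'" "Comp D w w' c i' m = i"
        for w i w' i' m
        using tc[OF that] nat[of w w' m "t (w', i')"] tin[OF that(2)] o(1)[OF that(1)] o(1)[OF that(2)]
          inert that(3) by auto
      show ?thesis
        unfolding el_lim_def using tin Fin o(1) tc' by (auto simp: PiE_def)
    qed
    show ?thesis
      unfolding bij_betw_def
    proof
      show "inj_on ?X (PSet X c)"
      proof (rule inj_onI)
        fix x x' assume *: "x \<in> PSet X c" "x' \<in> PSet X c" "?X x = ?X x'"
        then obtain l l' where l: "l \<in> PSet L c" "l' \<in> PSet L c" "x = F c l" "x' = F c l'"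
          using Fsur[OF c] by metis
        have "?L l p = ?L l' p" for p
        proof (cases "p \<in> el_over D c")
          case True
          then obtain w i where p: "p = (w, i)" "(w, i) \<in> el_over D c" by (cases p) auto
          have "?X (F c l) p = ?X (F c l') p" using *(3) unfolding l by (rule fun_cong)
          then have "F w (?L l p) = F w (?L l' p)"
            unfolding XF[OF l(1)] XF[OF l(2)] using p True by simp
          then show ?thesis using Finj[OF o(1)[OF p(2)]] Lin[OF l(1) p(2)] Lin[OF l(2) p(2)] p(1) by blast
        next
          case False
          then show ?thesis by simp
        qed
        then have "?L l = ?L l'" by (rule ext)
        then show "x = x'" using bL l by (auto simp: bij_betw_def dest: inj_onD)
      qed
      show "?X ` PSet X c = el_lim D X c"
      proof
        show "?X ` PSet X c \<subseteq> el_lim D X c"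
          using Fsur[OF c] XF into Llim by fastforce
        show "el_lim D X c \<subseteq> ?X ` PSet X c"
        proof
          fix s assume s: "s \<in> el_lim D X c"
          have sin: "s (w, i) \<in> PSet X w" if "(w, i) \<in> el_over D c" for w i
            using s that unfolding el_lim_def by (auto simp: PiE_def Pi_def)
          have sx: "s \<in> extensional (el_over D c)"
            using s unfolding el_lim_def by (auto simp: PiE_def)
          have sc: "PMap X w w' m (s (w', i')) = s (w, i)"
            if "(w, i) \<in> el_over D c" "(w', i') \<in> el_over D c" "m \<in> Inert D w w'" "Comp D w w' c i' m = i"
            for w i w' i' m
            using s that unfolding el_lim_def by blast
          \<comment> \<open>Pull \<open>s\<close> back through the bijections; injectivity of each
            \<open>F w\<close> returns the compatibility of \<open>s\<close> to
            \<open>t\<close>.\<close>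
          define t where "t = (\<lambda>p\<in>el_over D c. inv_into (PSet L (fst p)) (F (fst p)) (s p))"
          have t: "t (w, i) \<in> PSet L w" "F w (t (w, i)) = s (w, i)" if "(w, i) \<in> el_over D c" for w i
          proof -
            have "s (w, i) \<in> F w ` PSet L w"
              using sin[OF that] F[OF o(1)[OF that]] by (simp add: bij_betw_def)
            then show "t (w, i) \<in> PSet L w" "F w (t (w, i)) = s (w, i)"
              using that by (auto simp: t_def inv_into_into f_inv_into_f)
          qed
          have "PMap L w w' m (t (w', i')) = t (w, i)"
            if p: "(w, i) \<in> el_over D c" "(w', i') \<in> el_over D c" "m \<in> Inert D w w'" "Comp D w w' c i' m = i"
            for w i w' i' m
          proof -
            have ob: "w \<in> Ob D" "w' \<in> Ob D" "m \<in> Hom D w w'"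
              using o(1)[OF p(1)] o(1)[OF p(2)] inert p(3) by auto
            have "F w (PMap L w w' m (t (w', i'))) = F w (t (w, i))"
              using nat[OF ob t(1)[OF p(2)]] sc[OF p] t(2)[OF p(1)] t(2)[OF p(2)] by simp
            then show ?thesis using Finj[OF ob(1) Pm[OF ob t(1)[OF p(2)]] t(1)[OF p(1)]] by blast
          qed
          moreover have "t \<in> (\<Pi>\<^sub>E p\<in>el_over D c. PSet L (fst p))"
            using t(1) by (auto simp: PiE_def) (auto simp: t_def)
          ultimately have "t \<in> el_lim D L c" unfolding el_lim_def by blast
          then have "t \<in> ?L ` PSet L c" unfolding bij_betw_imp_surj_on[OF bL] .
          then obtain l where l': "t = ?L l" and l: "l \<in> PSet L c" by (rule imageE)
          have "?X (F c l) = s"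
            unfolding XF[OF l] l'[symmetric] using t(2) sx by (auto simp: fun_eq_iff extensional_def)
          then show "s \<in> ?X ` PSet X c" using Fin[OF c l] by blast
        qed
      qed
    qed
  qed
  ultimately show ?thesis by (simp add: segal_def)
qed

section \<open>Restriction of orientations and the sum over the fibre\<close>

definition pull :: "graph \<Rightarrow> gmap \<Rightarrow> (nat \<Rightarrow> int) \<Rightarrow> nat \<Rightarrow> int" where
  "pull G \<phi> x = (\<lambda>a\<in>arcs G. x (fst \<phi> a))"

text \<open>
  The functor that forgets orientations is a discrete fibration, so its left Kan extension
  sums over the fibre.
\<close>

definition sum_psh :: "(orgraph, gmap, 'x) psh \<Rightarrow> (graph, gmap, (nat \<Rightarrow> int) \<times> 'x) psh" where
  "sum_psh Z =
     \<lparr>PSet = (\<lambda>G. {(x, z). x \<in> orientations G \<and> z \<in> PSet Z (G, x)}),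
      PMap = (\<lambda>G G' \<phi> (x, z). (pull G \<phi> x, PMap Z (G, pull G \<phi> x) (G', x) \<phi> z))\<rparr>"

lemma sum_psh_simps:
  "(x, z) \<in> PSet (sum_psh Z) G \<longleftrightarrow> x \<in> orientations G \<and> z \<in> PSet Z (G, x)"
  "PMap (sum_psh Z) G G' \<phi> (x, z) = (pull G \<phi> x, PMap Z (G, pull G \<phi> x) (G', x) \<phi> z)"
  by (simp_all add: sum_psh_def)

text \<open>\<open>Hom_eq\<close> speaks of objects only, because \<open>U_hom\<close> and
  \<open>Utilde_hom\<close> can differ when the codomain is a nodeless loop.
  \<open>edge_Elem\<close> supplies the elementary objects on which orientations are tested.\<close>

locale graph_pattern =
  fixes D :: "(graph, gmap) pattern"
  assumes Ob_connected: "G \<in> Ob D \<Longrightarrow> connected_graph G"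
    and Elem_Ob: "Elem D \<subseteq> Ob D"
    and edge_Elem: "edge_graph \<in> Elem D"
    and Hom_eq: "G \<in> Ob D \<Longrightarrow> G' \<in> Ob D \<Longrightarrow> Hom D G G' = Utilde_hom G G'"
    and Id_eq: "Id D = gmap_id"
    and Comp_eq: "Comp D = gmap_comp"
    and Inert_eq: "Inert D = inert_maps"
begin

lemma Id_Hom: "G \<in> Ob D \<Longrightarrow> Id D G \<in> Hom D G G"
  by (simp add: Hom_eq Id_eq gmap_id_in_Utilde_hom Ob_connected)

lemma Comp_Hom:
  "a \<in> Ob D \<Longrightarrow> b \<in> Ob D \<Longrightarrow> c \<in> Ob D \<Longrightarrow> f \<in> Hom D a b \<Longrightarrow> g \<in> Hom D b c \<Longrightarrow>
    Comp D a b c g f \<in> Hom D a c"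
  by (simp add: Hom_eq Comp_eq gmap_comp_in_Utilde_hom Ob_connected)

lemma Inert_Hom: "a \<in> Ob D \<Longrightarrow> b \<in> Ob D \<Longrightarrow> Inert D a b \<subseteq> Hom D a b"
  by (auto simp: Hom_eq Inert_eq inert_in_Utilde_hom)

lemma pull_orientations:
  assumes "a \<in> Ob D" "b \<in> Ob D" "f \<in> Hom D a b" "x \<in> orientations b"
  shows "pull a f x \<in> orientations a"
proof -
  have f: "f \<in> Utilde_hom a b" using assms by (simp add: Hom_eq)
  show ?thesis
    using assms(4) Utilde_homD(1,3)[OF f] graph_opp(1)[OF connected_is_graph[OF Ob_connected[OF assms(1)]]]
    by (auto simp: orientations_def pull_def PiE_def Pi_def)
qed

text \<open>Together with \<open>pull_orientations\<close> this is existence of lifts in the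
  discrete fibration \<open>forget\<close>; \<open>pull_eq\<close> is their uniqueness.\<close>

lemma pull_Hom:
  assumes "a \<in> Ob D" "b \<in> Ob D" "f \<in> Hom D a b" "x \<in> orientations b"
  shows "f \<in> Hom (oriented D) (a, pull a f x) (b, x)"
  using assms by (simp add: oriented_def pull_def)

lemma pull_eq:
  assumes "f \<in> Hom (oriented D) (a, y) (b, x)" "y \<in> orientations a"
  shows "pull a f x = y"
  using assms by (auto simp: oriented_def pull_def orientations_def PiE_def extensional_def fun_eq_iff)

lemma Ob_oriented: "(a, x) \<in> Ob (oriented D) \<longleftrightarrow> a \<in> Ob D \<and> x \<in> orientations a"
  by (simp add: oriented_def)

lemma pull_id: "x \<in> orientations a \<Longrightarrow> pull a (gmap_id a) x = x"
  by (auto simp: pull_def fst_gmap_id orientations_def PiE_def extensional_def fun_eq_iff)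

lemma pull_comp:
  assumes "a \<in> Ob D" "b \<in> Ob D" "f \<in> Hom D a b"
  shows "pull a (gmap_comp a b c g f) x = pull a f (pull b g x)"
proof -
  have f: "f \<in> Utilde_hom a b" using assms by (simp add: Hom_eq)
  show ?thesis using Utilde_homD(1)[OF f] by (auto simp: pull_def gmap_comp_def fun_eq_iff)
qed

lemma presheaf_sum_psh:
  assumes Z: "presheaf (oriented D) Z"
  shows "presheaf D (sum_psh Z)"
  unfolding presheaf_def
proof (intro conjI ballI)
  fix a b f p assume *: "a \<in> Ob D" "b \<in> Ob D" "f \<in> Hom D a b" "p \<in> PSet (sum_psh Z) b"
  obtain x z where p: "p = (x, z)" "x \<in> orientations b" "z \<in> PSet Z (b, x)"
    using *(4) by (cases p) (auto simp: sum_psh_simps)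
  note y = pull_orientations[OF *(1-3) p(2)]
  have "PMap Z (a, pull a f x) (b, x) f z \<in> PSet Z (a, pull a f x)"
    using Z pull_Hom[OF *(1-3) p(2)] * y p unfolding presheaf_def by (simp add: Ob_oriented)
  then show "PMap (sum_psh Z) a b f p \<in> PSet (sum_psh Z) a" using y p by (simp add: sum_psh_simps)
next
  fix a p assume *: "a \<in> Ob D" "p \<in> PSet (sum_psh Z) a"
  obtain x z where p: "p = (x, z)" "x \<in> orientations a" "z \<in> PSet Z (a, x)"
    using *(2) by (cases p) (auto simp: sum_psh_simps)
  have "Id (oriented D) (a, x) = gmap_id a" by (simp add: oriented_def Id_eq)
  moreover have "PMap Z (a, x) (a, x) (Id (oriented D) (a, x)) z = z"
    using Z * p unfolding presheaf_def by (simp add: Ob_oriented)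
  ultimately show "PMap (sum_psh Z) a a (Id D a) p = p"
    using p by (simp add: sum_psh_simps Id_eq pull_id)
next
  fix a b c f g p
  assume *: "a \<in> Ob D" "b \<in> Ob D" "c \<in> Ob D" "f \<in> Hom D a b" "g \<in> Hom D b c" "p \<in> PSet (sum_psh Z) c"
  obtain x z where p: "p = (x, z)" "x \<in> orientations c" "z \<in> PSet Z (c, x)"
    using *(6) by (cases p) (auto simp: sum_psh_simps)
  let ?y = "pull b g x" let ?w = "pull a f ?y"
  note y = pull_orientations[OF *(2,3,5) p(2)] and w = pull_orientations[OF *(1,2,4)]
  have "Comp (oriented D) (a, ?w) (b, ?y) (c, x) g f = gmap_comp a b c g f"
    by (simp add: oriented_def Comp_eq)
  moreover have "PMap Z (a, ?w) (c, x) (Comp (oriented D) (a, ?w) (b, ?y) (c, x) g f) z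
      = PMap Z (a, ?w) (b, ?y) f (PMap Z (b, ?y) (c, x) g z)"
    using Z pull_Hom[OF *(2,3,5) p(2)] pull_Hom[OF *(1,2,4) y] * y w[OF y] p
    unfolding presheaf_def by (simp add: Ob_oriented)
  ultimately show "PMap (sum_psh Z) a c (Comp D a b c g f) p
      = PMap (sum_psh Z) a b f (PMap (sum_psh Z) b c g p)"
    unfolding p(1) by (simp add: sum_psh_simps Comp_eq pull_comp[OF *(1,2,4)])
qed

section \<open>Edges detect orientations\<close>

definition edge_inert :: "graph \<Rightarrow> nat \<Rightarrow> gmap" where
  "edge_inert G a = gmap_of_emb edge_graph G (edge_map G a)"

lemma edge_inert_simps:
  "fst (edge_inert G a) = (\<lambda>i\<in>{0, 1}. if i = 0 then a else opp G a)" "snd (edge_inert G a) = (\<lambda>v\<in>{}. undefined)"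
  by (simp_all add: edge_inert_def gmap_of_emb_def edge_map_def edge_graph_simps restrict_def)

lemma edge_el_over:
  assumes "G \<in> Ob D" "a \<in> arcs G"
  shows "(edge_graph, edge_inert G a) \<in> el_over D G" "edge_inert G a \<in> Inert D edge_graph G"
proof -
  have "edge_inert G a \<in> inert_maps edge_graph G"
    using edge_embedding(1)[OF Ob_connected[OF assms(1)] assms(2)]
    unfolding inert_maps_def edge_inert_def by blast
  then show "(edge_graph, edge_inert G a) \<in> el_over D G" "edge_inert G a \<in> Inert D edge_graph G"
    using edge_Elem by (auto simp: el_over_def Inert_eq)
qed

text \<open>A map out of the edge graph has no vertex component, so only the values at arcs 0 and 1
  are compared.\<close>

lemma edge_inert_comp:
  assumes "i \<in> Utilde_hom w c" "b \<in> arcs w" "w \<in> Ob D"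
  shows "Comp D edge_graph w c i (edge_inert w b) = edge_inert c (fst i b)"
  using Utilde_homD(3)[OF assms(1,2)]
  by (auto simp: Comp_eq gmap_comp_def edge_inert_simps edge_graph_simps prod_eq_iff fun_eq_iff)

lemma pull_edge_inert: "pull edge_graph (edge_inert G a) x 0 = x a"
  by (simp add: pull_def edge_inert_simps edge_graph_simps)

text \<open>Edges determine the orientation component. Once it is fixed, the elementary objects over
  \<open>c\<close> and over \<open>(c, x)\<close> correspond, and the Segal condition on
  \<open>Z\<close> handles the other component.\<close>

lemma segal_sum_psh:
  assumes Z: "segal (oriented D) Z"
  shows "segal D (sum_psh Z)"
proof -
  let ?L = "sum_psh Z"
  have P: "presheaf D ?L" using Z by (intro presheaf_sum_psh) (simp add: segal_def)
  have "bij_betw (\<lambda>z. \<lambda>p\<in>el_over D c. PMap ?L (fst p) c (snd p) z) (PSet ?L c) (el_lim D ?L c)"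
    (is "bij_betw ?R _ _") if c: "c \<in> Ob D" for c
  proof -
    have el: "w \<in> Ob D" "i \<in> Hom D w c" "i \<in> Utilde_hom w c" if "(w, i) \<in> el_over D c" for w i
    proof -
      have w: "w \<in> Ob D" "i \<in> Inert D w c" using that Elem_Ob by (auto simp: el_over_def)
      then show "w \<in> Ob D" "i \<in> Hom D w c" using Inert_Hom[OF _ c] by auto
      then show "i \<in> Utilde_hom w c" using Hom_eq[OF _ c] by simp
    qed
    \<comment> \<open>With \<open>el_orD\<close>: every elementary object over \<open>c\<close>
      carries exactly one orientation that places it over \<open>(c, x)\<close>.\<close>
    have el_or: "((w, pull w i x), i) \<in> el_over (oriented D) (c, x)"
      if "(w, i) \<in> el_over D c" "x \<in> orientations c" for w i x
      using that pull_orientations[OF el(1)[OF that(1)] c el(2)[OF that(1)] that(2)]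
      by (auto simp: el_over_def oriented_def pull_def)
    have el_orD: "(w, i) \<in> el_over D c" "y = pull w i x"
      if "((w, y), i) \<in> el_over (oriented D) (c, x)" for w y i x
      using that
      by (auto simp: el_over_def oriented_def pull_def orientations_def PiE_def extensional_def fun_eq_iff)
    have segZ: "bij_betw (\<lambda>z. \<lambda>p\<in>el_over (oriented D) (c, x). PMap Z (fst p) (c, x) (snd p) z)
        (PSet Z (c, x)) (el_lim (oriented D) Z (c, x))" if "x \<in> orientations c" for x
      using Z that c by (auto simp: segal_def Ob_oriented)
    have R: "?R (x, z) (w, i) = (pull w i x, PMap Z (w, pull w i x) (c, x) i z)"
      if "(w, i) \<in> el_over D c" for x z w i
      using that by (simp add: sum_psh_simps)
    show ?thesis
      unfolding bij_betw_def
    proof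
      show "inj_on ?R (PSet ?L c)"
      proof (rule inj_onI)
        fix p p' assume *: "p \<in> PSet ?L c" "p' \<in> PSet ?L c" "?R p = ?R p'"
        obtain x z where p: "p = (x, z)" "x \<in> orientations c" "z \<in> PSet Z (c, x)"
          using *(1) by (cases p) (auto simp: sum_psh_simps)
        obtain x' z' where p': "p' = (x', z')" "x' \<in> orientations c" "z' \<in> PSet Z (c, x')"
          using *(2) by (cases p') (auto simp: sum_psh_simps)
        have eq: "pull w i x = pull w i x'"
          "PMap Z (w, pull w i x) (c, x) i z = PMap Z (w, pull w i x') (c, x') i z'"
          if "(w, i) \<in> el_over D c" for w i
          using fun_cong[OF *(3), of "(w, i)"] unfolding p(1) p'(1) R[OF that] by auto
        have "x a = x' a" if "a \<in> arcs c" for a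
          using fun_cong[OF eq(1)[OF edge_el_over(1)[OF c that]], of 0] by (simp only: pull_edge_inert)
        then have xx: "x = x'"
          using p(2) p'(2) unfolding orientations_def by (auto intro: PiE_ext)
        have "(\<lambda>p\<in>el_over (oriented D) (c, x). PMap Z (fst p) (c, x) (snd p) z)
            = (\<lambda>p\<in>el_over (oriented D) (c, x). PMap Z (fst p) (c, x) (snd p) z')"
        proof (rule restrict_ext)
          fix q assume q: "q \<in> el_over (oriented D) (c, x)"
          obtain w y i where w: "q = ((w, y), i)" by (metis prod.exhaust)
          then show "PMap Z (fst q) (c, x) (snd q) z = PMap Z (fst q) (c, x) (snd q) z'"
            using eq(2)[of w i] el_orD[of w y i x] q xx by simp
        qed
        then have "z = z'" using segZ[OF p(2)] p(3) p'(3) xx by (auto simp: bij_betw_def dest: inj_onD)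
        then show "p = p'" using p p' xx by simp
      qed
      show "?R ` PSet ?L c = el_lim D ?L c"
      proof
        show "?R ` PSet ?L c \<subseteq> el_lim D ?L c"
        proof
          fix r assume "r \<in> ?R ` PSet ?L c"
          then obtain p where p: "r = ?R p" "p \<in> PSet ?L c" by blast
          have "?R p q \<in> PSet ?L (fst q)" if "q \<in> el_over D c" for q
            using that P el[of "fst q" "snd q"] c p(2) unfolding presheaf_def by auto
          moreover have "PMap ?L w w' m (?R p (w', i')) = ?R p (w, i)"
            if q: "(w, i) \<in> el_over D c" "(w', i') \<in> el_over D c" "m \<in> Inert D w w'"
              "Comp D w w' c i' m = i" for w i w' i' m
          proof -
            have "m \<in> Hom D w w'" using Inert_Hom q(3) el(1)[OF q(1)] el(1)[OF q(2)] by blast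
            then have "PMap ?L w c (Comp D w w' c i' m) p = PMap ?L w w' m (PMap ?L w' c i' p)"
              using P el(1)[OF q(1)] el(1,2)[OF q(2)] c p(2) unfolding presheaf_def by blast
            then show ?thesis using q by simp
          qed
          ultimately show "r \<in> el_lim D ?L c"
            unfolding el_lim_def p(1) by (auto simp: PiE_def simp del: restrict_apply)
        qed
        show "el_lim D ?L c \<subseteq> ?R ` PSet ?L c"
        proof
          fix s assume s: "s \<in> el_lim D ?L c"
          have sin: "s (w, i) \<in> PSet ?L w" if "(w, i) \<in> el_over D c" for w i
          proof -
            have "s \<in> (\<Pi>\<^sub>E p\<in>el_over D c. PSet ?L (fst p))" using s unfolding el_lim_def by blast
            from PiE_mem[OF this that] show ?thesis by simp
          qed
          have sx: "s \<in> extensional (el_over D c)"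
            using s unfolding el_lim_def by (auto simp: PiE_def)
          have sc: "PMap ?L w w' m (s (w', i')) = s (w, i)"
            if "(w, i) \<in> el_over D c" "(w', i') \<in> el_over D c" "m \<in> Inert D w w'" "Comp D w w' c i' m = i"
            for w i w' i' m
            using s that unfolding el_lim_def by blast
          have sor: "fst (s (w, i)) \<in> orientations w" "snd (s (w, i)) \<in> PSet Z (w, fst (s (w, i)))"
            if "(w, i) \<in> el_over D c" for w i
            using sin[OF that] by (cases "s (w, i)"; simp add: sum_psh_simps)+
          have fst_PMap: "fst (PMap ?L w w' m l) = pull w m (fst l)" for w w' m l
            by (cases l) (simp add: sum_psh_simps)
          have snd_PMap: "snd (PMap ?L w w' m l) = PMap Z (w, pull w m (fst l)) (w', fst l) m (snd l)" for w w' m l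
            by (cases l) (simp add: sum_psh_simps)
          \<comment> \<open>Since \<open>edge_inert c a\<close> sends arc 0 to \<open>a\<close>,
            this is the only value at \<open>a\<close> that an orientation inducing \<open>s\<close>
            can have.\<close>
          define x where "x = (\<lambda>a\<in>arcs c. fst (s (edge_graph, edge_inert c a)) 0)"
          \<comment> \<open>Restrict \<open>s (w, i)\<close> to the edge of \<open>w\<close> at
            \<open>b\<close>: followed by \<open>i\<close>, it is the edge of \<open>c\<close> at
            \<open>fst i b\<close>, where \<open>x\<close> is defined.\<close>
          have val: "fst (s (w, i)) b = x (fst i b)" if wi: "(w, i) \<in> el_over D c" and b: "b \<in> arcs w" for w i b
          proof -
            have ib: "fst i b \<in> arcs c" using Utilde_homD(1)[OF el(3)[OF wi] b] .
            note e = edge_el_over[OF el(1)[OF wi] b] and e' = edge_el_over(1)[OF c ib]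
            have "pull edge_graph (edge_inert w b) (fst (s (w, i))) = fst (s (edge_graph, edge_inert c (fst i b)))"
              using fst_PMap[of edge_graph w "edge_inert w b" "s (w, i)"]
              unfolding sc[OF e' wi e(2) edge_inert_comp[OF el(3)[OF wi] b el(1)[OF wi]]] by (rule sym)
            from fun_cong[OF this, of 0] show ?thesis
              unfolding pull_edge_inert by (simp add: x_def ib)
          qed
          have xa: "x a \<in> {1, -1} \<and> x (opp c a) = - x a" if a: "a \<in> arcs c" for a
          proof -
            note e = edge_el_over(1)[OF c a]
            have v: "fst (s (edge_graph, edge_inert c a)) 0 = x a"
              "fst (s (edge_graph, edge_inert c a)) 1 = x (opp c a)"
              using val[OF e, of 0] val[OF e, of 1] by (simp_all add: edge_graph_simps edge_inert_simps)
            define y where "y = fst (s (edge_graph, edge_inert c a))"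
            have y: "y \<in> arcs edge_graph \<rightarrow>\<^sub>E {1, -1}" "\<forall>b\<in>arcs edge_graph. y (opp edge_graph b) = - y b"
              using sor(1)[OF e] by (simp_all add: orientations_def y_def)
            have "0 \<in> arcs edge_graph" by (simp add: edge_graph_simps)
            then have "y 0 \<in> {1, -1}" "y 1 = - y 0"
              using PiE_mem[OF y(1), of 0] bspec[OF y(2), of 0] by (simp_all add: edge_graph_simps)
            then show ?thesis using v unfolding y_def by simp
          qed
          have xor: "x \<in> orientations c"
            unfolding orientations_def using xa by (auto simp: PiE_def) (auto simp: x_def)
          have sp: "fst (s (w, i)) = pull w i x" if wi: "(w, i) \<in> el_over D c" for w i
            using sor(1)[OF wi] val[OF wi] unfolding orientations_def pull_def
            by (auto simp: PiE_def extensional_def fun_eq_iff)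
          \<comment> \<open>The orientation in the index may be dropped, as it is forced to be
            \<open>pull w i x\<close>, the first component of \<open>s (w, i)\<close> by
            \<open>sp\<close>.\<close>
          define t where "t = (\<lambda>p\<in>el_over (oriented D) (c, x). snd (s (fst (fst p), snd p)))"
          have tw: "t ((w, y), i) = snd (s (w, i))" if "((w, y), i) \<in> el_over (oriented D) (c, x)" for w y i
            using that by (simp add: t_def)
          have "t q \<in> PSet Z (fst q)" if q: "q \<in> el_over (oriented D) (c, x)" for q
          proof -
            obtain w y i where w: "q = ((w, y), i)" by (metis prod.exhaust)
            show ?thesis using sor(2)[of w i] sp[of w i] el_orD[of w y i x] tw[of w y i] q unfolding w by simp
          qed
          moreover have "PMap Z w w' m (t (w', i')) = t (w, i)"
            if q: "(w, i) \<in> el_over (oriented D) (c, x)" "(w', i') \<in> el_over (oriented D) (c, x)"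
              "m \<in> Inert (oriented D) w w'" "Comp (oriented D) w w' (c, x) i' m = i" for w i w' i' m
          proof -
            obtain v y v' y' where w: "w = (v, y)" "w' = (v', y')" by (metis prod.exhaust)
            note d = el_orD[OF q(1)[unfolded w]] and d' = el_orD[OF q(2)[unfolded w]]
            have m: "m \<in> Inert D v v'" "Comp D v v' c i' m = i" "\<forall>a\<in>arcs v. y' (fst m a) = y a"
              using q(3,4) unfolding w by (simp_all add: oriented_def)
            have sm: "PMap ?L v v' m (s (v', i')) = s (v, i)" using sc[OF d(1) d'(1) m(1,2)] .
            have y': "fst (s (v', i')) = y'" and y: "fst (s (v, i)) = y" using sp[OF d(1)] sp[OF d'(1)] d d' by auto
            then have "pull v m y' = y" using fst_PMap[of v v' m "s (v', i')"] sm by simp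
            then show ?thesis
              using snd_PMap[of v v' m "s (v', i')"] tw q unfolding w sm y' by simp
          qed
          ultimately have "t \<in> el_lim (oriented D) Z (c, x)"
            unfolding el_lim_def by (auto simp: PiE_def) (auto simp: t_def)
          then have "t \<in> (\<lambda>z. \<lambda>p\<in>el_over (oriented D) (c, x). PMap Z (fst p) (c, x) (snd p) z) ` PSet Z (c, x)"
            unfolding bij_betw_imp_surj_on[OF segZ[OF xor]] .
          then obtain z where z: "t = (\<lambda>p\<in>el_over (oriented D) (c, x). PMap Z (fst p) (c, x) (snd p) z)"
            "z \<in> PSet Z (c, x)" by (rule imageE)
          have "?R (x, z) = s"
          proof
            fix p
            show "?R (x, z) p = s p"
            proof (cases "p \<in> el_over D c")
              case True
              obtain w i where p: "p = (w, i)" by (cases p)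
              note wi = True[unfolded p]
              have "PMap Z (w, pull w i x) (c, x) i z = snd (s (w, i))"
                using fun_cong[OF z(1), of "((w, pull w i x), i)"] el_or[OF wi xor] tw by simp
              then show ?thesis unfolding p R[OF wi] using sp[OF wi] by (simp add: prod_eq_iff)
            next
              case False
              then show ?thesis using extensional_arb[OF sx] by simp
            qed
          qed
          moreover have "(x, z) \<in> PSet ?L c" using xor z(2) by (simp add: sum_psh_simps)
          ultimately show "s \<in> ?R ` PSet ?L c" by blast
        qed
      qed
    qed
  qed
  then show ?thesis using P by (simp add: segal_def)
qed

section \<open>The coend as the sum over the fibre\<close>

definition lan_value ::
  "(orgraph, gmap, 'x) psh \<Rightarrow> graph \<Rightarrow> orgraph \<times> gmap \<times> 'x \<Rightarrow> (nat \<Rightarrow> int) \<times> 'x" where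
  "lan_value Z d u = (case u of (c, \<alpha>, z) \<Rightarrow> PMap (sum_psh Z) d (fst c) \<alpha> (snd c, z))"

lemma lan_elE:
  assumes "u \<in> lan_el (oriented D) D forget Z d"
  obtains G x \<alpha> z where "u = ((G, x), \<alpha>, z)" "G \<in> Ob D" "x \<in> orientations G"
    "\<alpha> \<in> Hom D d G" "z \<in> PSet Z (G, x)" "(x, z) \<in> PSet (sum_psh Z) G"
  using assms by (auto simp: lan_el_def forget_def Ob_oriented sum_psh_simps)

lemma lan_value_sum:
  assumes Z: "presheaf (oriented D) Z" and d: "d \<in> Ob D" and u: "u \<in> lan_el (oriented D) D forget Z d"
  shows "lan_value Z d u \<in> PSet (sum_psh Z) d"
  using u
proof (cases rule: lan_elE)
  case (1 G x \<alpha> z)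
  then show ?thesis
    using presheaf_sum_psh[OF Z] d unfolding presheaf_def lan_value_def by simp
qed

text \<open>The orientation of the source of \<open>m\<close> is forced by \<open>pull_eq\<close>,
  so a generating step becomes functoriality of \<open>sum_psh Z\<close> at \<open>m\<close> after
  \<alpha>.\<close>

lemma lan_value_step:
  assumes Z: "presheaf (oriented D) Z" and d: "d \<in> Ob D"
    and s: "(u, v) \<in> lan_step (oriented D) D forget Z d"
  shows "lan_value Z d u = lan_value Z d v"
proof -
  from s obtain c c' m \<alpha> z where *:
    "u = (c, \<alpha>, PMap Z c c' m z)" "v = (c', Comp D d (fst c) (fst c') m \<alpha>, z)"
    "c \<in> Ob (oriented D)" "c' \<in> Ob (oriented D)" "m \<in> Hom (oriented D) c c'" "\<alpha> \<in> Hom D d (fst c)"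
    "z \<in> PSet Z c'"
    unfolding lan_step_def forget_def by auto
  obtain G x G' x' where c: "c = (G, x)" "c' = (G', x')" by (metis prod.exhaust)
  have G: "G \<in> Ob D" "x \<in> orientations G" "G' \<in> Ob D" "x' \<in> orientations G'"
    using * c by (auto simp: Ob_oriented)
  have m: "m \<in> Hom D G G'" using *(5) c by (simp add: oriented_def)
  have "pull G m x' = x" using pull_eq *(5) c G by blast
  then have "PMap (sum_psh Z) G G' m (x', z) = (x, PMap Z (G, x) (G', x') m z)"
    by (simp add: sum_psh_simps)
  moreover have "(x', z) \<in> PSet (sum_psh Z) G'" "\<alpha> \<in> Hom D d G"
    using G *(6,7) c by (simp_all add: sum_psh_simps)
  then have "PMap (sum_psh Z) d G' (Comp D d G G' m \<alpha>) (x', z)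
      = PMap (sum_psh Z) d G \<alpha> (PMap (sum_psh Z) G G' m (x', z))"
    using presheaf_sum_psh[OF Z] d G(1,3) m unfolding presheaf_def by blast
  ultimately show ?thesis using *(1,2) c by (simp add: lan_value_def)
qed

definition lan_normal :: "graph \<Rightarrow> (nat \<Rightarrow> int) \<times> 'x \<Rightarrow> orgraph \<times> gmap \<times> 'x" where
  "lan_normal d l = ((d, fst l), gmap_id d, snd l)"

lemma lan_normal:
  assumes Z: "presheaf (oriented D) Z" and d: "d \<in> Ob D" and l: "l \<in> PSet (sum_psh Z) d"
  shows "lan_normal d l \<in> lan_el (oriented D) D forget Z d" "lan_value Z d (lan_normal d l) = l"
proof -
  show "lan_normal d l \<in> lan_el (oriented D) D forget Z d"
    using l d Id_Hom[OF d]
    by (cases l) (simp add: lan_normal_def lan_el_def forget_def Ob_oriented sum_psh_simps Id_eq)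
  show "lan_value Z d (lan_normal d l) = l"
    using presheaf_sum_psh[OF Z] d l unfolding presheaf_def lan_value_def lan_normal_def
    by (simp add: Id_eq)
qed

text \<open>The lift of \<alpha> with source \<open>(d, pull d \<alpha> x)\<close> and target
  \<open>(G, x)\<close> gives one generating step out of the normal form; the right unit law turns
  its new middle entry into \<alpha>.\<close>

lemma lan_rel_normal:
  assumes Z: "presheaf (oriented D) Z" and d: "d \<in> Ob D" and u: "u \<in> lan_el (oriented D) D forget Z d"
  shows "(lan_normal d (lan_value Z d u), u) \<in> lan_rel (oriented D) D forget Z d"
  using u
proof (cases rule: lan_elE)
  case (1 G x \<alpha> z)
  have \<alpha>: "\<alpha> \<in> Utilde_hom d G" using 1 d by (simp add: Hom_eq)
  have "gmap_comp d d G \<alpha> (gmap_id d) = \<alpha>"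
    using gmap_comp_id[OF \<alpha> Ob_connected[OF d] Ob_connected[OF 1(2)]] .
  then have "lan_normal d (lan_value Z d u) =
      ((d, pull d \<alpha> x), gmap_id d, PMap Z (d, pull d \<alpha> x) (G, x) \<alpha> z)"
    "u = ((G, x), Comp D d (FOb forget (d, pull d \<alpha> x)) (FOb forget (G, x))
      (FMap forget (d, pull d \<alpha> x) (G, x) \<alpha>) (gmap_id d), z)"
    unfolding lan_normal_def lan_value_def 1(1) by (simp_all add: sum_psh_simps forget_def Comp_eq)
  moreover have "(d, pull d \<alpha> x) \<in> Ob (oriented D)" "(G, x) \<in> Ob (oriented D)"
    "gmap_id d \<in> Hom D d (FOb forget (d, pull d \<alpha> x))"
    using 1 d pull_orientations[OF d 1(2,4,3)] Id_Hom[OF d] by (simp_all add: Ob_oriented forget_def Id_eq)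
  ultimately have "(lan_normal d (lan_value Z d u), u) \<in> lan_step (oriented D) D forget Z d"
    unfolding lan_step_def using pull_Hom[OF d 1(2,4,3)] 1(5) by blast
  then show ?thesis
    unfolding lan_rel_def using u lan_normal(1)[OF Z d lan_value_sum[OF Z d u]] by auto
qed

text \<open>Normal forms depend only on the value, so triples of equal value are linked through a
  common one.\<close>

lemma lan_rel_iff:
  assumes Z: "presheaf (oriented D) Z" and d: "d \<in> Ob D"
  shows "(u, v) \<in> lan_rel (oriented D) D forget Z d \<longleftrightarrow>
    u \<in> lan_el (oriented D) D forget Z d \<and> v \<in> lan_el (oriented D) D forget Z d \<and>
    lan_value Z d u = lan_value Z d v" (is "?l \<longleftrightarrow> ?r")
proof
  assume l: ?l
  have "lan_value Z d u = lan_value Z d v"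
    using l by (rule lan_rel_invariant) (rule lan_value_step[OF Z d])
  then show ?r using l by (simp add: lan_rel_def)
next
  assume r: ?r
  have E: "sym (lan_rel (oriented D) D forget Z d)" "trans (lan_rel (oriented D) D forget Z d)"
    using equiv_lan_rel[of "oriented D" D forget Z d] by (simp_all add: equiv_def)
  have "(lan_normal d (lan_value Z d u), u) \<in> lan_rel (oriented D) D forget Z d"
    "(lan_normal d (lan_value Z d u), v) \<in> lan_rel (oriented D) D forget Z d"
    using lan_rel_normal[OF Z d, of u] lan_rel_normal[OF Z d, of v] r by simp_all
  then show ?l by (blast intro: symD[OF E(1)] transD[OF E(2)])
qed

definition lan_fibre ::
  "(orgraph, gmap, 'x) psh \<Rightarrow> graph \<Rightarrow> (nat \<Rightarrow> int) \<times> 'x \<Rightarrow> (orgraph \<times> gmap \<times> 'x) set" where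
  "lan_fibre Z d l = {u \<in> lan_el (oriented D) D forget Z d. lan_value Z d u = l}"

lemma lan_fibre_bij:
  assumes Z: "presheaf (oriented D) Z" and d: "d \<in> Ob D"
  shows "bij_betw (lan_fibre Z d) (PSet (sum_psh Z) d) (PSet (lan (oriented D) D forget Z) d)"
proof -
  have cl: "lan_rel (oriented D) D forget Z d `` {u} = lan_fibre Z d (lan_value Z d u)"
    if "u \<in> lan_el (oriented D) D forget Z d" for u
    using that lan_rel_iff[OF Z d, of u] by (auto simp: lan_fibre_def)
  have n: "lan_normal d l \<in> lan_fibre Z d l" if "l \<in> PSet (sum_psh Z) d" for l
    using lan_normal[OF Z d that] by (simp add: lan_fibre_def)
  show ?thesis
    unfolding bij_betw_def
  proof
    show "inj_on (lan_fibre Z d) (PSet (sum_psh Z) d)"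
    proof (rule inj_onI)
      fix l l' assume "l \<in> PSet (sum_psh Z) d" "l' \<in> PSet (sum_psh Z) d"
        "lan_fibre Z d l = lan_fibre Z d l'"
      then have "lan_normal d l \<in> lan_fibre Z d l" "lan_normal d l \<in> lan_fibre Z d l'"
        using n[of l] by simp_all
      then show "l = l'" by (simp add: lan_fibre_def)
    qed
    show "lan_fibre Z d ` PSet (sum_psh Z) d = PSet (lan (oriented D) D forget Z) d"
    proof
      show "lan_fibre Z d ` PSet (sum_psh Z) d \<subseteq> PSet (lan (oriented D) D forget Z) d"
      proof
        fix X assume "X \<in> lan_fibre Z d ` PSet (sum_psh Z) d"
        then obtain l where l: "l \<in> PSet (sum_psh Z) d" "X = lan_fibre Z d l" by blast
        note u = lan_normal[OF Z d l(1)]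
        then have "X = lan_rel (oriented D) D forget Z d `` {lan_normal d l}" using cl l by simp
        then show "X \<in> PSet (lan (oriented D) D forget Z) d" using u(1) by (simp add: lan_PSet quotientI)
      qed
      show "PSet (lan (oriented D) D forget Z) d \<subseteq> lan_fibre Z d ` PSet (sum_psh Z) d"
      proof
        fix X assume "X \<in> PSet (lan (oriented D) D forget Z) d"
        then obtain u where u: "u \<in> lan_el (oriented D) D forget Z d"
          "X = lan_rel (oriented D) D forget Z d `` {u}"
          unfolding lan_PSet by (rule quotientE)
        then show "X \<in> lan_fibre Z d ` PSet (sum_psh Z) d"
          using cl[OF u(1)] lan_value_sum[OF Z d u(1)] by blast
      qed
    qed
  qed
qed

text \<open>Restriction in \<open>lan\<close> precomposes all members of a class and then saturates.
  All results have the same value, and a class is an entire fibre, so the single member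
  \<open>lan_normal d' l\<close> already reaches every element of the target.\<close>

lemma lan_fibre_natural:
  assumes Z: "presheaf (oriented D) Z" and d: "d \<in> Ob D" "d' \<in> Ob D" "\<delta> \<in> Hom D d d'"
    and l: "l \<in> PSet (sum_psh Z) d'"
  shows "PMap (lan (oriented D) D forget Z) d d' \<delta> (lan_fibre Z d' l)
    = lan_fibre Z d (PMap (sum_psh Z) d d' \<delta> l)"
proof -
  let ?p = "\<lambda>(c, \<alpha>, z). (c, Comp D d d' (fst c) \<alpha> \<delta>, z)"
  have p: "?p u \<in> lan_el (oriented D) D forget Z d"
    "lan_value Z d (?p u) = PMap (sum_psh Z) d d' \<delta> (lan_value Z d' u)"
    if "u \<in> lan_el (oriented D) D forget Z d'" for u
    using that
  proof (atomize (full), cases rule: lan_elE)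
    case (1 G x \<alpha> z)
    have "Comp D d d' G \<alpha> \<delta> \<in> Hom D d G" using Comp_Hom 1 d by blast
    moreover have "PMap (sum_psh Z) d G (Comp D d d' G \<alpha> \<delta>) (x, z)
        = PMap (sum_psh Z) d d' \<delta> (PMap (sum_psh Z) d' G \<alpha> (x, z))"
      using presheaf_sum_psh[OF Z] d 1 unfolding presheaf_def by blast
    ultimately show "?p u \<in> lan_el (oriented D) D forget Z d \<and>
        lan_value Z d (?p u) = PMap (sum_psh Z) d d' \<delta> (lan_value Z d' u)"
      using 1 by (simp add: lan_el_def forget_def Ob_oriented lan_value_def)
  qed
  have ne: "lan_normal d' l \<in> lan_fibre Z d' l"
    using lan_normal[OF Z d(2) l] by (simp add: lan_fibre_def)
  have "PMap (lan (oriented D) D forget Z) d d' \<delta> (lan_fibre Z d' l)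
      = lan_rel (oriented D) D forget Z d `` (?p ` lan_fibre Z d' l)"
    unfolding lan_def forget_def psh.simps func.simps by (rule arg_cong[of _ _ "Image _"]) force
  also have "\<dots> = lan_fibre Z d (PMap (sum_psh Z) d d' \<delta> l)"
  proof
    show "lan_rel (oriented D) D forget Z d `` (?p ` lan_fibre Z d' l)
        \<subseteq> lan_fibre Z d (PMap (sum_psh Z) d d' \<delta> l)"
      using p(2) by (auto simp: lan_rel_iff[OF Z d(1)] lan_fibre_def)
    show "lan_fibre Z d (PMap (sum_psh Z) d d' \<delta> l)
        \<subseteq> lan_rel (oriented D) D forget Z d `` (?p ` lan_fibre Z d' l)"
    proof
      fix v assume v: "v \<in> lan_fibre Z d (PMap (sum_psh Z) d d' \<delta> l)"
      have "lan_normal d' l \<in> lan_el (oriented D) D forget Z d'" "lan_value Z d' (lan_normal d' l) = l"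
        using ne by (auto simp: lan_fibre_def)
      then have "(?p (lan_normal d' l), v) \<in> lan_rel (oriented D) D forget Z d"
        using p v unfolding lan_rel_iff[OF Z d(1)] lan_fibre_def by simp
      then show "v \<in> lan_rel (oriented D) D forget Z d `` (?p ` lan_fibre Z d' l)"
        using ne by blast
    qed
  qed
  finally show ?thesis .
qed

theorem segal_lan:
  assumes Z: "segal (oriented D) Z"
  shows "segal D (lan (oriented D) D forget Z)"
proof -
  have P: "presheaf (oriented D) Z" using Z by (simp add: segal_def)
  show ?thesis
    by (rule segal_transfer[OF Id_Hom Comp_Hom Elem_Ob Inert_Hom lan_fibre_bij[OF P]
          lan_fibre_natural[OF P] segal_sum_psh[OF Z]])
qed

end

section \<open>The three forgetful functors\<close>

lemma edge_elementary: "elementary edge_graph"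
proof -
  have "graph_iso edge_graph edge_graph (\<lambda>a\<in>{0, 1}. a, \<lambda>v\<in>{}. v)"
    using connected_is_graph[OF edge_graph_connected]
    by (intro graph_isoI) (auto simp: edge_graph_simps bij_betw_def)
  then show ?thesis by (auto simp: elementary_def isomorphic_def)
qed

lemma graph_pattern_Utilde: "graph_pattern Utilde"
  by standard (auto simp: Utilde_def edge_graph_connected edge_elementary)

lemma graph_pattern_U: "graph_pattern U"
  by standard (auto simp: U_def edge_graph_connected edge_elementary edge_graph_simps U_hom_eq_Utilde_hom)

text \<open>A full subpattern keeps the homs, composites and inert maps, so trees inherit
  substitution from \<open>U\<close>.\<close>

lemma graph_pattern_U0: "graph_pattern U0"
  by standard (auto simp: U0_def full_subpattern_def U_def edge_graph_connected edge_elementary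
      edge_graph_simps U_hom_eq_Utilde_hom is_tree_def)

text \<open>Being a tree concerns the underlying graph alone, so restricting to trees commutes with
  adding orientations.\<close>

lemma Gsc_eq: "Gsc = oriented U0"
  by (auto simp: Gsc_def U0_def full_subpattern_def oriented_def)

theorem theorem6p23:
  fixes Z :: "(orgraph, gmap, 'x) psh"
  shows "(segal Gsc Z \<longrightarrow> segal U0 (lan Gsc U0 forget Z)) \<and>
    (segal (oriented U) Z \<longrightarrow> segal U (lan (oriented U) U forget Z)) \<and>
    (segal (oriented Utilde) Z \<longrightarrow> segal Utilde (lan (oriented Utilde) Utilde forget Z))"
  unfolding Gsc_eq
  by (intro conjI impI graph_pattern.segal_lan graph_pattern_U0 graph_pattern_U graph_pattern_Utilde)

end
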